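(* Let $k$ be a commutative ring, $H$ a Hopf algebra over $k$ with bijective antipode $S_H$, $A$ a left $H$-module algebra and $\mathcal{C}$ an $(H,A)$-coring with left dual ring ${}'\mathcal{C}$. (1) ${}'\mathcal{C}$ is a left $(H,A)$-bimodule, with $A$-biaction $(af)(c)=f(c\blacktriangleleft a)$, $(fa)(c)=f(c)a$ and $H$-action $(hf)(c)=h_2.f(S_H^{-1}(h_1).c)$ for all $a\in A$, $h\in H$, $c\in\mathcal{C}$, $f\in{}'\mathcal{C}$. (2) With this $H$-action, ${}'\mathcal{C}$ is a left $H$-module algebra (so the smash product ${}'\mathcal{C}\#H$ can be formed). (3) The algebra homomorphism $i:A\to{}'\mathcal{C}$ defined by $i(a)(c)=\epsilon_{\mathcal{C}}(c)a$ is a homomorphism of $H$-modules, i.e. a homomorphism of $H$-module algebras. Moreover $af=i(a)\#f$ and $fa=f\#i(a)$ for all $a\in A$, $f\in{}'\mathcal{C}$.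
   Context: Sweedler notation with summation suppressed is used: $\Delta_H(h)=h_1\otimes h_2$, $\Delta_{\mathcal C}(c)=c_1\otimes_Ac_2$; $\epsilon_H$ is the counit of $H$. A left $H$-module algebra is a $k$-algebra $A$ with a left $H$-module structure such that $h.(aa')=(h_1.a)(h_2.a')$ and $h.1_A=\epsilon_H(h)1_A$. A left $(H,A)$-bimodule is an $A$-bimodule and left $H$-module $M$ with $h(am)=(h_1.a)(h_2m)$ and $h(ma)=(h_1m)(h_2.a)$. For left $(H,A)$-bimodules $M,N$, $H$ acts on $M\otimes_AN$ diagonally: $h(m\otimes_An)=h_1m\otimes_Ah_2n$. An $A$-coring is a coassociative counital coalgebra $(\mathcal C,\Delta_{\mathcal C},\epsilon_{\mathcal C})$ in the monoidal category of $A$-bimodules; its left and right $A$-actions are denoted $\blacktriangleright$ and $\blacktriangleleft$. An $(H,A)$-coring is an $A$-coring $\mathcal C$ that is also a left $(H,A)$-bimodule (with the same $A$-bimodule structure) such that $\Delta_{\mathcal C}:\mathcal C\to\mathcal C\otimes_A\mathcal C$ and $\epsilon_{\mathcal C}:\mathcal C\to A$ are $H$-linear. The left dual ring ${}'\mathcal C$ is the set of left $A$-linear maps $\mathcal C\to A$ with product $(f\#g)(c)=g(c_1\blacktriangleleft f(c_2))$ and unit $\epsilon_{\mathcal C}$; it is an associative $k$-algebra. *)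

theory Defs
  imports "HOL-Algebra.Module" "HOL-Algebra.Free_Abelian_Groups"
begin

section \<open>Algebras and (bi)modules over a commutative ring\<close>

text \<open>All structures are carrier based, so zero rings and zero modules are allowed.
  As for modules in HOL-Algebra, the ring multiplication and unit fields of a record that is
  used only as a module carry no meaning.\<close>

record ('k, 'a, 'm) bimod = "('k, 'm) module" +
  lact :: "'a \<Rightarrow> 'm \<Rightarrow> 'm" (infixl \<open>\<triangleright>\<index>\<close> 70)
  ract :: "'m \<Rightarrow> 'a \<Rightarrow> 'm" (infixl \<open>\<triangleleft>\<index>\<close> 70)

locale k_algebra = module K A + A: ring A
  for K :: "('k, 'x) ring_scheme" and A :: "('k, 'a, 'y) module_scheme" +
  assumes smult_mult_left:
      "\<lbrakk>r \<in> carrier K; a \<in> carrier A; b \<in> carrier A\<rbrakk>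
        \<Longrightarrow> (r \<odot>\<^bsub>A\<^esub> a) \<otimes>\<^bsub>A\<^esub> b = r \<odot>\<^bsub>A\<^esub> (a \<otimes>\<^bsub>A\<^esub> b)"
    and smult_mult_right:
      "\<lbrakk>r \<in> carrier K; a \<in> carrier A; b \<in> carrier A\<rbrakk>
        \<Longrightarrow> a \<otimes>\<^bsub>A\<^esub> (r \<odot>\<^bsub>A\<^esub> b) = r \<odot>\<^bsub>A\<^esub> (a \<otimes>\<^bsub>A\<^esub> b)"

locale left_module = A: k_algebra K A + M: module K M
  for K :: "('k, 'x) ring_scheme" and A :: "('k, 'a, 'y) module_scheme"
    and M :: "('k, 'm, 'z) module_scheme" and act :: "'a \<Rightarrow> 'm \<Rightarrow> 'm" +
  assumes act_closed: "\<lbrakk>a \<in> carrier A; m \<in> carrier M\<rbrakk> \<Longrightarrow> act a m \<in> carrier M"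
    and act_add_left: "\<lbrakk>a \<in> carrier A; b \<in> carrier A; m \<in> carrier M\<rbrakk>
        \<Longrightarrow> act (a \<oplus>\<^bsub>A\<^esub> b) m = act a m \<oplus>\<^bsub>M\<^esub> act b m"
    and act_add_right: "\<lbrakk>a \<in> carrier A; m \<in> carrier M; n \<in> carrier M\<rbrakk>
        \<Longrightarrow> act a (m \<oplus>\<^bsub>M\<^esub> n) = act a m \<oplus>\<^bsub>M\<^esub> act a n"
    and act_smult_left: "\<lbrakk>r \<in> carrier K; a \<in> carrier A; m \<in> carrier M\<rbrakk>
        \<Longrightarrow> act (r \<odot>\<^bsub>A\<^esub> a) m = r \<odot>\<^bsub>M\<^esub> act a m"
    and act_smult_right: "\<lbrakk>r \<in> carrier K; a \<in> carrier A; m \<in> carrier M\<rbrakk>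
        \<Longrightarrow> act a (r \<odot>\<^bsub>M\<^esub> m) = r \<odot>\<^bsub>M\<^esub> act a m"
    and act_mult: "\<lbrakk>a \<in> carrier A; b \<in> carrier A; m \<in> carrier M\<rbrakk>
        \<Longrightarrow> act (a \<otimes>\<^bsub>A\<^esub> b) m = act a (act b m)"
    and act_one: "m \<in> carrier M \<Longrightarrow> act \<one>\<^bsub>A\<^esub> m = m"

locale right_module = A: k_algebra K A + M: module K M
  for K :: "('k, 'x) ring_scheme" and A :: "('k, 'a, 'y) module_scheme"
    and M :: "('k, 'm, 'z) module_scheme" and act :: "'m \<Rightarrow> 'a \<Rightarrow> 'm" +
  assumes act_closed: "\<lbrakk>m \<in> carrier M; a \<in> carrier A\<rbrakk> \<Longrightarrow> act m a \<in> carrier M"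
    and act_add_left: "\<lbrakk>m \<in> carrier M; n \<in> carrier M; a \<in> carrier A\<rbrakk>
        \<Longrightarrow> act (m \<oplus>\<^bsub>M\<^esub> n) a = act m a \<oplus>\<^bsub>M\<^esub> act n a"
    and act_add_right: "\<lbrakk>m \<in> carrier M; a \<in> carrier A; b \<in> carrier A\<rbrakk>
        \<Longrightarrow> act m (a \<oplus>\<^bsub>A\<^esub> b) = act m a \<oplus>\<^bsub>M\<^esub> act m b"
    and act_smult_left: "\<lbrakk>r \<in> carrier K; m \<in> carrier M; a \<in> carrier A\<rbrakk>
        \<Longrightarrow> act (r \<odot>\<^bsub>M\<^esub> m) a = r \<odot>\<^bsub>M\<^esub> act m a"
    and act_smult_right: "\<lbrakk>r \<in> carrier K; m \<in> carrier M; a \<in> carrier A\<rbrakk>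
        \<Longrightarrow> act m (r \<odot>\<^bsub>A\<^esub> a) = r \<odot>\<^bsub>M\<^esub> act m a"
    and act_mult: "\<lbrakk>m \<in> carrier M; a \<in> carrier A; b \<in> carrier A\<rbrakk>
        \<Longrightarrow> act m (a \<otimes>\<^bsub>A\<^esub> b) = act (act m a) b"
    and act_one: "m \<in> carrier M \<Longrightarrow> act m \<one>\<^bsub>A\<^esub> = m"

locale bimodule = L: left_module K A M "lact M" + R: right_module K A M "ract M"
  for K :: "('k, 'x) ring_scheme" and A :: "('k, 'a, 'y) module_scheme"
    and M :: "('k, 'a, 'm, 'z) bimod_scheme" +
  assumes lact_ract_assoc: "\<lbrakk>a \<in> carrier A; m \<in> carrier M; b \<in> carrier A\<rbrakk>
        \<Longrightarrow> (a \<triangleright>\<^bsub>M\<^esub> m) \<triangleleft>\<^bsub>M\<^esub> b = a \<triangleright>\<^bsub>M\<^esub> (m \<triangleleft>\<^bsub>M\<^esub> b)"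

definition regular_bimod :: "('k, 'a, 'y) module_scheme \<Rightarrow> ('k, 'a, 'a) bimod" where
  "regular_bimod A = \<lparr>carrier = carrier A, monoid.mult = mult A, one = \<one>\<^bsub>A\<^esub>,
     ring.zero = \<zero>\<^bsub>A\<^esub>,
     add = add A, smult = smult A, lact = mult A, ract = mult A\<rparr>"

text \<open>A \<open>k\<close>-module as a symmetric \<open>k\<close>-bimodule, so that tensor products over \<open>k\<close> are an
  instance of the tensor product of bimodules below.\<close>

definition sym_bimod :: "('k, 'm, 'y) module_scheme \<Rightarrow> ('k, 'k, 'm) bimod" where
  "sym_bimod M = \<lparr>carrier = carrier M, monoid.mult = mult M, one = \<one>\<^bsub>M\<^esub>,
     ring.zero = \<zero>\<^bsub>M\<^esub>,
     add = add M, smult = smult M, lact = smult M, ract = (\<lambda>m r. r \<odot>\<^bsub>M\<^esub> m)\<rparr>"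

definition left_linear ::
  "('a, 'x) ring_scheme \<Rightarrow> ('k, 'a, 'm, 'y) bimod_scheme \<Rightarrow> ('k, 'a, 'n, 'z) bimod_scheme
    \<Rightarrow> ('m \<Rightarrow> 'n) set" where
  "left_linear A M N = {f \<in> hom (add_monoid M) (add_monoid N).
     \<forall>a \<in> carrier A. \<forall>m \<in> carrier M. f (a \<triangleright>\<^bsub>M\<^esub> m) = a \<triangleright>\<^bsub>N\<^esub> f m}"

definition right_linear ::
  "('a, 'x) ring_scheme \<Rightarrow> ('k, 'a, 'm, 'y) bimod_scheme \<Rightarrow> ('k, 'a, 'n, 'z) bimod_scheme
    \<Rightarrow> ('m \<Rightarrow> 'n) set" where
  "right_linear A M N = {f \<in> hom (add_monoid M) (add_monoid N).
     \<forall>m \<in> carrier M. \<forall>a \<in> carrier A. f (m \<triangleleft>\<^bsub>M\<^esub> a) = f m \<triangleleft>\<^bsub>N\<^esub> a}"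


section \<open>Tensor products\<close>

text \<open>\<open>M \<otimes>\<^sub>A N\<close> is the free abelian group on \<open>M \<times> N\<close> modulo the subgroup generated by the
  biadditivity and balancing relations; its elements are cosets of formal integer combinations
  of pairs.\<close>

type_synonym ('m, 'n) tens = "('m \<times> 'n \<Rightarrow>\<^sub>0 int) set"

definition tensor_relations ::
  "('a, 'x) ring_scheme \<Rightarrow> ('k, 'a, 'm, 'y) bimod_scheme \<Rightarrow> ('k, 'a, 'n, 'z) bimod_scheme
    \<Rightarrow> ('m \<times> 'n \<Rightarrow>\<^sub>0 int) set" where
  "tensor_relations A M N =
     {frag_of (m \<oplus>\<^bsub>M\<^esub> m', n) - frag_of (m, n) - frag_of (m', n) | m m' n.
        m \<in> carrier M \<and> m' \<in> carrier M \<and> n \<in> carrier N} \<union>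
     {frag_of (m, n \<oplus>\<^bsub>N\<^esub> n') - frag_of (m, n) - frag_of (m, n') | m n n'.
        m \<in> carrier M \<and> n \<in> carrier N \<and> n' \<in> carrier N} \<union>
     {frag_of (m \<triangleleft>\<^bsub>M\<^esub> a, n) - frag_of (m, a \<triangleright>\<^bsub>N\<^esub> n) | m a n.
        m \<in> carrier M \<and> a \<in> carrier A \<and> n \<in> carrier N}"

definition tensor_group ::
  "('a, 'x) ring_scheme \<Rightarrow> ('k, 'a, 'm, 'y) bimod_scheme \<Rightarrow> ('k, 'a, 'n, 'z) bimod_scheme
    \<Rightarrow> ('m, 'n) tens monoid" where
  "tensor_group A M N =
     (let F = free_Abelian_group (carrier M \<times> carrier N)
      in F Mod generate F (tensor_relations A M N))"

definition pure_tensor ::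
  "('a, 'x) ring_scheme \<Rightarrow> ('k, 'a, 'm, 'y) bimod_scheme \<Rightarrow> ('k, 'a, 'n, 'z) bimod_scheme
    \<Rightarrow> 'm \<Rightarrow> 'n \<Rightarrow> ('m, 'n) tens" where
  "pure_tensor A M N m n =
     (let F = free_Abelian_group (carrier M \<times> carrier N)
      in generate F (tensor_relations A M N) #>\<^bsub>F\<^esub> frag_of (m, n))"

text \<open>\<open>tensor_eval G b\<close> is the group homomorphism \<open>M \<otimes>\<^sub>A N \<rightarrow> G\<close> induced by \<open>b\<close>, i.e.
  \<open>m \<otimes> n \<mapsto> b m n\<close>, computed on a representative of the coset.  It is meaningful only
  for \<open>b\<close> biadditive and \<open>A\<close>-balanced, where the choice is irrelevant.
  This is how Sweedler notation is expressed: for \<open>\<Delta>(c) = c\<^sub>1 \<otimes> c\<^sub>2\<close>, the element \<open>b(c\<^sub>1, c\<^sub>2)\<close>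
  is \<open>tensor_eval G b (\<Delta> c)\<close>.\<close>

definition tensor_eval ::
  "('g, 'x) ring_scheme \<Rightarrow> ('m \<Rightarrow> 'n \<Rightarrow> 'g) \<Rightarrow> ('m, 'n) tens \<Rightarrow> 'g" where
  "tensor_eval G b t =
     (let x = (SOME x. x \<in> t)
      in \<Oplus>\<^bsub>G\<^esub>p \<in> Poly_Mapping.keys x. [Poly_Mapping.lookup x p] \<cdot>\<^bsub>G\<^esub> b (fst p) (snd p))"

definition tensor_add ::
  "('a, 'x) ring_scheme \<Rightarrow> ('k, 'a, 'm, 'y) bimod_scheme \<Rightarrow> ('k, 'a, 'n, 'z) bimod_scheme
    \<Rightarrow> ('m, 'n) tens ring" where
  "tensor_add A M N = \<lparr>carrier = carrier (tensor_group A M N), monoid.mult = undefined,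
     one = undefined, ring.zero = one (tensor_group A M N), add = mult (tensor_group A M N)\<rparr>"

definition tensor ::
  "('a, 'x) ring_scheme \<Rightarrow> ('k, 'a, 'm, 'y) bimod_scheme \<Rightarrow> ('k, 'a, 'n, 'z) bimod_scheme
    \<Rightarrow> ('k, 'a, ('m, 'n) tens) bimod" where
  "tensor A M N =
     (let T = tensor_add A M N in
      \<lparr>carrier = carrier T, monoid.mult = mult T, one = one T, ring.zero = \<zero>\<^bsub>T\<^esub>, add = add T,
       smult = (\<lambda>r. tensor_eval T (\<lambda>m n. pure_tensor A M N (r \<odot>\<^bsub>M\<^esub> m) n)),
       lact = (\<lambda>a. tensor_eval T (\<lambda>m n. pure_tensor A M N (a \<triangleright>\<^bsub>M\<^esub> m) n)),
       ract = (\<lambda>t a. tensor_eval T (\<lambda>m n. pure_tensor A M N m (n \<triangleleft>\<^bsub>N\<^esub> a)) t)\<rparr>)"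


section \<open>Hopf algebras and module algebras\<close>

record ('k, 'h) hopf = "('k, 'h) module" +
  hcomult :: "'h \<Rightarrow> ('h, 'h) tens"
  hcounit :: "'h \<Rightarrow> 'k"
  antipode :: "'h \<Rightarrow> 'h"

text \<open>Coassociativity is stated in \<open>H \<otimes> (H \<otimes> H)\<close>: the left-hand side is
  \<open>\<Sum> h\<^sub>1\<^sub>1 \<otimes> (h\<^sub>1\<^sub>2 \<otimes> h\<^sub>2)\<close>, i.e. \<open>(\<Delta> \<otimes> id) \<Delta> h\<close> followed by the associativity isomorphism,
  the right-hand side is \<open>(id \<otimes> \<Delta>) \<Delta> h\<close>.\<close>

locale hopf_algebra = k_algebra K H
  for K :: "('k, 'x) ring_scheme" and H :: "('k, 'h, 'y) hopf_scheme" +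
  assumes hcomult_linear:
      "hcomult H \<in> left_linear K (sym_bimod H) (tensor K (sym_bimod H) (sym_bimod H))"
    and hcoassoc: "h \<in> carrier H \<Longrightarrow>
      tensor_eval (tensor K (sym_bimod H) (tensor K (sym_bimod H) (sym_bimod H)))
        (\<lambda>x y. tensor_eval (tensor K (sym_bimod H) (tensor K (sym_bimod H) (sym_bimod H)))
           (\<lambda>u v. pure_tensor K (sym_bimod H) (tensor K (sym_bimod H) (sym_bimod H)) u
              (pure_tensor K (sym_bimod H) (sym_bimod H) v y))
           (hcomult H x))
        (hcomult H h) =
      tensor_eval (tensor K (sym_bimod H) (tensor K (sym_bimod H) (sym_bimod H)))
        (\<lambda>x y. pure_tensor K (sym_bimod H) (tensor K (sym_bimod H) (sym_bimod H)) x
           (hcomult H y))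
        (hcomult H h)"
    and hcounit_hom: "hcounit H \<in> ring_hom H K"
    and hcounit_smult: "\<lbrakk>r \<in> carrier K; h \<in> carrier H\<rbrakk>
      \<Longrightarrow> hcounit H (r \<odot>\<^bsub>H\<^esub> h) = r \<otimes>\<^bsub>K\<^esub> hcounit H h"
    and hcounit_left: "h \<in> carrier H \<Longrightarrow>
      tensor_eval H (\<lambda>x y. hcounit H x \<odot>\<^bsub>H\<^esub> y) (hcomult H h) = h"
    and hcounit_right: "h \<in> carrier H \<Longrightarrow>
      tensor_eval H (\<lambda>x y. hcounit H y \<odot>\<^bsub>H\<^esub> x) (hcomult H h) = h"
    and hcomult_one:
      "hcomult H \<one>\<^bsub>H\<^esub> = pure_tensor K (sym_bimod H) (sym_bimod H) \<one>\<^bsub>H\<^esub> \<one>\<^bsub>H\<^esub>"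
    and hcomult_mult: "\<lbrakk>g \<in> carrier H; h \<in> carrier H\<rbrakk> \<Longrightarrow>
      hcomult H (g \<otimes>\<^bsub>H\<^esub> h) =
      tensor_eval (tensor K (sym_bimod H) (sym_bimod H))
        (\<lambda>x y. tensor_eval (tensor K (sym_bimod H) (sym_bimod H))
           (\<lambda>u v. pure_tensor K (sym_bimod H) (sym_bimod H) (x \<otimes>\<^bsub>H\<^esub> u) (y \<otimes>\<^bsub>H\<^esub> v))
           (hcomult H h))
        (hcomult H g)"
    and antipode_linear: "antipode H \<in> left_linear K (sym_bimod H) (sym_bimod H)"
    and antipode_left: "h \<in> carrier H \<Longrightarrow>
      tensor_eval H (\<lambda>x y. antipode H x \<otimes>\<^bsub>H\<^esub> y) (hcomult H h) = hcounit H h \<odot>\<^bsub>H\<^esub> \<one>\<^bsub>H\<^esub>"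
    and antipode_right: "h \<in> carrier H \<Longrightarrow>
      tensor_eval H (\<lambda>x y. x \<otimes>\<^bsub>H\<^esub> antipode H y) (hcomult H h) = hcounit H h \<odot>\<^bsub>H\<^esub> \<one>\<^bsub>H\<^esub>"

locale H_module_algebra =
  H: hopf_algebra K H + A: k_algebra K A + left_module K H A act
  for K :: "('k, 'x) ring_scheme" and H :: "('k, 'h, 'y) hopf_scheme"
    and A :: "('k, 'a, 'z) module_scheme" and act :: "'h \<Rightarrow> 'a \<Rightarrow> 'a" +
  assumes act_prod: "\<lbrakk>h \<in> carrier H; a \<in> carrier A; b \<in> carrier A\<rbrakk> \<Longrightarrow>
      act h (a \<otimes>\<^bsub>A\<^esub> b) = tensor_eval A (\<lambda>x y. act x a \<otimes>\<^bsub>A\<^esub> act y b) (hcomult H h)"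
    and act_unit: "h \<in> carrier H \<Longrightarrow> act h \<one>\<^bsub>A\<^esub> = hcounit H h \<odot>\<^bsub>A\<^esub> \<one>\<^bsub>A\<^esub>"

definition H_module_algebra_hom ::
  "('k, 'x) ring_scheme \<Rightarrow> ('k, 'h, 'y) hopf_scheme
    \<Rightarrow> ('k, 'a, 'z) module_scheme \<Rightarrow> ('h \<Rightarrow> 'a \<Rightarrow> 'a)
    \<Rightarrow> ('k, 'b, 'w) module_scheme \<Rightarrow> ('h \<Rightarrow> 'b \<Rightarrow> 'b) \<Rightarrow> ('a \<Rightarrow> 'b) set" where
  "H_module_algebra_hom K H A actA B actB = {f \<in> ring_hom A B.
     (\<forall>r \<in> carrier K. \<forall>a \<in> carrier A. f (r \<odot>\<^bsub>A\<^esub> a) = r \<odot>\<^bsub>B\<^esub> f a) \<and>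
     (\<forall>h \<in> carrier H. \<forall>a \<in> carrier A. f (actA h a) = actB h (f a))}"

locale HA_bimodule =
  A: H_module_algebra K H A actA + H_mod: left_module K H M actM + bimod: bimodule K A M
  for K :: "('k, 'x) ring_scheme" and H :: "('k, 'h, 'y) hopf_scheme"
    and A :: "('k, 'a, 'z) module_scheme" and actA :: "'h \<Rightarrow> 'a \<Rightarrow> 'a"
    and M :: "('k, 'a, 'm, 'w) bimod_scheme" and actM :: "'h \<Rightarrow> 'm \<Rightarrow> 'm" +
  assumes act_lact: "\<lbrakk>h \<in> carrier H; a \<in> carrier A; m \<in> carrier M\<rbrakk> \<Longrightarrow>
      actM h (a \<triangleright>\<^bsub>M\<^esub> m) = tensor_eval M (\<lambda>x y. actA x a \<triangleright>\<^bsub>M\<^esub> actM y m) (hcomult H h)"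
    and act_ract: "\<lbrakk>h \<in> carrier H; m \<in> carrier M; a \<in> carrier A\<rbrakk> \<Longrightarrow>
      actM h (m \<triangleleft>\<^bsub>M\<^esub> a) = tensor_eval M (\<lambda>x y. actM x m \<triangleleft>\<^bsub>M\<^esub> actA y a) (hcomult H h)"

text \<open>The diagonal action \<open>h (m \<otimes> n) = h\<^sub>1 m \<otimes> h\<^sub>2 n\<close>.  The evaluation over \<open>M \<otimes>\<^sub>A N\<close> must be the
  outer one: for fixed \<open>x, y \<in> H\<close> the map \<open>(m, n) \<mapsto> x m \<otimes> y n\<close> is not \<open>A\<close>-balanced.\<close>

definition tensor_act ::
  "('k, 'h, 'w) hopf_scheme \<Rightarrow> ('a, 'x) ring_scheme
    \<Rightarrow> ('k, 'a, 'm, 'y) bimod_scheme \<Rightarrow> ('h \<Rightarrow> 'm \<Rightarrow> 'm)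
    \<Rightarrow> ('k, 'a, 'n, 'z) bimod_scheme \<Rightarrow> ('h \<Rightarrow> 'n \<Rightarrow> 'n)
    \<Rightarrow> 'h \<Rightarrow> ('m, 'n) tens \<Rightarrow> ('m, 'n) tens" where
  "tensor_act H A M actM N actN h =
     tensor_eval (tensor A M N)
       (\<lambda>m n. tensor_eval (tensor A M N)
          (\<lambda>x y. pure_tensor A M N (actM x m) (actN y n)) (hcomult H h))"


section \<open>Corings and the left dual ring\<close>

record ('k, 'a, 'c) coring = "('k, 'a, 'c) bimod" +
  comult :: "'c \<Rightarrow> ('c, 'c) tens"
  counit :: "'c \<Rightarrow> 'a"

locale A_coring = bimodule K A C
  for K :: "('k, 'x) ring_scheme" and A :: "('k, 'a, 'y) module_scheme"
    and C :: "('k, 'a, 'c, 'z) coring_scheme" +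
  assumes comult_bilinear:
      "comult C \<in> left_linear A C (tensor A C C) \<inter> right_linear A C (tensor A C C)"
    and counit_bilinear:
      "counit C \<in> left_linear A C (regular_bimod A) \<inter> right_linear A C (regular_bimod A)"
    and coassoc: "c \<in> carrier C \<Longrightarrow>
      tensor_eval (tensor A C (tensor A C C))
        (\<lambda>x y. tensor_eval (tensor A C (tensor A C C))
           (\<lambda>u v. pure_tensor A C (tensor A C C) u (pure_tensor A C C v y))
           (comult C x))
        (comult C c) =
      tensor_eval (tensor A C (tensor A C C))
        (\<lambda>x y. pure_tensor A C (tensor A C C) x (comult C y))
        (comult C c)"
    and counit_left: "c \<in> carrier C \<Longrightarrow>
      tensor_eval C (\<lambda>x y. counit C x \<triangleright>\<^bsub>C\<^esub> y) (comult C c) = c"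
    and counit_right: "c \<in> carrier C \<Longrightarrow>
      tensor_eval C (\<lambda>x y. x \<triangleleft>\<^bsub>C\<^esub> counit C y) (comult C c) = c"

locale HA_coring = A_coring K A C + HA_bimodule K H A actA C actC
  for K :: "('k, 'x) ring_scheme" and H :: "('k, 'h, 'y) hopf_scheme"
    and A :: "('k, 'a, 'z) module_scheme" and actA :: "'h \<Rightarrow> 'a \<Rightarrow> 'a"
    and C :: "('k, 'a, 'c, 'w) coring_scheme" and actC :: "'h \<Rightarrow> 'c \<Rightarrow> 'c" +
  assumes comult_H_linear: "\<lbrakk>h \<in> carrier H; c \<in> carrier C\<rbrakk> \<Longrightarrow>
      comult C (actC h c) = tensor_act H A C actC C actC h (comult C c)"
    and counit_H_linear: "\<lbrakk>h \<in> carrier H; c \<in> carrier C\<rbrakk> \<Longrightarrow>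
      counit C (actC h c) = actA h (counit C c)"

text \<open>The left dual ring, with product \<open>(f # g)(c) = g (c\<^sub>1 \<triangleleft> f c\<^sub>2)\<close> and \<open>A\<close>-actions
  \<open>(a f)(c) = f (c \<triangleleft> a)\<close>, \<open>(f a)(c) = (f c) a\<close>.  Its elements are functions on
  \<^term>\<open>carrier C\<close>, made extensional so that equality is pointwise equality there.\<close>

definition left_dual ::
  "('k, 'a, 'y) module_scheme \<Rightarrow> ('k, 'a, 'c, 'z) coring_scheme \<Rightarrow> ('k, 'a, 'c \<Rightarrow> 'a) bimod" where
  "left_dual A C =
     \<lparr>carrier = left_linear A C (regular_bimod A) \<inter> extensional (carrier C),
      monoid.mult = (\<lambda>f g. \<lambda>c \<in> carrier C. tensor_eval A (\<lambda>x y. g (x \<triangleleft>\<^bsub>C\<^esub> f y)) (comult C c)),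
      one = restrict (counit C) (carrier C),
      ring.zero = (\<lambda>c \<in> carrier C. \<zero>\<^bsub>A\<^esub>),
      add = (\<lambda>f g. \<lambda>c \<in> carrier C. f c \<oplus>\<^bsub>A\<^esub> g c),
      smult = (\<lambda>r f. \<lambda>c \<in> carrier C. r \<odot>\<^bsub>A\<^esub> f c),
      lact = (\<lambda>a f. \<lambda>c \<in> carrier C. f (c \<triangleleft>\<^bsub>C\<^esub> a)),
      ract = (\<lambda>f a. \<lambda>c \<in> carrier C. f c \<otimes>\<^bsub>A\<^esub> a)\<rparr>"

text \<open>\<open>(h f)(c) = h\<^sub>2 . f (S\<^sup>-\<^sup>1(h\<^sub>1) . c)\<close>\<close>

definition dual_act ::
  "('k, 'h, 'x) hopf_scheme \<Rightarrow> ('k, 'a, 'y) module_scheme \<Rightarrow> ('h \<Rightarrow> 'a \<Rightarrow> 'a)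
    \<Rightarrow> ('k, 'a, 'c, 'z) coring_scheme \<Rightarrow> ('h \<Rightarrow> 'c \<Rightarrow> 'c)
    \<Rightarrow> 'h \<Rightarrow> ('c \<Rightarrow> 'a) \<Rightarrow> ('c \<Rightarrow> 'a)" where
  "dual_act H A actA C actC h f =
     (\<lambda>c \<in> carrier C. tensor_eval A
        (\<lambda>x y. actA y (f (actC (inv_into (carrier H) (antipode H) x) c))) (hcomult H h))"

definition dual_emb ::
  "('k, 'a, 'y) module_scheme \<Rightarrow> ('k, 'a, 'c, 'z) coring_scheme \<Rightarrow> 'a \<Rightarrow> ('c \<Rightarrow> 'a)" where
  "dual_emb A C a = (\<lambda>c \<in> carrier C. counit C c \<otimes>\<^bsub>A\<^esub> a)"

end

theory Submission
  imports Defs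
begin

text \<open>Write \<open>T\<close> for the inverse of the antipode.  Since the antipode is anti-multiplicative,
  \<open>T(h\<^sub>2) h\<^sub>1 = \<epsilon>(h) 1 = h\<^sub>2 T(h\<^sub>1)\<close>, which with the multiplicativity
  of \<open>\<Delta>\<close> gives \<open>\<Delta>(T(h)) = T(h\<^sub>2) \<otimes> T(h\<^sub>1)\<close>.  Hence \<open>T(h)\<close> acts on products and on \<open>\<Delta>(c)\<close> with its two legs
  interchanged, and each identity about \<open>(h f)(c) = h\<^sub>2 . f(T(h\<^sub>1) c)\<close> comes down to cancelling one
  adjacent pair of legs; for the product,
  \<open>h\<^sub>5 . g(T(h\<^sub>4) c\<^sub>1 \<triangleleft> T(h\<^sub>3) h\<^sub>2 . f(T(h\<^sub>1) c\<^sub>2)) = h\<^sub>3 . g(T(h\<^sub>2) c\<^sub>1 \<triangleleft> f(T(h\<^sub>1) c\<^sub>2))\<close>.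
  The \<open>(H, A)\<close>-bimodule axioms then follow from the \<open>H\<close>-module algebra structure, because the
  \<open>A\<close>-actions are multiplications by elements \<open>i(a)\<close> and \<open>h i(a) = i(h a)\<close>.\<close>

section \<open>Evaluation of tensors\<close>

text \<open>Two kinds of sums are nested throughout, over the tensor square of \<open>H\<close> over
  \<open>K\<close> and over that of \<open>C\<close> over \<open>A\<close>, and they cannot be
  treated alike. For fixed legs \<open>x\<close>, \<open>y\<close> of \<open>h\<close>, a map like
  \<open>(m, n) \<mapsto> b (x m) (y n)\<close> on \<open>C \<times> C\<close> need not be
  \<open>A\<close>-balanced, so its sum over a class may depend on the representative and no
  universal property applies to it. What saves the computations is that \<open>tensor_eval\<close>
  uses one fixed representative per class: closure, congruence, composition with additive maps and
  interchange of two sums are facts about finite sums and hold for arbitrary closed integrands.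
  Balancedness enters only where the class itself changes: for sums and pure tensors, for the
  coproducts of \<open>g h\<close>, \<open>a c\<close>, \<open>c a\<close> and \<open>h c\<close>,
  and for coassociativity. Over \<open>K\<close> it amounts to bilinearity, which nested
  introduction rules can check; over \<open>A\<close> it is verified by hand for the few integrands
  that occur, chiefly \<open>g (x \<triangleleft> f y)\<close>.\<close>

definition frag_sum :: "('g, 'x) ring_scheme \<Rightarrow> ('p \<Rightarrow> 'g) \<Rightarrow> ('p \<Rightarrow>\<^sub>0 int) \<Rightarrow> 'g" where
  "frag_sum G f x = (\<Oplus>\<^bsub>G\<^esub>p \<in> Poly_Mapping.keys x. [Poly_Mapping.lookup x p] \<cdot>\<^bsub>G\<^esub> f p)"

lemma tensor_eval_frag_sum:
  "tensor_eval G b t = frag_sum G (\<lambda>p. b (fst p) (snd p)) (SOME x. x \<in> t)"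
  by (simp only: tensor_eval_def frag_sum_def Let_def)

context abelian_group
begin

lemma frag_sum_superset:
  assumes "finite B" "Poly_Mapping.keys x \<subseteq> B" "\<And>p. p \<in> B \<Longrightarrow> f p \<in> carrier G"
  shows "frag_sum G f x = (\<Oplus>p \<in> B. [Poly_Mapping.lookup x p] \<cdot> f p)"
  unfolding frag_sum_def
  by (rule add.finprod_mono_neutral_cong_left)
     (use assms in \<open>auto simp: in_keys_iff add_pow_def intro!: add.int_pow_closed[unfolded add_pow_def]\<close>)

lemma frag_sum_add:
  assumes "\<And>p. p \<in> Poly_Mapping.keys x \<Longrightarrow> f p \<in> carrier G"
    and "\<And>p. p \<in> Poly_Mapping.keys x \<Longrightarrow> g p \<in> carrier G"
  shows "frag_sum G (\<lambda>p. f p \<oplus> g p) x = frag_sum G f x \<oplus> frag_sum G g x"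
proof -
  have "frag_sum G (\<lambda>p. f p \<oplus> g p) x = (\<Oplus>p \<in> Poly_Mapping.keys x.
      [Poly_Mapping.lookup x p] \<cdot> f p \<oplus> [Poly_Mapping.lookup x p] \<cdot> g p)"
    unfolding frag_sum_def
    by (rule finsum_cong') (use assms in \<open>auto simp: add.int_pow_mult_distrib add.m_comm\<close>)
  also have "\<dots> = frag_sum G f x \<oplus> frag_sum G g x"
    unfolding frag_sum_def by (rule finsum_addf) (use assms in auto)
  finally show ?thesis .
qed

text \<open>Cancellation can make the support of \<open>x + y\<close> smaller than the union of the
  two supports, so all three sums are first taken over that union, where the extra coefficients are
  0. Together with \<open>frag_sum_of\<close> this is the extension of \<open>f\<close> to the free
  abelian group.\<close>

lemma frag_sum_hom:
  assumes f: "\<And>p. p \<in> S \<Longrightarrow> f p \<in> carrier G"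
  shows "frag_sum G f \<in> hom (free_Abelian_group S) (add_monoid G)"
proof (rule homI)
  fix x y assume "x \<in> carrier (free_Abelian_group S)" "y \<in> carrier (free_Abelian_group S)"
  then have x: "Poly_Mapping.keys x \<subseteq> S" and y: "Poly_Mapping.keys y \<subseteq> S" by auto
  let ?B = "Poly_Mapping.keys x \<union> Poly_Mapping.keys y"
  have B: "finite ?B" "\<And>p. p \<in> ?B \<Longrightarrow> f p \<in> carrier G" using f x y by auto
  have "frag_sum G f (x + y) = (\<Oplus>p \<in> ?B. [Poly_Mapping.lookup (x + y) p] \<cdot> f p)"
    by (rule frag_sum_superset[OF B(1) Poly_Mapping.keys_add B(2)])
  also have "\<dots> = (\<Oplus>p \<in> ?B. [Poly_Mapping.lookup x p] \<cdot> f p \<oplus> [Poly_Mapping.lookup y p] \<cdot> f p)"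
    by (rule finsum_cong') (use B in \<open>auto simp: lookup_add add.int_pow_mult\<close>)
  also have "\<dots> = (\<Oplus>p \<in> ?B. [Poly_Mapping.lookup x p] \<cdot> f p) \<oplus>
      (\<Oplus>p \<in> ?B. [Poly_Mapping.lookup y p] \<cdot> f p)"
    by (rule finsum_addf) (use B in auto)
  finally show "frag_sum G f (x \<otimes>\<^bsub>free_Abelian_group S\<^esub> y)
      = frag_sum G f x \<otimes>\<^bsub>add_monoid G\<^esub> frag_sum G f y"
    using frag_sum_superset[of ?B x f] frag_sum_superset[of ?B y f] B by simp
qed (use f in \<open>auto simp: frag_sum_def intro!: finsum_closed\<close>)

lemma frag_sum_of:
  assumes "f p \<in> carrier G" shows "frag_sum G f (frag_of p) = f p"
  using assms by (simp add: frag_sum_def)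

text \<open>The relations of the tensor product are written with subtraction, while
  \<open>group_hom\<close> speaks of inverses in the free abelian group; this translates between the
  two.\<close>

lemma frag_sum_diff:
  assumes "\<And>p. p \<in> S \<Longrightarrow> f p \<in> carrier G"
    and "Poly_Mapping.keys x \<subseteq> S" "Poly_Mapping.keys y \<subseteq> S"
  shows "frag_sum G f (x - y) = frag_sum G f x \<ominus> frag_sum G f y"
proof -
  interpret F: group "free_Abelian_group S" by simp
  interpret h: group_hom "free_Abelian_group S" "add_monoid G" "frag_sum G f"
    by (intro group_hom.intro group_hom_axioms.intro F.group_axioms a_group frag_sum_hom assms)
  have "frag_sum G f (x \<otimes>\<^bsub>free_Abelian_group S\<^esub> inv\<^bsub>free_Abelian_group S\<^esub> y) =
      frag_sum G f x \<otimes>\<^bsub>add_monoid G\<^esub> inv\<^bsub>add_monoid G\<^esub> frag_sum G f y"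
    using h.hom_mult h.hom_inv assms by (simp del: add_uminus_conv_diff)
  then show ?thesis using assms by (simp add: a_minus_def a_inv_def)
qed

end

lemma add_hom_finsum:
  assumes "abelian_group G" "abelian_group G'" and h: "h \<in> hom (add_monoid G) (add_monoid G')"
    and f: "\<And>p. p \<in> B \<Longrightarrow> f p \<in> carrier G" and "finite B"
  shows "h (\<Oplus>\<^bsub>G\<^esub>p \<in> B. f p) = (\<Oplus>\<^bsub>G'\<^esub>p \<in> B. h (f p))"
  using \<open>finite B\<close> f
proof (induction B)
  case empty
  interpret G: abelian_group G by fact
  interpret G': abelian_group G' by fact
  interpret h: group_hom "add_monoid G" "add_monoid G'" h
    by (intro group_hom.intro group_hom_axioms.intro G.a_group G'.a_group h)
  show ?case using h.hom_one by simp
next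
  case (insert p B)
  interpret G: abelian_group G by fact
  interpret G': abelian_group G' by fact
  have "h u \<in> carrier G'" if "u \<in> carrier G" for u using h that by (auto simp: hom_def)
  moreover have "h (u \<oplus>\<^bsub>G\<^esub> v) = h u \<oplus>\<^bsub>G'\<^esub> h v" if "u \<in> carrier G" "v \<in> carrier G" for u v
    using h that by (auto simp: hom_def)
  ultimately show ?case using insert by (simp add: Pi_def)
qed

lemma frag_sum_compose:
  assumes "abelian_group G" "abelian_group G'" and h: "h \<in> hom (add_monoid G) (add_monoid G')"
    and f: "\<And>p. p \<in> Poly_Mapping.keys x \<Longrightarrow> f p \<in> carrier G"
  shows "h (frag_sum G f x) = frag_sum G' (\<lambda>p. h (f p)) x"
proof -
  interpret G: abelian_group G by fact
  interpret G': abelian_group G' by fact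
  interpret h: group_hom "add_monoid G" "add_monoid G'" h
    by (intro group_hom.intro group_hom_axioms.intro G.a_group G'.a_group h)
  have pow: "h ([k] \<cdot>\<^bsub>G\<^esub> u) = [k] \<cdot>\<^bsub>G'\<^esub> h u" if "u \<in> carrier G" for k :: int and u
    using h.hom_int_pow[of u k] that by (simp add: add_pow_def)
  have "h (frag_sum G f x) =
      (\<Oplus>\<^bsub>G'\<^esub>p \<in> Poly_Mapping.keys x. h ([Poly_Mapping.lookup x p] \<cdot>\<^bsub>G\<^esub> f p))"
    unfolding frag_sum_def using f by (intro add_hom_finsum[OF assms(1-3)]) auto
  also have "\<dots> = frag_sum G' (\<lambda>p. h (f p)) x"
    unfolding frag_sum_def using f h.hom_closed
    by (intro G'.finsum_cong') (auto simp: pow)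
  finally show ?thesis .
qed

section \<open>The universal property of the tensor product\<close>

locale tensor_pair = M: abelian_group M + N: abelian_group N
  for R :: "('a, 'x) ring_scheme" and M :: "('k, 'a, 'm, 'y) bimod_scheme"
    and N :: "('k, 'a, 'n, 'z) bimod_scheme" +
  assumes ract_closed: "\<lbrakk>m \<in> carrier M; a \<in> carrier R\<rbrakk> \<Longrightarrow> m \<triangleleft>\<^bsub>M\<^esub> a \<in> carrier M"
    and lact_closed: "\<lbrakk>a \<in> carrier R; n \<in> carrier N\<rbrakk> \<Longrightarrow> a \<triangleright>\<^bsub>N\<^esub> n \<in> carrier N"

text \<open>Apart from closedness, the clauses say that the three families of generators in
  \<open>tensor_relations\<close> are sent to zero, which makes \<open>tensor_eval G b\<close>
  independent of the representative.\<close>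

definition balanced ::
  "('a, 'x) ring_scheme \<Rightarrow> ('k, 'a, 'm, 'y) bimod_scheme \<Rightarrow> ('k, 'a, 'n, 'z) bimod_scheme
    \<Rightarrow> ('g, 'w) ring_scheme \<Rightarrow> ('m \<Rightarrow> 'n \<Rightarrow> 'g) \<Rightarrow> bool" where
  "balanced R M N G b \<longleftrightarrow>
     (\<forall>m \<in> carrier M. \<forall>n \<in> carrier N. b m n \<in> carrier G) \<and>
     (\<forall>m \<in> carrier M. \<forall>m' \<in> carrier M. \<forall>n \<in> carrier N.
        b (m \<oplus>\<^bsub>M\<^esub> m') n = b m n \<oplus>\<^bsub>G\<^esub> b m' n) \<and>
     (\<forall>m \<in> carrier M. \<forall>n \<in> carrier N. \<forall>n' \<in> carrier N.
        b m (n \<oplus>\<^bsub>N\<^esub> n') = b m n \<oplus>\<^bsub>G\<^esub> b m n') \<and>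
     (\<forall>m \<in> carrier M. \<forall>a \<in> carrier R. \<forall>n \<in> carrier N.
        b (m \<triangleleft>\<^bsub>M\<^esub> a) n = b m (a \<triangleright>\<^bsub>N\<^esub> n))"

lemma balancedI:
  assumes "\<And>m n. \<lbrakk>m \<in> carrier M; n \<in> carrier N\<rbrakk> \<Longrightarrow> b m n \<in> carrier G"
    and "\<And>m m' n. \<lbrakk>m \<in> carrier M; m' \<in> carrier M; n \<in> carrier N\<rbrakk>
      \<Longrightarrow> b (m \<oplus>\<^bsub>M\<^esub> m') n = b m n \<oplus>\<^bsub>G\<^esub> b m' n"
    and "\<And>m n n'. \<lbrakk>m \<in> carrier M; n \<in> carrier N; n' \<in> carrier N\<rbrakk>
      \<Longrightarrow> b m (n \<oplus>\<^bsub>N\<^esub> n') = b m n \<oplus>\<^bsub>G\<^esub> b m n'"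
    and "\<And>m a n. \<lbrakk>m \<in> carrier M; a \<in> carrier R; n \<in> carrier N\<rbrakk>
      \<Longrightarrow> b (m \<triangleleft>\<^bsub>M\<^esub> a) n = b m (a \<triangleright>\<^bsub>N\<^esub> n)"
  shows "balanced R M N G b"
  using assms by (simp add: balanced_def)

lemma balancedD:
  assumes "balanced R M N G b"
  shows "\<And>m n. \<lbrakk>m \<in> carrier M; n \<in> carrier N\<rbrakk> \<Longrightarrow> b m n \<in> carrier G"
    and "\<And>m m' n. \<lbrakk>m \<in> carrier M; m' \<in> carrier M; n \<in> carrier N\<rbrakk>
      \<Longrightarrow> b (m \<oplus>\<^bsub>M\<^esub> m') n = b m n \<oplus>\<^bsub>G\<^esub> b m' n"
    and "\<And>m n n'. \<lbrakk>m \<in> carrier M; n \<in> carrier N; n' \<in> carrier N\<rbrakk>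
      \<Longrightarrow> b m (n \<oplus>\<^bsub>N\<^esub> n') = b m n \<oplus>\<^bsub>G\<^esub> b m n'"
    and "\<And>m a n. \<lbrakk>m \<in> carrier M; a \<in> carrier R; n \<in> carrier N\<rbrakk>
      \<Longrightarrow> b (m \<triangleleft>\<^bsub>M\<^esub> a) n = b m (a \<triangleright>\<^bsub>N\<^esub> n)"
  using assms by (simp_all add: balanced_def)

context tensor_pair
begin

abbreviation "pairs \<equiv> free_Abelian_group (carrier M \<times> carrier N)"
abbreviation "rels \<equiv> generate pairs (tensor_relations R M N)"
abbreviation "T \<equiv> tensor R M N"

lemma tensor_relations_subset: "tensor_relations R M N \<subseteq> carrier pairs"
proof -
  have *: "Poly_Mapping.keys (x - y) \<subseteq> S"
    if "Poly_Mapping.keys x \<subseteq> S" "Poly_Mapping.keys y \<subseteq> S" for x y :: "'m \<times> 'n \<Rightarrow>\<^sub>0 int" and S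
    using that keys_diff[of x y] by blast
  show ?thesis
    unfolding tensor_relations_def
    by (intro Un_least subsetI; elim CollectE exE conjE; hypsubst;
        unfold carrier_free_Abelian_group_iff; intro *)
       (simp_all add: ract_closed lact_closed)
qed

lemma rels_normal: "rels \<lhd> pairs"
proof -
  interpret F: comm_group pairs by (rule abelian_free_Abelian_group)
  show ?thesis
    by (intro F.subgroup_imp_normal F.generate_is_subgroup tensor_relations_subset)
qed

lemma tensor_fields:
  "carrier T = carrier (tensor_group R M N)" "add T = mult (tensor_group R M N)"
  "\<zero>\<^bsub>T\<^esub> = \<one>\<^bsub>tensor_group R M N\<^esub>"
  by (simp_all add: tensor_def tensor_add_def Let_def)

lemma tensor_group_comm: "comm_group (tensor_group R M N)"
proof -
  interpret F: comm_group pairs by (rule abelian_free_Abelian_group)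
  show ?thesis
    unfolding tensor_group_def Let_def
    by (intro F.abelian_FactGroup F.generate_is_subgroup tensor_relations_subset)
qed

lemma tensor_abelian_group: "abelian_group T"
proof -
  interpret Q: comm_group "tensor_group R M N" by (rule tensor_group_comm)
  show ?thesis
    by (rule abelian_groupI) (simp_all add: tensor_fields Q.m_assoc Q.l_inv_ex, rule Q.m_comm)
qed

lemma carrier_tensor: "carrier T = (\<lambda>x. rels #>\<^bsub>pairs\<^esub> x) ` carrier pairs"
proof -
  show ?thesis by (simp add: tensor_fields tensor_group_def Let_def carrier_FactGroup)
qed

text \<open>Classes are cosets inside the free abelian group on
  \<open>carrier M \<times> carrier N\<close>, so whatever representative \<open>SOME\<close> picks,
  its support consists of such pairs. The congruence, closure and composition lemmas that follow
  rest on this.\<close>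

lemma tensor_rep:
  assumes "t \<in> carrier T"
  shows "(SOME x. x \<in> t) \<in> t"
    and "\<And>x. x \<in> t \<Longrightarrow> Poly_Mapping.keys x \<subseteq> carrier M \<times> carrier N"
proof -
  interpret n: normal rels pairs by (rule rels_normal)
  obtain x where x: "x \<in> carrier pairs" "t = rels #>\<^bsub>pairs\<^esub> x"
    using assms by (auto simp: carrier_tensor)
  have "x \<in> t" using x n.rcos_self n.subgroup_axioms by auto
  then show "(SOME x. x \<in> t) \<in> t" by (rule someI)
  show "\<And>x. x \<in> t \<Longrightarrow> Poly_Mapping.keys x \<subseteq> carrier M \<times> carrier N"
    using x n.r_coset_subset_G n.subset by (meson carrier_free_Abelian_group_iff subsetD)
qed

lemma tensor_rep_mem:
  assumes "t \<in> carrier T" "p \<in> Poly_Mapping.keys (SOME x. x \<in> t)"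
  shows "fst p \<in> carrier M" "snd p \<in> carrier N"
  using subsetD[OF tensor_rep(2)[OF assms(1) tensor_rep(1)[OF assms(1)]] assms(2)] by auto

lemma tensor_eval_cong:
  assumes "t \<in> carrier T" "abelian_group G"
    and "\<And>m n. \<lbrakk>m \<in> carrier M; n \<in> carrier N\<rbrakk> \<Longrightarrow> b' m n \<in> carrier G"
    and "\<And>m n. \<lbrakk>m \<in> carrier M; n \<in> carrier N\<rbrakk> \<Longrightarrow> b m n = b' m n"
  shows "tensor_eval G b t = tensor_eval G b' t"
proof -
  interpret G: abelian_group G by fact
  show ?thesis
    unfolding tensor_eval_frag_sum frag_sum_def
    by (rule G.finsum_cong') (use assms tensor_rep_mem[OF assms(1)] in auto)
qed

lemma tensor_eval_closed:
  assumes "t \<in> carrier T" "abelian_group G"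
    and "\<And>m n. \<lbrakk>m \<in> carrier M; n \<in> carrier N\<rbrakk> \<Longrightarrow> b m n \<in> carrier G"
  shows "tensor_eval G b t \<in> carrier G"
proof -
  interpret G: abelian_group G by fact
  show ?thesis
    unfolding tensor_eval_frag_sum frag_sum_def
    using assms tensor_rep_mem[OF assms(1)] by (auto intro!: G.finsum_closed)
qed

lemma tensor_eval_compose:
  assumes "t \<in> carrier T" "abelian_group G" "abelian_group G'"
    and "h \<in> hom (add_monoid G) (add_monoid G')"
    and "\<And>m n. \<lbrakk>m \<in> carrier M; n \<in> carrier N\<rbrakk> \<Longrightarrow> b m n \<in> carrier G"
  shows "h (tensor_eval G b t) = tensor_eval G' (\<lambda>m n. h (b m n)) t"
  unfolding tensor_eval_frag_sum
  by (rule frag_sum_compose) (use assms tensor_rep_mem[OF assms(1)] in auto)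

lemma tensor_eval_add_fun:
  assumes "t \<in> carrier T" "abelian_group G"
    and "\<And>m n. \<lbrakk>m \<in> carrier M; n \<in> carrier N\<rbrakk> \<Longrightarrow> b m n \<in> carrier G"
    and "\<And>m n. \<lbrakk>m \<in> carrier M; n \<in> carrier N\<rbrakk> \<Longrightarrow> b' m n \<in> carrier G"
  shows "tensor_eval G (\<lambda>m n. b m n \<oplus>\<^bsub>G\<^esub> b' m n) t = tensor_eval G b t \<oplus>\<^bsub>G\<^esub> tensor_eval G b' t"
proof -
  interpret G: abelian_group G by fact
  have c: "b (fst p) (snd p) \<in> carrier G" "b' (fst p) (snd p) \<in> carrier G"
    if "p \<in> Poly_Mapping.keys (SOME x. x \<in> t)" for p
    using assms tensor_rep_mem[OF assms(1)] that by auto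
  show ?thesis
    unfolding tensor_eval_frag_sum by (rule G.frag_sum_add) (use c in auto)
qed

lemma pure_tensor_closed:
  assumes "m \<in> carrier M" "n \<in> carrier N"
  shows "pure_tensor R M N m n \<in> carrier T"
  using assms by (auto simp: carrier_tensor pure_tensor_def Let_def)

text \<open>The homomorphism induced on the free abelian group kills each generating relation; its
  kernel then contains the subgroup they generate, and it is constant on cosets.\<close>

lemma frag_sum_coset:
  assumes "abelian_group G" "balanced R M N G b" "x \<in> carrier pairs" "y \<in> rels #>\<^bsub>pairs\<^esub> x"
  shows "frag_sum G (\<lambda>p. b (fst p) (snd p)) y = frag_sum G (\<lambda>p. b (fst p) (snd p)) x"
proof -
  interpret G: abelian_group G by fact
  interpret F: comm_group pairs by (rule abelian_free_Abelian_group)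
  interpret n: normal rels pairs by (rule rels_normal)
  let ?f = "\<lambda>p. b (fst p) (snd p)"
  note b = balancedD[OF assms(2)]
  have f: "?f p \<in> carrier G" if "p \<in> carrier M \<times> carrier N" for p using that b(1) by auto
  interpret h: group_hom pairs "add_monoid G" "frag_sum G ?f"
    by (intro group_hom.intro group_hom_axioms.intro F.group_axioms G.a_group G.frag_sum_hom f)
  have d: "frag_sum G ?f (u - v) = frag_sum G ?f u \<ominus>\<^bsub>G\<^esub> frag_sum G ?f v"
    if "Poly_Mapping.keys u \<subseteq> carrier M \<times> carrier N" "Poly_Mapping.keys v \<subseteq> carrier M \<times> carrier N"
    for u v
    by (rule G.frag_sum_diff[OF f]) (use that in auto)
  have kd: "Poly_Mapping.keys (x - y) \<subseteq> S"
    if "Poly_Mapping.keys x \<subseteq> S" "Poly_Mapping.keys y \<subseteq> S" for x y :: "'m \<times> 'n \<Rightarrow>\<^sub>0 int" and S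
    using that keys_diff[of x y] by blast
  \<comment> \<open>The shape that the two additivity relations take once \<open>d\<close> has
    expanded their differences.\<close>
  have cancel: "(u \<oplus>\<^bsub>G\<^esub> v) \<oplus>\<^bsub>G\<^esub> \<ominus>\<^bsub>G\<^esub> u \<oplus>\<^bsub>G\<^esub> \<ominus>\<^bsub>G\<^esub> v = \<zero>\<^bsub>G\<^esub>"
    if "u \<in> carrier G" "v \<in> carrier G" for u v
    using that G.r_neg[of "u \<oplus>\<^bsub>G\<^esub> v"] by (simp add: G.minus_add G.a_assoc)
  have "frag_sum G ?f r = \<zero>\<^bsub>G\<^esub>" if "r \<in> tensor_relations R M N" for r
    using that unfolding tensor_relations_def
    by (auto simp: d kd G.frag_sum_of cancel b lact_closed ract_closed G.minus_eq G.r_neg)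
  then have "tensor_relations R M N \<subseteq> kernel pairs (add_monoid G) (frag_sum G ?f)"
    using tensor_relations_subset unfolding kernel_def by (simp add: subset_iff)
  then have sub: "rels \<subseteq> kernel pairs (add_monoid G) (frag_sum G ?f)"
    by (rule F.generate_subgroup_incl[OF _ h.subgroup_kernel])
  obtain r where r: "r \<in> rels" "y = r \<otimes>\<^bsub>pairs\<^esub> x"
    using assms(4) by (auto simp: r_coset_def)
  then have "r \<in> carrier pairs" "frag_sum G ?f r = \<zero>\<^bsub>G\<^esub>"
    using sub by (auto simp: kernel_def)
  then show ?thesis using r(2) h.hom_mult[of r x] h.hom_closed[of x] assms(3) by simp
qed

lemma tensor_eval_rep:
  assumes "abelian_group G" "balanced R M N G b" "x \<in> carrier pairs"
  shows "tensor_eval G b (rels #>\<^bsub>pairs\<^esub> x) = frag_sum G (\<lambda>p. b (fst p) (snd p)) x"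
proof -
  have "rels #>\<^bsub>pairs\<^esub> x \<in> carrier T" using assms(3) by (auto simp: carrier_tensor)
  then show ?thesis
    unfolding tensor_eval_frag_sum by (intro frag_sum_coset assms tensor_rep(1))
qed

text \<open>The representative chosen for a sum of classes need not be the sum of the chosen ones;
  \<open>tensor_eval_rep\<close> allows both sides to be computed on \<open>x\<close>,
  \<open>y\<close> and their sum instead.\<close>

lemma tensor_eval_hom:
  assumes "abelian_group G" "balanced R M N G b"
  shows "tensor_eval G b \<in> hom (add_monoid T) (add_monoid G)"
proof (rule homI)
  interpret G: abelian_group G by fact
  interpret n: normal rels pairs by (rule rels_normal)
  fix s t assume "s \<in> carrier (add_monoid T)" "t \<in> carrier (add_monoid T)"
  then obtain x y where x: "x \<in> carrier pairs" "s = rels #>\<^bsub>pairs\<^esub> x"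
    and y: "y \<in> carrier pairs" "t = rels #>\<^bsub>pairs\<^esub> y"
    by (auto simp: carrier_tensor)
  have f: "b (fst p) (snd p) \<in> carrier G" if "p \<in> carrier M \<times> carrier N" for p
    using that balancedD(1)[OF assms(2)] by auto
  have "s \<otimes>\<^bsub>add_monoid T\<^esub> t = rels #>\<^bsub>pairs\<^esub> (x \<otimes>\<^bsub>pairs\<^esub> y)"
    unfolding monoid_record_simps tensor_fields tensor_group_def Let_def x y using n.rcos_sum x y by simp
  moreover have "x \<otimes>\<^bsub>pairs\<^esub> y \<in> carrier pairs" using x(1) y(1) by (rule n.m_closed)
  ultimately show "tensor_eval G b (s \<otimes>\<^bsub>add_monoid T\<^esub> t) =
      tensor_eval G b s \<otimes>\<^bsub>add_monoid G\<^esub> tensor_eval G b t"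
    using hom_mult[OF G.frag_sum_hom[OF f] x(1) y(1)] x y by (simp only: tensor_eval_rep assms)
next
  fix t assume "t \<in> carrier (add_monoid T)"
  then show "tensor_eval G b t \<in> carrier (add_monoid G)"
    using tensor_eval_closed[OF _ assms(1) balancedD(1)[OF assms(2)]] by simp
qed

lemma tensor_eval_add:
  assumes "abelian_group G" "balanced R M N G b" "s \<in> carrier T" "t \<in> carrier T"
  shows "tensor_eval G b (s \<oplus>\<^bsub>T\<^esub> t) = tensor_eval G b s \<oplus>\<^bsub>G\<^esub> tensor_eval G b t"
  using hom_mult[OF tensor_eval_hom[OF assms(1,2)]] assms by simp

lemma tensor_eval_pure:
  assumes "abelian_group G" "balanced R M N G b" "m \<in> carrier M" "n \<in> carrier N"
  shows "tensor_eval G b (pure_tensor R M N m n) = b m n"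
proof -
  interpret G: abelian_group G by fact
  show ?thesis
    unfolding pure_tensor_def Let_def
    using assms balancedD(1)[OF assms(2)] by (simp add: tensor_eval_rep G.frag_sum_of)
qed

end

text \<open>Both classes are replaced by their chosen representatives, so this is an interchange of
  two finite sums with integer weights, for an arbitrary closed \<open>f\<close>.\<close>

lemma tensor_eval_swap:
  fixes M :: "('k, 'a, 'm, 'y) bimod_scheme" and N :: "('k, 'a, 'n, 'z) bimod_scheme"
  assumes "tensor_pair R M N" "tensor_pair R' M' N'"
    and s: "s \<in> carrier (tensor R M N)" and t: "t \<in> carrier (tensor R' M' N')"
    and G: "abelian_group G"
    and f: "\<And>m n m' n'. \<lbrakk>m \<in> carrier M; n \<in> carrier N; m' \<in> carrier M'; n' \<in> carrier N'\<rbrakk>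
      \<Longrightarrow> f m n m' n' \<in> carrier G"
  shows "tensor_eval G (\<lambda>m n. tensor_eval G (f m n) t) s
       = tensor_eval G (\<lambda>m' n'. tensor_eval G (\<lambda>m n. f m n m' n') s) t"
proof -
  interpret P: tensor_pair R M N by fact
  interpret Q: tensor_pair R' M' N' by fact
  interpret G: abelian_group G by fact
  have pow: "[k] \<cdot>\<^bsub>G\<^esub> tensor_eval G b t = tensor_eval G (\<lambda>m' n'. [k] \<cdot>\<^bsub>G\<^esub> b m' n') t"
    if "\<And>m' n'. \<lbrakk>m' \<in> carrier M'; n' \<in> carrier N'\<rbrakk> \<Longrightarrow> b m' n' \<in> carrier G" for k :: int and b
  proof (rule Q.tensor_eval_compose[OF t G G _ that])
    show "(\<lambda>u. [k] \<cdot>\<^bsub>G\<^esub> u) \<in> hom (add_monoid G) (add_monoid G)"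
      by (rule homI) (simp_all add: G.add.int_pow_mult_distrib G.add.m_comm)
  qed
  \<comment> \<open>The sum over \<open>t\<close> has to pass the weights of \<open>s\<close>, which
    is \<open>pow\<close>, and the finite sum over the support of \<open>s\<close>, which is this
    induction.\<close>
  have sum: "(\<Oplus>\<^bsub>G\<^esub>p \<in> B. tensor_eval G (g p) t) = tensor_eval G (\<lambda>m' n'. \<Oplus>\<^bsub>G\<^esub>p \<in> B. g p m' n') t"
    if "finite B" "\<And>p m' n'. \<lbrakk>p \<in> B; m' \<in> carrier M'; n' \<in> carrier N'\<rbrakk> \<Longrightarrow> g p m' n' \<in> carrier G"
    for B :: "('m \<times> 'n) set" and g
    using that
  proof (induction B)
    case empty
    have "tensor_eval G (\<lambda>m' n'. \<zero>\<^bsub>G\<^esub>) t = \<zero>\<^bsub>G\<^esub>"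
      unfolding tensor_eval_frag_sum frag_sum_def by (rule G.add.finprod_one_eqI) simp
    then show ?case by simp
  next
    case (insert p B)
    have "tensor_eval G (g q) t \<in> carrier G" if "q \<in> insert p B" for q
      by (intro Q.tensor_eval_closed t G insert.prems that)
    then have "(\<Oplus>\<^bsub>G\<^esub>q \<in> insert p B. tensor_eval G (g q) t)
        = tensor_eval G (g p) t \<oplus>\<^bsub>G\<^esub> (\<Oplus>\<^bsub>G\<^esub>q \<in> B. tensor_eval G (g q) t)"
      using insert.hyps by (intro G.finsum_insert) auto
    also have "\<dots> = tensor_eval G (\<lambda>m' n'. g p m' n' \<oplus>\<^bsub>G\<^esub> (\<Oplus>\<^bsub>G\<^esub>q \<in> B. g q m' n')) t"
      using insert by (subst Q.tensor_eval_add_fun[OF t G]) (auto intro!: G.finsum_closed)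
    also have "\<dots> = tensor_eval G (\<lambda>m' n'. \<Oplus>\<^bsub>G\<^esub>q \<in> insert p B. g q m' n') t"
      using insert by (intro Q.tensor_eval_cong t G) (auto intro!: G.finsum_closed simp: Pi_def)
    finally show ?case .
  qed
  note rep = P.tensor_rep_mem[OF s]
  let ?x = "SOME x. x \<in> s"
  let ?g = "\<lambda>p m' n'. [Poly_Mapping.lookup ?x p] \<cdot>\<^bsub>G\<^esub> f (fst p) (snd p) m' n'"
  have "tensor_eval G (\<lambda>m n. tensor_eval G (f m n) t) s
      = (\<Oplus>\<^bsub>G\<^esub>p \<in> Poly_Mapping.keys ?x. tensor_eval G (?g p) t)"
    unfolding tensor_eval_frag_sum[of G _ s] frag_sum_def
    using rep by (intro G.finsum_cong') (auto simp: pow f intro!: Q.tensor_eval_closed t G)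
  also have "\<dots> = tensor_eval G (\<lambda>m' n'. \<Oplus>\<^bsub>G\<^esub>p \<in> Poly_Mapping.keys ?x. ?g p m' n') t"
    by (rule sum) (use rep in \<open>auto simp: f\<close>)
  finally show ?thesis unfolding tensor_eval_frag_sum[of G _ s] frag_sum_def .
qed


text \<open>\<open>tensor_eval\<close> with junk values of \<open>b\<close> replaced by \<open>\<zero>\<close>, which makes congruence and the
  exchange of sums unconditional.\<close>

definition tsum :: "'m set \<Rightarrow> 'n set \<Rightarrow> ('g, 'x) ring_scheme \<Rightarrow> ('m, 'n) tens
    \<Rightarrow> ('m \<Rightarrow> 'n \<Rightarrow> 'g) \<Rightarrow> 'g" where
  "tsum U V G t b = tensor_eval G
     (\<lambda>m n. if m \<in> U \<and> n \<in> V \<and> b m n \<in> carrier G then b m n else \<zero>\<^bsub>G\<^esub>) t"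

lemma tsum_cong:
  assumes "t = t'" "\<And>m n. \<lbrakk>m \<in> U; n \<in> V\<rbrakk> \<Longrightarrow> b m n = b' m n"
  shows "tsum U V G t b = tsum U V G t' b'"
proof -
  have "(\<lambda>m n. if m \<in> U \<and> n \<in> V \<and> b m n \<in> carrier G then b m n else \<zero>\<^bsub>G\<^esub>)
      = (\<lambda>m n. if m \<in> U \<and> n \<in> V \<and> b' m n \<in> carrier G then b' m n else \<zero>\<^bsub>G\<^esub>)"
    using assms(2) by (intro ext) auto
  then show ?thesis using assms(1) by (simp add: tsum_def)
qed

lemmas tcong = tsum_cong[OF refl]

text \<open>As a congruence rule this hands the simplifier the membership facts for the bound
  variables, so that conditional laws such as associativity on a carrier rewrite inside nested
  sums.\<close>

lemma tsum_cong_simp [cong]: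
  assumes "U = U'" "V = V'" "t = t'" "\<And>m n. \<lbrakk>m \<in> U'; n \<in> V'\<rbrakk> \<Longrightarrow> b m n = b' m n"
  shows "tsum U V G t b = tsum U' V' G t' b'"
  unfolding assms(1,2) using assms(3,4) by (rule tsum_cong)

context tensor_pair
begin

lemma tsum_eq:
  assumes "t \<in> carrier T" "abelian_group G"
    and "\<And>m n. \<lbrakk>m \<in> carrier M; n \<in> carrier N\<rbrakk> \<Longrightarrow> b m n \<in> carrier G"
  shows "tensor_eval G b t = tsum (carrier M) (carrier N) G t b"
  unfolding tsum_def by (rule tensor_eval_cong) (use assms abelian_group.axioms in auto)

lemma tsum_closed:
  assumes "t \<in> carrier T" "abelian_group G"
  shows "tsum (carrier M) (carrier N) G t b \<in> carrier G"
proof -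
  interpret G: abelian_group G by fact
  show ?thesis unfolding tsum_def by (rule tensor_eval_closed) (use assms in auto)
qed

lemma tsum_compose:
  assumes "t \<in> carrier T" "abelian_group G" "abelian_group G'"
    and "h \<in> hom (add_monoid G) (add_monoid G')"
    and "\<And>m n. \<lbrakk>m \<in> carrier M; n \<in> carrier N\<rbrakk> \<Longrightarrow> b m n \<in> carrier G"
  shows "h (tsum (carrier M) (carrier N) G t b) = tsum (carrier M) (carrier N) G' t (\<lambda>m n. h (b m n))"
proof -
  have "h u \<in> carrier G'" if "u \<in> carrier G" for u using that assms(4) by (auto simp: hom_def)
  then show ?thesis
    using tensor_eval_compose[OF assms] by (simp add: tsum_eq assms)
qed

lemma tsum_add_fun:
  assumes "t \<in> carrier T" "abelian_group G"
    and "\<And>m n. \<lbrakk>m \<in> carrier M; n \<in> carrier N\<rbrakk> \<Longrightarrow> b m n \<in> carrier G"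
    and "\<And>m n. \<lbrakk>m \<in> carrier M; n \<in> carrier N\<rbrakk> \<Longrightarrow> b' m n \<in> carrier G"
  shows "tsum (carrier M) (carrier N) G t (\<lambda>m n. b m n \<oplus>\<^bsub>G\<^esub> b' m n)
    = tsum (carrier M) (carrier N) G t b \<oplus>\<^bsub>G\<^esub> tsum (carrier M) (carrier N) G t b'"
proof -
  interpret G: abelian_group G by fact
  show ?thesis using tensor_eval_add_fun[OF assms] by (simp add: tsum_eq assms)
qed

lemma tsum_add:
  assumes "abelian_group G" "balanced R M N G b" "s \<in> carrier T" "t \<in> carrier T"
  shows "tsum (carrier M) (carrier N) G (s \<oplus>\<^bsub>T\<^esub> t) b
    = tsum (carrier M) (carrier N) G s b \<oplus>\<^bsub>G\<^esub> tsum (carrier M) (carrier N) G t b"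
proof -
  interpret T: abelian_group T by (rule tensor_abelian_group)
  show ?thesis
    using tensor_eval_add[OF assms] assms balancedD(1)[OF assms(2)] by (simp add: tsum_eq)
qed

lemma tsum_pure:
  assumes "abelian_group G" "balanced R M N G b" "m \<in> carrier M" "n \<in> carrier N"
  shows "tsum (carrier M) (carrier N) G (pure_tensor R M N m n) b = b m n"
  using tensor_eval_pure[OF assms] assms balancedD(1)[OF assms(2)]
  by (simp add: tsum_eq pure_tensor_closed)

text \<open>Coproducts of composite elements are given as sums of pure tensors indexed by another
  tensor \<open>t\<close>. Since \<open>tensor_eval G b\<close> is additive on classes, summing
  \<open>b\<close> over such an element amounts to substituting the two legs into
  \<open>b\<close>.\<close>

lemma tsum_tensor_eval_pure:
  assumes "abelian_group G" "balanced R M N G b" "tensor_pair R' M' N'" "t \<in> carrier (tensor R' M' N')"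
    and "\<And>m n. \<lbrakk>m \<in> carrier M'; n \<in> carrier N'\<rbrakk> \<Longrightarrow> f m n \<in> carrier M"
    and "\<And>m n. \<lbrakk>m \<in> carrier M'; n \<in> carrier N'\<rbrakk> \<Longrightarrow> g m n \<in> carrier N"
  shows "tsum (carrier M) (carrier N) G
      (tensor_eval T (\<lambda>m n. pure_tensor R M N (f m n) (g m n)) t) b
    = tsum (carrier M') (carrier N') G t (\<lambda>m n. b (f m n) (g m n))"
proof -
  interpret P: tensor_pair R' M' N' by fact
  interpret T: abelian_group T by (rule tensor_abelian_group)
  note b = balancedD(1)[OF assms(2)]
  have "tensor_eval G b (tensor_eval T (\<lambda>m n. pure_tensor R M N (f m n) (g m n)) t)
      = tensor_eval G (\<lambda>m n. tensor_eval G b (pure_tensor R M N (f m n) (g m n))) t"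
    by (rule P.tensor_eval_compose)
       (use assms in \<open>auto intro: tensor_eval_hom pure_tensor_closed tensor_abelian_group\<close>)
  also have "\<dots> = tensor_eval G (\<lambda>m n. b (f m n) (g m n)) t"
    by (rule P.tensor_eval_cong) (use assms b in \<open>auto simp: tensor_eval_pure\<close>)
  moreover have "tensor_eval T (\<lambda>m n. pure_tensor R M N (f m n) (g m n)) t \<in> carrier T"
    by (rule P.tensor_eval_closed)
       (use assms in \<open>auto intro: pure_tensor_closed tensor_abelian_group\<close>)
  ultimately show ?thesis using assms b by (simp add: tsum_eq P.tsum_eq)
qed

end

lemma tsum_swap:
  assumes "tensor_pair R M N" "tensor_pair R' M' N'"
    and "s \<in> carrier (tensor R M N)" "t \<in> carrier (tensor R' M' N')" "abelian_group G"
    and "\<And>m n m' n'. \<lbrakk>m \<in> carrier M; n \<in> carrier N; m' \<in> carrier M'; n' \<in> carrier N'\<rbrakk>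
      \<Longrightarrow> f m n m' n' \<in> carrier G"
  shows "tsum (carrier M) (carrier N) G s (\<lambda>m n. tsum (carrier M') (carrier N') G t (f m n))
       = tsum (carrier M') (carrier N') G t (\<lambda>m' n'. tsum (carrier M) (carrier N) G s (\<lambda>m n. f m n m' n'))"
proof -
  interpret P: tensor_pair R M N by fact
  interpret Q: tensor_pair R' M' N' by fact
  interpret G: abelian_group G by fact
  have "tsum (carrier M) (carrier N) G s (\<lambda>m n. tsum (carrier M') (carrier N') G t (f m n))
      = tsum (carrier M) (carrier N) G s (\<lambda>m n. tensor_eval G (f m n) t)"
    by (rule tsum_cong) (use assms in \<open>auto simp: Q.tsum_eq\<close>)
  also have "\<dots> = tensor_eval G (\<lambda>m n. tensor_eval G (f m n) t) s"
    by (rule P.tsum_eq[symmetric]) (use assms in \<open>auto intro!: Q.tensor_eval_closed\<close>)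
  also have "\<dots> = tensor_eval G (\<lambda>m' n'. tensor_eval G (\<lambda>m n. f m n m' n') s) t"
    by (rule tensor_eval_swap[OF assms])
  also have "\<dots> = tsum (carrier M') (carrier N') G t (\<lambda>m' n'. tensor_eval G (\<lambda>m n. f m n m' n') s)"
    by (rule Q.tsum_eq) (use assms in \<open>auto intro!: P.tensor_eval_closed\<close>)
  also have "\<dots> = tsum (carrier M') (carrier N') G t
      (\<lambda>m' n'. tsum (carrier M) (carrier N) G s (\<lambda>m n. f m n m' n'))"
    by (rule tsum_cong) (use assms in \<open>auto simp: P.tsum_eq\<close>)
  finally show ?thesis .
qed

section \<open>Coproducts and coassociativity, for \<open>H\<close> over \<open>K\<close> and
  \<open>C\<close> over \<open>A\<close> at once\<close>

locale comultiplication = tensor_pair R M M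
  for R :: "('a, 'x) ring_scheme" and M :: "('k, 'a, 'm, 'y) bimod_scheme" +
  fixes \<Delta> :: "'m \<Rightarrow> ('m, 'm) tens"
  assumes comult_closed: "m \<in> carrier M \<Longrightarrow> \<Delta> m \<in> carrier (tensor R M M)"
    and left_closed: "\<lbrakk>a \<in> carrier R; m \<in> carrier M\<rbrakk> \<Longrightarrow> a \<triangleright>\<^bsub>M\<^esub> m \<in> carrier M"
    and comult_coassoc: "m \<in> carrier M \<Longrightarrow>
      tensor_eval (tensor R M (tensor R M M))
        (\<lambda>x y. tensor_eval (tensor R M (tensor R M M))
           (\<lambda>u v. pure_tensor R M (tensor R M M) u (pure_tensor R M M v y)) (\<Delta> x)) (\<Delta> m) =
      tensor_eval (tensor R M (tensor R M M))
        (\<lambda>x y. pure_tensor R M (tensor R M M) x (\<Delta> y)) (\<Delta> m)"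
begin

abbreviation "csum G m b \<equiv> tsum (carrier M) (carrier M) G (\<Delta> m) b"

text \<open>The record \<open>tensor\<close> defines its actions with \<open>tensor_eval\<close>
  into the auxiliary \<open>tensor_add\<close>. Only the additive fields of the target enter an
  evaluation, and those agree.\<close>

lemma tensor_acts:
  "a \<triangleright>\<^bsub>T\<^esub> t = tensor_eval T (\<lambda>m n. pure_tensor R M M (a \<triangleright>\<^bsub>M\<^esub> m) n) t" (is ?left)
  "t \<triangleleft>\<^bsub>T\<^esub> a = tensor_eval T (\<lambda>m n. pure_tensor R M M m (n \<triangleleft>\<^bsub>M\<^esub> a)) t" (is ?right)
proof -
  have "tensor_eval (tensor_add R M M) b t = tensor_eval T b t" for b
    by (simp add: tensor_eval_def tensor_def Let_def add_pow_def finsum_def finprod_def int_pow_def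
        nat_pow_def m_inv_def cong: if_cong)
  then show ?left ?right by (simp_all add: tensor_def Let_def)
qed

lemmas lact_tensor = tensor_acts(1)
lemmas ract_tensor = tensor_acts(2)

text \<open>Coassociativity lives in \<open>M \<otimes> (M \<otimes> M)\<close>, so the tensor
  square must itself serve as a right factor.\<close>

lemma tensor_pair_right: "tensor_pair R M (tensor R M M)"
proof -
  interpret T: abelian_group T by (rule tensor_abelian_group)
  show ?thesis
    by unfold_locales
       (auto simp: lact_tensor ract_closed left_closed
          intro!: tensor_eval_closed tensor_abelian_group pure_tensor_closed)
qed

text \<open>The coassociativity axiom is an equation in \<open>M \<otimes> (M \<otimes> M)\<close>,
  to which the homomorphism \<open>?\<Phi>\<close> sending
  \<open>u \<otimes> (v \<otimes> w)\<close> to \<open>f u v w\<close> is applied. The assumptions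
  make \<open>?\<Phi>\<close> well defined: \<open>bal2\<close> on the inner tensor product,
  \<open>add1\<close> and \<open>bal1\<close> on the outer one.\<close>

lemma csum_coassoc:
  assumes G: "abelian_group G"
    and closed: "\<And>u v w. \<lbrakk>u \<in> carrier M; v \<in> carrier M; w \<in> carrier M\<rbrakk> \<Longrightarrow> f u v w \<in> carrier G"
    and add1: "\<And>u u' v w. \<lbrakk>u \<in> carrier M; u' \<in> carrier M; v \<in> carrier M; w \<in> carrier M\<rbrakk>
      \<Longrightarrow> f (u \<oplus>\<^bsub>M\<^esub> u') v w = f u v w \<oplus>\<^bsub>G\<^esub> f u' v w"
    and bal1: "\<And>u a v w. \<lbrakk>u \<in> carrier M; a \<in> carrier R; v \<in> carrier M; w \<in> carrier M\<rbrakk>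
      \<Longrightarrow> f (u \<triangleleft>\<^bsub>M\<^esub> a) v w = f u (a \<triangleright>\<^bsub>M\<^esub> v) w"
    and bal2: "\<And>u. u \<in> carrier M \<Longrightarrow> balanced R M M G (f u)"
    and m: "m \<in> carrier M"
  shows "csum G m (\<lambda>x y. csum G x (\<lambda>u v. f u v y)) = csum G m (\<lambda>x y. csum G y (f x))"
proof -
  interpret G: abelian_group G by fact
  interpret T: abelian_group T by (rule tensor_abelian_group)
  interpret P: tensor_pair R M T by (rule tensor_pair_right)
  interpret TT: abelian_group "tensor R M T" by (rule P.tensor_abelian_group)
  let ?\<Phi> = "tensor_eval G (\<lambda>u. tensor_eval G (f u))"
  have ev: "tensor_eval G (f u) s \<in> carrier G" if "u \<in> carrier M" "s \<in> carrier T" for u s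
    using that by (intro tensor_eval_closed closed G)
  have bal: "balanced R M T G (\<lambda>u. tensor_eval G (f u))"
  proof (rule balancedI)
    show "tensor_eval G (f (u \<oplus>\<^bsub>M\<^esub> u')) s = tensor_eval G (f u) s \<oplus>\<^bsub>G\<^esub> tensor_eval G (f u') s"
      if "u \<in> carrier M" "u' \<in> carrier M" "s \<in> carrier T" for u u' s
      using that
      by (subst tensor_eval_add_fun[symmetric]) (auto simp: closed add1 G intro!: tensor_eval_cong)
    \<comment> \<open>Balancing against a whole class \<open>s\<close>: \<open>a\<close> acts on
      \<open>s\<close> through its first leg, and \<open>bal1\<close> moves it there from
      \<open>u\<close>.\<close>
    show "tensor_eval G (f (u \<triangleleft>\<^bsub>M\<^esub> a)) s = tensor_eval G (f u) (a \<triangleright>\<^bsub>T\<^esub> s)"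
      if "u \<in> carrier M" "a \<in> carrier R" "s \<in> carrier T" for u a s
    proof -
      have "a \<triangleright>\<^bsub>T\<^esub> s \<in> carrier T" using that P.lact_closed by blast
      then have "tensor_eval G (f u) (a \<triangleright>\<^bsub>T\<^esub> s) = tsum (carrier M) (carrier M) G (a \<triangleright>\<^bsub>T\<^esub> s) (f u)"
        using that by (intro tsum_eq G closed)
      also have "\<dots> = tsum (carrier M) (carrier M) G s (\<lambda>v w. f u (a \<triangleright>\<^bsub>M\<^esub> v) w)"
        unfolding lact_tensor using that
        by (intro tsum_tensor_eval_pure G bal2 left_closed) (simp_all add: tensor_pair_axioms)
      also have "\<dots> = tensor_eval G (\<lambda>v w. f u (a \<triangleright>\<^bsub>M\<^esub> v) w) s"
        using that by (intro tsum_eq[symmetric] G closed left_closed)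
      also have "\<dots> = tensor_eval G (f (u \<triangleleft>\<^bsub>M\<^esub> a)) s"
        using that by (intro tensor_eval_cong G) (auto simp: bal1 closed left_closed ract_closed)
      finally show ?thesis ..
    qed
  qed (auto simp: ev bal2 tensor_eval_add G)
  have hom: "?\<Phi> \<in> hom (add_monoid (tensor R M T)) (add_monoid G)"
    by (rule P.tensor_eval_hom[OF G bal])
  have hom_c: "?\<Phi> s \<in> carrier G" if "s \<in> carrier (tensor R M T)" for s
    using hom that by (auto simp: hom_def)
  have pure: "?\<Phi> (pure_tensor R M T u s) = tensor_eval G (f u) s"
    if "u \<in> carrier M" "s \<in> carrier T" for u s
    using that by (rule P.tensor_eval_pure[OF G bal])
  have "csum G m (\<lambda>x y. csum G x (\<lambda>u v. f u v y)) =
      tensor_eval G (\<lambda>x y. tensor_eval G (\<lambda>u v. f u v y) (\<Delta> x)) (\<Delta> m)"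
    using m by (subst tsum_eq) (auto simp: tsum_eq comult_closed closed G intro!: tsum_closed)
  also have "\<dots> = ?\<Phi> (tensor_eval (tensor R M T)
        (\<lambda>x y. tensor_eval (tensor R M T)
           (\<lambda>u v. pure_tensor R M T u (pure_tensor R M M v y)) (\<Delta> x)) (\<Delta> m))"
  proof -
    have "tensor_eval G (\<lambda>u v. f u v y) (\<Delta> x) = ?\<Phi> (tensor_eval (tensor R M T)
           (\<lambda>u v. pure_tensor R M T u (pure_tensor R M M v y)) (\<Delta> x))"
      if "x \<in> carrier M" "y \<in> carrier M" for x y
      using that
      by (subst tensor_eval_compose[OF _ TT.abelian_group_axioms G hom])
         (auto simp: comult_closed pure pure_tensor_closed G tensor_eval_pure bal2 closed
           intro!: tensor_eval_cong P.pure_tensor_closed)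
    then show ?thesis using m
      by (subst tensor_eval_compose[OF _ TT.abelian_group_axioms G hom])
         (auto simp: comult_closed G
           intro!: tensor_eval_cong tensor_eval_closed P.pure_tensor_closed pure_tensor_closed
             TT.abelian_group_axioms hom_c)
  qed
  also have "\<dots> = ?\<Phi> (tensor_eval (tensor R M T)
        (\<lambda>x y. pure_tensor R M T x (\<Delta> y)) (\<Delta> m))"
    using comult_coassoc[OF m] by simp
  also have "\<dots> = tensor_eval G (\<lambda>x y. tensor_eval G (f x) (\<Delta> y)) (\<Delta> m)"
    using m
    by (subst tensor_eval_compose[OF _ TT.abelian_group_axioms G hom])
       (auto simp: comult_closed G pure ev intro!: tensor_eval_cong P.pure_tensor_closed)
  also have "\<dots> = csum G m (\<lambda>x y. csum G y (f x))"
    using m by (subst tsum_eq) (auto simp: tsum_eq comult_closed closed G intro!: tsum_closed)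
  finally show ?thesis .
qed

end


section \<open>Multilinear maps\<close>

text \<open>Tensor products over \<open>K\<close> are taken of symmetric bimodules, where bilinear
  maps are balanced. Linearity in one variable at a time is therefore the side condition of the
  whole Hopf part; as a predicate stable under composition it can be discharged by introduction
  rules.\<close>

definition klin ::
  "('k, 'x) ring_scheme \<Rightarrow> ('k, 'm, 'y) module_scheme \<Rightarrow> ('k, 'n, 'z) module_scheme
    \<Rightarrow> ('m \<Rightarrow> 'n) \<Rightarrow> bool" where
  "klin K M N f \<longleftrightarrow> (\<forall>m \<in> carrier M. f m \<in> carrier N) \<and>
     (\<forall>m \<in> carrier M. \<forall>m' \<in> carrier M. f (m \<oplus>\<^bsub>M\<^esub> m') = f m \<oplus>\<^bsub>N\<^esub> f m') \<and>
     (\<forall>r \<in> carrier K. \<forall>m \<in> carrier M. f (r \<odot>\<^bsub>M\<^esub> m) = r \<odot>\<^bsub>N\<^esub> f m)"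

definition bilin ::
  "('k, 'x) ring_scheme \<Rightarrow> ('k, 'm, 'y) module_scheme \<Rightarrow> ('k, 'n, 'z) module_scheme
    \<Rightarrow> ('k, 'g, 'w) module_scheme \<Rightarrow> ('m \<Rightarrow> 'n \<Rightarrow> 'g) \<Rightarrow> bool" where
  "bilin K M N G b \<longleftrightarrow> (\<forall>n \<in> carrier N. klin K M G (\<lambda>m. b m n)) \<and>
     (\<forall>m \<in> carrier M. klin K N G (b m))"

lemma klinI:
  assumes "\<And>m. m \<in> carrier M \<Longrightarrow> f m \<in> carrier N"
    and "\<And>m m'. \<lbrakk>m \<in> carrier M; m' \<in> carrier M\<rbrakk> \<Longrightarrow> f (m \<oplus>\<^bsub>M\<^esub> m') = f m \<oplus>\<^bsub>N\<^esub> f m'"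
    and "\<And>r m. \<lbrakk>r \<in> carrier K; m \<in> carrier M\<rbrakk> \<Longrightarrow> f (r \<odot>\<^bsub>M\<^esub> m) = r \<odot>\<^bsub>N\<^esub> f m"
  shows "klin K M N f"
  using assms by (simp add: klin_def)

lemma klinD:
  assumes "klin K M N f"
  shows "\<And>m. m \<in> carrier M \<Longrightarrow> f m \<in> carrier N"
    and "\<And>m m'. \<lbrakk>m \<in> carrier M; m' \<in> carrier M\<rbrakk> \<Longrightarrow> f (m \<oplus>\<^bsub>M\<^esub> m') = f m \<oplus>\<^bsub>N\<^esub> f m'"
    and "\<And>r m. \<lbrakk>r \<in> carrier K; m \<in> carrier M\<rbrakk> \<Longrightarrow> f (r \<odot>\<^bsub>M\<^esub> m) = r \<odot>\<^bsub>N\<^esub> f m"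
  using assms by (simp_all add: klin_def)

lemma klin_hom: "klin K M N f \<Longrightarrow> f \<in> hom (add_monoid M) (add_monoid N)"
  by (rule homI) (simp_all add: klin_def)

lemma klin_id: "klin K M M (\<lambda>x. x)"
  by (simp add: klin_def)

lemma klin_comp: "klin K N G g \<Longrightarrow> klin K M N f \<Longrightarrow> klin K M G (\<lambda>x. g (f x))"
  by (simp add: klin_def)

lemma (in left_module) klin_act_left:
  "m \<in> carrier M \<Longrightarrow> klin K L A f \<Longrightarrow> klin K L M (\<lambda>x. act (f x) m)"
  by (simp add: klin_def act_closed act_add_left act_smult_left)

lemma (in left_module) klin_act_right:
  "a \<in> carrier A \<Longrightarrow> klin K L M f \<Longrightarrow> klin K L M (\<lambda>x. act a (f x))"
  by (simp add: klin_def act_closed act_add_right act_smult_right)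

lemma (in right_module) klin_act_left:
  "a \<in> carrier A \<Longrightarrow> klin K L M f \<Longrightarrow> klin K L M (\<lambda>x. act (f x) a)"
  by (simp add: klin_def act_closed act_add_left act_smult_left)

lemma (in right_module) klin_act_right:
  "m \<in> carrier M \<Longrightarrow> klin K L A f \<Longrightarrow> klin K L M (\<lambda>x. act m (f x))"
  by (simp add: klin_def act_closed act_add_right act_smult_right)

lemma (in k_algebra) klin_prod_left: "klin K L A f \<Longrightarrow> y \<in> carrier A \<Longrightarrow> klin K L A (\<lambda>x. f x \<otimes>\<^bsub>A\<^esub> y)"
  by (simp add: klin_def A.l_distr smult_mult_left)

lemma (in k_algebra) klin_prod_right: "x \<in> carrier A \<Longrightarrow> klin K L A f \<Longrightarrow> klin K L A (\<lambda>y. x \<otimes>\<^bsub>A\<^esub> f y)"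
  by (simp add: klin_def A.r_distr smult_mult_right)

lemma bilinI:
  assumes "\<And>n. n \<in> carrier N \<Longrightarrow> klin K M G (\<lambda>m. b m n)"
    and "\<And>m. m \<in> carrier M \<Longrightarrow> klin K N G (\<lambda>n. b m n)"
  shows "bilin K M N G b"
  using assms by (simp add: bilin_def)

lemma bilin_left: "bilin K M N G b \<Longrightarrow> klin K L M f \<Longrightarrow> n \<in> carrier N \<Longrightarrow> klin K L G (\<lambda>x. b (f x) n)"
  by (rule klin_comp[where g = "\<lambda>m. b m n"]) (auto simp: bilin_def)

lemma bilin_right: "bilin K M N G b \<Longrightarrow> m \<in> carrier M \<Longrightarrow> klin K L N f \<Longrightarrow> klin K L G (\<lambda>x. b m (f x))"
  by (rule klin_comp) (auto simp: bilin_def)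

lemma bilin_closed: "bilin K M N G b \<Longrightarrow> m \<in> carrier M \<Longrightarrow> n \<in> carrier N \<Longrightarrow> b m n \<in> carrier G"
  by (simp add: bilin_def klin_def)

lemma klin_smult:
  assumes "module K G" "klin K M G f" "r \<in> carrier K"
  shows "klin K M G (\<lambda>x. r \<odot>\<^bsub>G\<^esub> f x)"
proof (rule klinI)
  interpret G: module K G by fact
  note f = klinD[OF assms(2)]
  show "r \<odot>\<^bsub>G\<^esub> f (s \<odot>\<^bsub>M\<^esub> m) = s \<odot>\<^bsub>G\<^esub> (r \<odot>\<^bsub>G\<^esub> f m)" if "s \<in> carrier K" "m \<in> carrier M" for s m
    using assms f that by (simp add: G.smult_assoc1[symmetric] G.R.m_comm)
qed (use assms klinD[OF assms(2)] in \<open>auto simp: module.smult_r_distr intro: module.smult_closed\<close>)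

text \<open>A scalar moved across the tensor sign comes out of either slot as the same
  factor.\<close>

lemma balanced_sym_bimod:
  assumes "bilin K M N G b"
  shows "balanced K (sym_bimod M) (sym_bimod N) G b"
  using assms by (intro balancedI) (auto simp: sym_bimod_def bilin_def klin_def)

lemma carrier_sym_bimod [simp]: "carrier (sym_bimod M) = carrier M"
  by (simp add: sym_bimod_def)

lemma tensor_pair_sym_bimod:
  assumes "module K M" "module K N"
  shows "tensor_pair K (sym_bimod M) (sym_bimod N)"
proof -
  interpret M: module K M by fact
  interpret N: module K N by fact
  have "abelian_group (sym_bimod M)"
    by (rule abelian_groupI)
       (auto simp: sym_bimod_def M.a_assoc intro: M.a_comm M.add.l_inv_ex[simplified])
  moreover have "abelian_group (sym_bimod N)"
    by (rule abelian_groupI)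
       (auto simp: sym_bimod_def N.a_assoc intro: N.a_comm N.add.l_inv_ex[simplified])
  ultimately show ?thesis
    by (intro tensor_pair.intro tensor_pair_axioms.intro) (auto simp: sym_bimod_def)
qed

text \<open>Here the tensor \<open>t\<close> is fixed and only the integrand varies with
  \<open>x\<close>; \<open>klin_sw_arg\<close> treats the other case, in which the tensor is the
  coproduct of a varying element.\<close>

lemma klin_tsum:
  assumes "tensor_pair R M N" "t \<in> carrier (tensor R M N)" "module K G"
    and f: "\<And>u v. \<lbrakk>u \<in> carrier M; v \<in> carrier N\<rbrakk> \<Longrightarrow> klin K L G (\<lambda>x. f x u v)"
  shows "klin K L G (\<lambda>x. tsum (carrier M) (carrier N) G t (f x))"
proof -
  interpret P: tensor_pair R M N by fact
  interpret G: module K G by fact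
  have sm: "(\<lambda>g. r \<odot>\<^bsub>G\<^esub> g) \<in> hom (add_monoid G) (add_monoid G)" if "r \<in> carrier K" for r
    using that by (intro homI) (auto simp: G.smult_r_distr)
  show ?thesis
  proof (rule klinI)
    show "tsum (carrier M) (carrier N) G t (f (x \<oplus>\<^bsub>L\<^esub> y)) =
      tsum (carrier M) (carrier N) G t (f x) \<oplus>\<^bsub>G\<^esub> tsum (carrier M) (carrier N) G t (f y)"
      if "x \<in> carrier L" "y \<in> carrier L" for x y
      using that assms klinD[OF f]
      by (subst P.tsum_add_fun[symmetric]) (auto intro: G.abelian_group_axioms tsum_cong)
    show "tsum (carrier M) (carrier N) G t (f (r \<odot>\<^bsub>L\<^esub> x)) =
      r \<odot>\<^bsub>G\<^esub> tsum (carrier M) (carrier N) G t (f x)" if "r \<in> carrier K" "x \<in> carrier L" for r x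
      using that assms klinD[OF f]
      by (subst P.tsum_compose[OF _ _ _ sm]) (auto intro: G.abelian_group_axioms tsum_cong)
  qed (use assms G.abelian_group_axioms P.tsum_closed in auto)
qed


section \<open>Sweedler calculus in a Hopf algebra\<close>

context hopf_algebra
begin

abbreviation "sw G h b \<equiv> tsum (carrier H) (carrier H) G (hcomult H h) b"

lemma module_H: "module K H" ..

sublocale HH: comultiplication K "sym_bimod H" "hcomult H"
proof (intro comultiplication.intro comultiplication_axioms.intro)
  show "tensor_pair K (sym_bimod H) (sym_bimod H)"
    by (rule tensor_pair_sym_bimod) (rule module_H)+
  show "hcomult H h \<in> carrier (tensor K (sym_bimod H) (sym_bimod H))" if "h \<in> carrier (sym_bimod H)" for h
    using hcomult_linear that by (auto simp: left_linear_def hom_def)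
\<comment> \<open>Only the field \<open>lact\<close> is rewritten: unfolding
  \<open>sym_bimod\<close> altogether would also change the tensor products in the goal.\<close>
qed (auto simp: hcoassoc sym_bimod_def[THEN arg_cong[of _ _ lact]])

lemma comult_closed [simp]: "h \<in> carrier H \<Longrightarrow> hcomult H h \<in> carrier (tensor K (sym_bimod H) (sym_bimod H))"
  using HH.comult_closed by simp

lemma tensor_eval_sw:
  assumes "module K G" "h \<in> carrier H" "\<And>x y. \<lbrakk>x \<in> carrier H; y \<in> carrier H\<rbrakk> \<Longrightarrow> b x y \<in> carrier G"
  shows "tensor_eval G b (hcomult H h) = sw G h b"
proof -
  interpret G: module K G by fact
  show ?thesis using HH.tsum_eq[OF _ G.abelian_group_axioms] assms by simp
qed

lemma sw_closed:
  assumes "module K G" "h \<in> carrier H"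
  shows "sw G h b \<in> carrier G"
proof -
  interpret G: module K G by fact
  show ?thesis using HH.tsum_closed[OF _ G.abelian_group_axioms] assms by simp
qed

lemma sw_compose:
  assumes "module K G" "module K G'" "klin K G G' f" "h \<in> carrier H"
    and "\<And>x y. \<lbrakk>x \<in> carrier H; y \<in> carrier H\<rbrakk> \<Longrightarrow> b x y \<in> carrier G"
  shows "f (sw G h b) = sw G' h (\<lambda>x y. f (b x y))"
proof -
  interpret G: module K G by fact
  interpret G': module K G' by fact
  show ?thesis
    by (rule HH.tsum_compose[OF _ G.abelian_group_axioms G'.abelian_group_axioms klin_hom, simplified carrier_sym_bimod])
       (use assms in auto)
qed

lemma klin_sw_fun:
  assumes "module K G" "t \<in> carrier (tensor K (sym_bimod H) (sym_bimod H))"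
    and "\<And>u v. \<lbrakk>u \<in> carrier H; v \<in> carrier H\<rbrakk> \<Longrightarrow> klin K L G (\<lambda>x. f x u v)"
  shows "klin K L G (\<lambda>x. tsum (carrier H) (carrier H) G t (f x))"
  by (rule klin_tsum[OF HH.tensor_pair_axioms, simplified carrier_sym_bimod]) (use assms in auto)

text \<open>This is linearity of the coproduct: a scalar acts on \<open>hcomult H x\<close> through
  its first leg, and bilinearity of \<open>b\<close> takes it out.\<close>

lemma klin_sw_arg:
  assumes "module K G" "bilin K H H G b" "klin K L H f"
  shows "klin K L G (\<lambda>x. sw G (f x) b)"
proof (rule klin_comp[OF _ assms(3)])
  interpret G: module K G by fact
  note bal = balanced_sym_bimod[OF assms(2)]
  have lin: "hcomult H (x \<oplus>\<^bsub>H\<^esub> y) = hcomult H x \<oplus>\<^bsub>tensor K (sym_bimod H) (sym_bimod H)\<^esub> hcomult H y"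
    if "x \<in> carrier H" "y \<in> carrier H" for x y
    using hcomult_linear that by (auto simp: left_linear_def hom_def sym_bimod_def)
  have sm: "hcomult H (r \<odot>\<^bsub>H\<^esub> x) = r \<triangleright>\<^bsub>tensor K (sym_bimod H) (sym_bimod H)\<^esub> hcomult H x"
    if "r \<in> carrier K" "x \<in> carrier H" for x r
    using hcomult_linear that by (auto simp: left_linear_def hom_def sym_bimod_def)
  show "klin K H G (\<lambda>h. sw G h b)"
  proof (rule klinI)
    show "sw G (r \<odot>\<^bsub>H\<^esub> x) b = r \<odot>\<^bsub>G\<^esub> sw G x b" if "r \<in> carrier K" "x \<in> carrier H" for r x
    proof -
      have "sw G (r \<odot>\<^bsub>H\<^esub> x) b = sw G x (\<lambda>u v. b (r \<odot>\<^bsub>H\<^esub> u) v)"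
        using HH.tsum_tensor_eval_pure[OF G.abelian_group_axioms bal HH.tensor_pair_axioms,
            of "hcomult H x" "\<lambda>u v. r \<odot>\<^bsub>H\<^esub> u" "\<lambda>u v. v"] that
        by (simp add: sm HH.lact_tensor sym_bimod_def[THEN arg_cong[of _ _ lact]])
      also have "\<dots> = sw G x (\<lambda>u v. r \<odot>\<^bsub>G\<^esub> b u v)"
        using that assms(2) by (intro tsum_cong) (auto simp: bilin_def klin_def)
      also have "\<dots> = r \<odot>\<^bsub>G\<^esub> sw G x b"
        using that assms(1) bilin_closed[OF assms(2)]
        by (intro sw_compose[symmetric]) (auto intro: klin_smult klin_id)
      finally show ?thesis .
    qed
    show "sw G (x \<oplus>\<^bsub>H\<^esub> y) b = sw G x b \<oplus>\<^bsub>G\<^esub> sw G y b" if "x \<in> carrier H" "y \<in> carrier H" for x y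
      using HH.tsum_add[OF G.abelian_group_axioms bal, of "hcomult H x" "hcomult H y"] that by (simp add: lin)
  qed (use sw_closed assms in auto)
qed

text \<open>The balancing conditions of \<open>csum_coassoc\<close> follow from trilinearity, since
  a scalar passes from any slot to the next.\<close>

lemma sw_coassoc:
  assumes G: "module K G"
    and f: "\<And>v w. \<lbrakk>v \<in> carrier H; w \<in> carrier H\<rbrakk> \<Longrightarrow> klin K H G (\<lambda>u. f u v w)"
      "\<And>u w. \<lbrakk>u \<in> carrier H; w \<in> carrier H\<rbrakk> \<Longrightarrow> klin K H G (\<lambda>v. f u v w)"
      "\<And>u v. \<lbrakk>u \<in> carrier H; v \<in> carrier H\<rbrakk> \<Longrightarrow> klin K H G (\<lambda>w. f u v w)"
    and h: "h \<in> carrier H"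
  shows "sw G h (\<lambda>x y. sw G x (\<lambda>u v. f u v y)) = sw G h (\<lambda>x y. sw G y (f x))"
proof -
  interpret G: module K G by fact
  have "balanced K (sym_bimod H) (sym_bimod H) G (f u)" if "u \<in> carrier H" for u
    using that f by (intro balanced_sym_bimod bilinI)
  then show ?thesis
    using HH.csum_coassoc[of G f h] klinD[OF f(1)] klinD[OF f(2)] h
    by (simp add: G.abelian_group_axioms)
       (simp add: sym_bimod_def)
qed

lemma klin_hcounit_smult:
  assumes "module K G" "g \<in> carrier G" "klin K L H f"
  shows "klin K L G (\<lambda>x. hcounit H (f x) \<odot>\<^bsub>G\<^esub> g)"
proof -
  interpret G: module K G by fact
  show ?thesis
    using klinD[OF assms(3)] assms(2) ring_hom_add[OF hcounit_hom] ring_hom_closed[OF hcounit_hom]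
    by (intro klinI) (auto simp: G.smult_l_distr hcounit_smult G.smult_assoc1)
qed

lemma hcounit_closed [simp]: "h \<in> carrier H \<Longrightarrow> hcounit H h \<in> carrier K"
  by (rule ring_hom_closed[OF hcounit_hom])

lemma sw_counit_left:
  assumes "module K G" "klin K H G f" "h \<in> carrier H"
  shows "sw G h (\<lambda>x y. hcounit H x \<odot>\<^bsub>G\<^esub> f y) = f h"
proof -
  interpret G: module K G by fact
  have "f h = f (sw H h (\<lambda>x y. hcounit H x \<odot>\<^bsub>H\<^esub> y))"
    using assms hcounit_left[of h] by (simp add: tensor_eval_sw module_H)
  also have "\<dots> = sw G h (\<lambda>x y. f (hcounit H x \<odot>\<^bsub>H\<^esub> y))"
    using assms by (intro sw_compose module_H) auto
  finally show ?thesis using klinD(3)[OF assms(2)] by simp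
qed

lemma sw_counit_right:
  assumes "module K G" "klin K H G f" "h \<in> carrier H"
  shows "sw G h (\<lambda>x y. hcounit H y \<odot>\<^bsub>G\<^esub> f x) = f h"
proof -
  interpret G: module K G by fact
  have "f h = f (sw H h (\<lambda>x y. hcounit H y \<odot>\<^bsub>H\<^esub> x))"
    using assms hcounit_right[of h] by (simp add: tensor_eval_sw module_H)
  also have "\<dots> = sw G h (\<lambda>x y. f (hcounit H y \<odot>\<^bsub>H\<^esub> x))"
    using assms by (intro sw_compose module_H) auto
  finally show ?thesis using klinD(3)[OF assms(2)] by simp
qed

lemma antipode_closed [simp]: "h \<in> carrier H \<Longrightarrow> antipode H h \<in> carrier H"
  using antipode_linear by (auto simp: left_linear_def hom_def)

lemma klin_antipode: "klin K H H (antipode H)"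
  using antipode_linear
  by (intro klinI) (auto simp: left_linear_def hom_def sym_bimod_def)

text \<open>The linear map \<open>f\<close> stands for the expression surrounding the product, so
  that the antipode axiom can be used in the middle of a longer term.\<close>

lemma sw_antipode_left:
  assumes "module K G" "klin K H G f" "h \<in> carrier H"
  shows "sw G h (\<lambda>x y. f (antipode H x \<otimes>\<^bsub>H\<^esub> y)) = hcounit H h \<odot>\<^bsub>G\<^esub> f \<one>\<^bsub>H\<^esub>"
proof -
  have "sw G h (\<lambda>x y. f (antipode H x \<otimes>\<^bsub>H\<^esub> y)) = f (sw H h (\<lambda>x y. antipode H x \<otimes>\<^bsub>H\<^esub> y))"
    using assms by (intro sw_compose[symmetric] module_H) auto
  also have "\<dots> = hcounit H h \<odot>\<^bsub>G\<^esub> f \<one>\<^bsub>H\<^esub>"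
    using assms antipode_left[of h] klinD(3)[OF assms(2)] by (simp add: tensor_eval_sw module_H)
  finally show ?thesis .
qed

lemma sw_antipode_right:
  assumes "module K G" "klin K H G f" "h \<in> carrier H"
  shows "sw G h (\<lambda>x y. f (x \<otimes>\<^bsub>H\<^esub> antipode H y)) = hcounit H h \<odot>\<^bsub>G\<^esub> f \<one>\<^bsub>H\<^esub>"
proof -
  have "sw G h (\<lambda>x y. f (x \<otimes>\<^bsub>H\<^esub> antipode H y)) = f (sw H h (\<lambda>x y. x \<otimes>\<^bsub>H\<^esub> antipode H y))"
    using assms by (intro sw_compose[symmetric] module_H) auto
  also have "\<dots> = hcounit H h \<odot>\<^bsub>G\<^esub> f \<one>\<^bsub>H\<^esub>"
    using assms antipode_right[of h] klinD(3)[OF assms(2)] by (simp add: tensor_eval_sw module_H)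
  finally show ?thesis .
qed

lemma sw_one:
  assumes "module K G" "bilin K H H G b"
  shows "sw G \<one>\<^bsub>H\<^esub> b = b \<one>\<^bsub>H\<^esub> \<one>\<^bsub>H\<^esub>"
proof -
  interpret G: module K G by fact
  show ?thesis
    using HH.tsum_pure[OF G.abelian_group_axioms balanced_sym_bimod[OF assms(2)]]
    by (simp add: hcomult_one)
qed

lemma sw_mult:
  assumes "module K G" "bilin K H H G b" "g \<in> carrier H" "h \<in> carrier H"
  shows "sw G (g \<otimes>\<^bsub>H\<^esub> h) b = sw G g (\<lambda>x y. sw G h (\<lambda>u v. b (x \<otimes>\<^bsub>H\<^esub> u) (y \<otimes>\<^bsub>H\<^esub> v)))"
proof -
  interpret G: module K G by fact
  interpret T: abelian_group "tensor K (sym_bimod H) (sym_bimod H)" by (rule HH.tensor_abelian_group)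
  note bal = balanced_sym_bimod[OF assms(2)] and ab = G.abelian_group_axioms
  note b = bilin_closed[OF assms(2)]
  let ?T = "tensor K (sym_bimod H) (sym_bimod H)" and ?p = "pure_tensor K (sym_bimod H) (sym_bimod H)"
  let ?in = "\<lambda>x y. tensor_eval ?T (\<lambda>u v. ?p (x \<otimes>\<^bsub>H\<^esub> u) (y \<otimes>\<^bsub>H\<^esub> v)) (hcomult H h)"
  have cl: "?in x y \<in> carrier ?T" if "x \<in> carrier H" "y \<in> carrier H" for x y
    using that assms by (intro HH.tensor_eval_closed HH.tensor_abelian_group HH.pure_tensor_closed) auto
  have "sw G (g \<otimes>\<^bsub>H\<^esub> h) b = tensor_eval G b (tensor_eval ?T ?in (hcomult H g))"
    using assms b hcomult_mult[of g h] by (subst tensor_eval_sw[symmetric]) auto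
  also have "\<dots> = tensor_eval G (\<lambda>x y. tensor_eval G b (?in x y)) (hcomult H g)"
    using assms cl
    by (intro HH.tensor_eval_compose HH.tensor_eval_hom ab bal T.abelian_group_axioms) auto
  also have "\<dots> = sw G g (\<lambda>x y. tensor_eval G b (?in x y))"
    using assms cl b by (intro HH.tsum_eq[simplified]) (auto intro!: HH.tensor_eval_closed ab HH.pure_tensor_closed HH.tensor_abelian_group)
  also have "\<dots> = sw G g (\<lambda>x y. sw G h (\<lambda>u v. b (x \<otimes>\<^bsub>H\<^esub> u) (y \<otimes>\<^bsub>H\<^esub> v)))"
  proof (rule tsum_cong[OF refl])
    fix x y assume "x \<in> carrier H" "y \<in> carrier H"
    then show "tensor_eval G b (?in x y) = sw G h (\<lambda>u v. b (x \<otimes>\<^bsub>H\<^esub> u) (y \<otimes>\<^bsub>H\<^esub> v))"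
      using HH.tsum_tensor_eval_pure[OF ab bal HH.tensor_pair_axioms, of "hcomult H h"
          "\<lambda>u v. x \<otimes>\<^bsub>H\<^esub> u" "\<lambda>u v. y \<otimes>\<^bsub>H\<^esub> v"] HH.tsum_eq[OF cl ab, of x y b] assms b
      by simp
  qed
  finally show ?thesis .
qed

lemma sw_swap:
  assumes "module K G" "g \<in> carrier H" "h \<in> carrier H"
    and "\<And>x y u v. \<lbrakk>x \<in> carrier H; y \<in> carrier H; u \<in> carrier H; v \<in> carrier H\<rbrakk>
      \<Longrightarrow> f x y u v \<in> carrier G"
  shows "sw G g (\<lambda>x y. sw G h (f x y)) = sw G h (\<lambda>u v. sw G g (\<lambda>x y. f x y u v))"
proof -
  interpret G: module K G by fact
  show ?thesis
    using tsum_swap[OF HH.tensor_pair_axioms HH.tensor_pair_axioms, of "hcomult H g" "hcomult H h" G f]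
      assms by (simp add: G.abelian_group_axioms)
qed

text \<open>Linearity of a nested Sweedler expression can be read off its syntax: the rules peel off
  one product, antipode, counit or sum at a time.\<close>

lemmas klin_intros = klin_id klin_prod_left klin_prod_right klin_comp[OF klin_antipode]
  klin_sw_fun klin_sw_arg klin_hcounit_smult bilinI

text \<open>Both sides are convolution inverses of the multiplication
  \<open>H \<otimes> H \<rightarrow> H\<close>. Uniqueness of inverses is written out as one chain,
  \<open>S(h) S(g) = S(g1 h1) g2 h2 S(h3) S(g3) = S(g h)\<close>, whose middle term comes from the
  counits of \<open>g\<close> and \<open>h\<close>.\<close>

lemma antipode_mult:
  assumes g: "g \<in> carrier H" and h: "h \<in> carrier H"
  shows "antipode H (g \<otimes>\<^bsub>H\<^esub> h) = antipode H h \<otimes>\<^bsub>H\<^esub> antipode H g"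
proof -
  note [simp] = module_H
  let ?S = "antipode H" and ?\<epsilon> = "hcounit H"
  let ?f = "\<lambda>p u v r s t. (?S (p \<otimes>\<^bsub>H\<^esub> r) \<otimes>\<^bsub>H\<^esub> (u \<otimes>\<^bsub>H\<^esub> s)) \<otimes>\<^bsub>H\<^esub> (?S t \<otimes>\<^bsub>H\<^esub> ?S v)"
  have "?S h \<otimes>\<^bsub>H\<^esub> ?S g = sw H g (\<lambda>m v. ?\<epsilon> m \<odot>\<^bsub>H\<^esub> (?S h \<otimes>\<^bsub>H\<^esub> ?S v))"
    by (rule sw_counit_left[symmetric]) (auto intro!: klin_intros simp: g h)
  also have "\<dots> = sw H g (\<lambda>m v. ?\<epsilon> m \<odot>\<^bsub>H\<^esub> sw H h (\<lambda>n t. ?\<epsilon> n \<odot>\<^bsub>H\<^esub> (?S t \<otimes>\<^bsub>H\<^esub> ?S v)))"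
  proof (rule tsum_cong[OF refl])
    fix m v assume mv: "m \<in> carrier H" "v \<in> carrier H"
    show "?\<epsilon> m \<odot>\<^bsub>H\<^esub> (?S h \<otimes>\<^bsub>H\<^esub> ?S v)
        = ?\<epsilon> m \<odot>\<^bsub>H\<^esub> sw H h (\<lambda>n t. ?\<epsilon> n \<odot>\<^bsub>H\<^esub> (?S t \<otimes>\<^bsub>H\<^esub> ?S v))"
      by (subst sw_counit_left) (auto intro!: klin_intros simp: h mv)
  qed
  also have "\<dots> = sw H g (\<lambda>m v. sw H h (\<lambda>n t. ?\<epsilon> (m \<otimes>\<^bsub>H\<^esub> n) \<odot>\<^bsub>H\<^esub> (\<one>\<^bsub>H\<^esub> \<otimes>\<^bsub>H\<^esub> (?S t \<otimes>\<^bsub>H\<^esub> ?S v))))"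
  proof (rule tsum_cong[OF refl])
    fix m v assume mv: "m \<in> carrier H" "v \<in> carrier H"
    then show "?\<epsilon> m \<odot>\<^bsub>H\<^esub> sw H h (\<lambda>n t. ?\<epsilon> n \<odot>\<^bsub>H\<^esub> (?S t \<otimes>\<^bsub>H\<^esub> ?S v))
        = sw H h (\<lambda>n t. ?\<epsilon> (m \<otimes>\<^bsub>H\<^esub> n) \<odot>\<^bsub>H\<^esub> (\<one>\<^bsub>H\<^esub> \<otimes>\<^bsub>H\<^esub> (?S t \<otimes>\<^bsub>H\<^esub> ?S v)))"
      using h
      by (subst sw_compose[where f = "\<lambda>z. ?\<epsilon> m \<odot>\<^bsub>H\<^esub> z" and G' = H])
         (auto intro!: klin_smult klin_id tsum_cong simp: ring_hom_mult[OF hcounit_hom] smult_assoc1)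
  qed
  \<comment> \<open>The antipode axiom read backwards for the product \<open>m n\<close>, at the
    unit that the previous step put in place for it.\<close>
  also have "\<dots> = sw H g (\<lambda>m v. sw H h (\<lambda>n t. sw H (m \<otimes>\<^bsub>H\<^esub> n) (\<lambda>x y.
      (?S x \<otimes>\<^bsub>H\<^esub> y) \<otimes>\<^bsub>H\<^esub> (?S t \<otimes>\<^bsub>H\<^esub> ?S v))))"
    by (rule tcong, rule tcong, subst sw_antipode_left[where f = "\<lambda>z. z \<otimes>\<^bsub>H\<^esub> (_ \<otimes>\<^bsub>H\<^esub> _)"])
       (auto intro!: klin_intros)
  also have "\<dots> = sw H g (\<lambda>m v. sw H h (\<lambda>n t. sw H m (\<lambda>p u. sw H n (\<lambda>r s. ?f p u v r s t))))"
    by (rule tcong, rule tcong, subst sw_mult) (auto intro!: klin_intros)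
  \<comment> \<open>The sums over the legs of \<open>g\<close> and of \<open>h\<close> are
    separated, so that coassociativity can be applied to each.\<close>
  also have "\<dots> = sw H g (\<lambda>m v. sw H m (\<lambda>p u. sw H h (\<lambda>n t. sw H n (\<lambda>r s. ?f p u v r s t))))"
    by (rule tcong, rule sw_swap) (simp_all add: h sw_closed)
  also have "\<dots> = sw H g (\<lambda>p q. sw H q (\<lambda>u v. sw H h (\<lambda>n t. sw H n (\<lambda>r s. ?f p u v r s t))))"
    by (rule sw_coassoc) (auto intro!: klin_intros simp: g h)
  also have "\<dots> = sw H g (\<lambda>p q. sw H q (\<lambda>u v. sw H h (\<lambda>r w. sw H w (\<lambda>s t. ?f p u v r s t))))"
    by (rule tcong, rule tcong, rule sw_coassoc) (auto intro!: klin_intros simp: h)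
  also have "\<dots> = sw H g (\<lambda>p q. sw H q (\<lambda>u v. sw H h (\<lambda>r w. sw H w (\<lambda>s t.
      (?S (p \<otimes>\<^bsub>H\<^esub> r) \<otimes>\<^bsub>H\<^esub> u) \<otimes>\<^bsub>H\<^esub> (s \<otimes>\<^bsub>H\<^esub> ?S t) \<otimes>\<^bsub>H\<^esub> ?S v))))"
    by (simp add: A.m_assoc)
  \<comment> \<open>The legs of \<open>h\<close> sit innermost and cancel first; only then do
    \<open>u\<close> and \<open>S(v)\<close> become adjacent.\<close>
  also have "\<dots> = sw H g (\<lambda>p q. sw H q (\<lambda>u v. sw H h (\<lambda>r w. ?\<epsilon> w \<odot>\<^bsub>H\<^esub>
      ((?S (p \<otimes>\<^bsub>H\<^esub> r) \<otimes>\<^bsub>H\<^esub> u) \<otimes>\<^bsub>H\<^esub> \<one>\<^bsub>H\<^esub> \<otimes>\<^bsub>H\<^esub> ?S v))))"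
    by (rule tcong, rule tcong, rule tcong, rule sw_antipode_right[where f = "\<lambda>z. (_ \<otimes>\<^bsub>H\<^esub> _) \<otimes>\<^bsub>H\<^esub> z \<otimes>\<^bsub>H\<^esub> _"])
       (auto intro!: klin_intros)
  also have "\<dots> = sw H g (\<lambda>p q. sw H q (\<lambda>u v. ?S (p \<otimes>\<^bsub>H\<^esub> h) \<otimes>\<^bsub>H\<^esub> u \<otimes>\<^bsub>H\<^esub> \<one>\<^bsub>H\<^esub> \<otimes>\<^bsub>H\<^esub> ?S v))"
    by (rule tcong, rule tcong, rule sw_counit_right) (auto intro!: klin_intros simp: h)
  also have "\<dots> = sw H g (\<lambda>p q. sw H q (\<lambda>u v. ?S (p \<otimes>\<^bsub>H\<^esub> h) \<otimes>\<^bsub>H\<^esub> (u \<otimes>\<^bsub>H\<^esub> ?S v)))"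
    by (simp add: A.m_assoc h)
  also have "\<dots> = sw H g (\<lambda>p q. ?\<epsilon> q \<odot>\<^bsub>H\<^esub> (?S (p \<otimes>\<^bsub>H\<^esub> h) \<otimes>\<^bsub>H\<^esub> \<one>\<^bsub>H\<^esub>))"
    by (rule tcong, rule sw_antipode_right[where f = "\<lambda>z. _ \<otimes>\<^bsub>H\<^esub> z"]) (auto intro!: klin_intros simp: h)
  also have "\<dots> = ?S (g \<otimes>\<^bsub>H\<^esub> h) \<otimes>\<^bsub>H\<^esub> \<one>\<^bsub>H\<^esub>"
    by (rule sw_counit_right) (auto intro!: klin_intros simp: g h)
  finally show ?thesis using g h by simp
qed

text \<open>The unit is grouplike with counit 1, so the antipode axiom at the unit reads
  \<open>S(1) 1 = 1\<close>.\<close>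

lemma antipode_one: "antipode H \<one>\<^bsub>H\<^esub> = \<one>\<^bsub>H\<^esub>"
proof -
  have "sw H \<one>\<^bsub>H\<^esub> (\<lambda>x y. antipode H x \<otimes>\<^bsub>H\<^esub> y) = antipode H \<one>\<^bsub>H\<^esub> \<otimes>\<^bsub>H\<^esub> \<one>\<^bsub>H\<^esub>"
    by (rule sw_one) (auto intro!: klin_intros module_H)
  moreover have "sw H \<one>\<^bsub>H\<^esub> (\<lambda>x y. antipode H x \<otimes>\<^bsub>H\<^esub> y) = hcounit H \<one>\<^bsub>H\<^esub> \<odot>\<^bsub>H\<^esub> \<one>\<^bsub>H\<^esub>"
    by (rule sw_antipode_left[where f = "\<lambda>z. z"]) (auto intro!: klin_intros module_H)
  ultimately show ?thesis using ring_hom_one[OF hcounit_hom] by simp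
qed

end

section \<open>The inverse of a bijective antipode\<close>

locale bij_hopf_algebra = hopf_algebra +
  assumes bij_antipode: "bij_betw (antipode H) (carrier H) (carrier H)"
begin

abbreviation "Sinv \<equiv> inv_into (carrier H) (antipode H)"

lemma Sinv_closed [simp]: "h \<in> carrier H \<Longrightarrow> Sinv h \<in> carrier H"
  using bij_antipode by (metis bij_betw_imp_surj_on inv_into_into)

lemma antipode_Sinv [simp]: "h \<in> carrier H \<Longrightarrow> antipode H (Sinv h) = h"
  using bij_antipode by (rule bij_betw_inv_into_right)

lemma Sinv_eqI: "\<lbrakk>x \<in> carrier H; antipode H x = h\<rbrakk> \<Longrightarrow> Sinv h = x"
  using bij_antipode by (metis bij_betw_inv_into_left)

lemma Sinv_mult: "\<lbrakk>g \<in> carrier H; h \<in> carrier H\<rbrakk> \<Longrightarrow> Sinv (g \<otimes>\<^bsub>H\<^esub> h) = Sinv h \<otimes>\<^bsub>H\<^esub> Sinv g"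
  by (rule Sinv_eqI) (simp_all add: antipode_mult)

lemma Sinv_one: "Sinv \<one>\<^bsub>H\<^esub> = \<one>\<^bsub>H\<^esub>"
  by (rule Sinv_eqI) (simp_all add: antipode_one)

lemma klin_Sinv: "klin K H H Sinv"
  using klinD[OF klin_antipode] by (intro klinI) (auto intro!: Sinv_eqI)

lemmas klin_intros' = klin_intros klin_comp[OF klin_Sinv]

lemma sw_Sinv_left:
  assumes "module K G" "klin K H G f" "h \<in> carrier H"
  shows "sw G h (\<lambda>x y. f (Sinv y \<otimes>\<^bsub>H\<^esub> x)) = hcounit H h \<odot>\<^bsub>G\<^esub> f \<one>\<^bsub>H\<^esub>"
proof -
  let ?z = "sw H h (\<lambda>x y. Sinv y \<otimes>\<^bsub>H\<^esub> x)"
  have z: "?z \<in> carrier H" by (rule sw_closed[OF module_H assms(3)])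
  have "antipode H ?z = sw H h (\<lambda>x y. antipode H x \<otimes>\<^bsub>H\<^esub> y)"
    using assms by (subst sw_compose[OF module_H module_H klin_antipode])
      (auto intro!: tsum_cong simp: antipode_mult)
  also have "\<dots> = hcounit H h \<odot>\<^bsub>H\<^esub> \<one>\<^bsub>H\<^esub>"
    by (rule sw_antipode_left[where f = "\<lambda>z. z"]) (auto intro!: klin_intros module_H assms)
  \<comment> \<open>The antipode of \<open>?z\<close> is a multiple of the unit, so
    \<open>?z\<close> is recovered by \<open>Sinv\<close>, which is linear and fixes the
    unit.\<close>
  finally have "?z = hcounit H h \<odot>\<^bsub>H\<^esub> \<one>\<^bsub>H\<^esub>"
    using Sinv_eqI[OF z] klinD(3)[OF klin_Sinv, of "hcounit H h" "\<one>\<^bsub>H\<^esub>"] assms by (simp add: Sinv_one)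
  then have "f ?z = hcounit H h \<odot>\<^bsub>G\<^esub> f \<one>\<^bsub>H\<^esub>" using assms klinD(3)[OF assms(2)] by simp
  then show ?thesis using assms by (subst (asm) sw_compose[OF module_H _ assms(2)]) auto
qed

lemma sw_Sinv_right:
  assumes "module K G" "klin K H G f" "h \<in> carrier H"
  shows "sw G h (\<lambda>x y. f (y \<otimes>\<^bsub>H\<^esub> Sinv x)) = hcounit H h \<odot>\<^bsub>G\<^esub> f \<one>\<^bsub>H\<^esub>"
proof -
  let ?z = "sw H h (\<lambda>x y. y \<otimes>\<^bsub>H\<^esub> Sinv x)"
  have z: "?z \<in> carrier H" by (rule sw_closed[OF module_H assms(3)])
  have "antipode H ?z = sw H h (\<lambda>x y. x \<otimes>\<^bsub>H\<^esub> antipode H y)"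
    using assms by (subst sw_compose[OF module_H module_H klin_antipode])
      (auto intro!: tsum_cong simp: antipode_mult)
  also have "\<dots> = hcounit H h \<odot>\<^bsub>H\<^esub> \<one>\<^bsub>H\<^esub>"
    by (rule sw_antipode_right[where f = "\<lambda>z. z"]) (auto intro!: klin_intros module_H assms)
  finally have "?z = hcounit H h \<odot>\<^bsub>H\<^esub> \<one>\<^bsub>H\<^esub>"
    using Sinv_eqI[OF z] klinD(3)[OF klin_Sinv, of "hcounit H h" "\<one>\<^bsub>H\<^esub>"] assms by (simp add: Sinv_one)
  then have "f ?z = hcounit H h \<odot>\<^bsub>G\<^esub> f \<one>\<^bsub>H\<^esub>" using assms klinD(3)[OF assms(2)] by simp
  then show ?thesis using assms by (subst (asm) sw_compose[OF module_H _ assms(2)]) auto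
qed

text \<open>Meant to be used from right to left: a unit in the second slot is replaced by
  \<open>Sinv(h3) h2\<close>, at the price of splitting \<open>h\<close> into three legs.\<close>

lemma sw_cancel_right:
  assumes "module K G" and F: "bilin K H H G F" and h: "h \<in> carrier H"
  shows "sw G h (\<lambda>p q. sw G q (\<lambda>u v. F p (Sinv v \<otimes>\<^bsub>H\<^esub> u))) = F h \<one>\<^bsub>H\<^esub>"
proof -
  have "sw G h (\<lambda>p q. sw G q (\<lambda>u v. F p (Sinv v \<otimes>\<^bsub>H\<^esub> u))) = sw G h (\<lambda>p q. hcounit H q \<odot>\<^bsub>G\<^esub> F p \<one>\<^bsub>H\<^esub>)"
    by (rule tcong, rule sw_Sinv_left) (auto intro!: klin_intros' bilin_right[OF F] simp: assms)
  also have "\<dots> = F h \<one>\<^bsub>H\<^esub>"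
    by (rule sw_counit_right) (auto intro!: klin_intros' bilin_left[OF F] simp: assms)
  finally show ?thesis .
qed

text \<open>The pair to be cancelled is divided between the outer and the inner sum. Coassociativity
  brings \<open>p\<close> and \<open>s\<close> under one coproduct, and the counit law absorbs the
  scalar that remains.\<close>

lemma sw_cancel_left:
  assumes "module K G" and F: "bilin K H H G F" and h: "h \<in> carrier H"
  shows "sw G h (\<lambda>p q. sw G q (\<lambda>s w. F (s \<otimes>\<^bsub>H\<^esub> Sinv p) w)) = F \<one>\<^bsub>H\<^esub> h" (is ?thesis1)
    and "sw G h (\<lambda>p q. sw G q (\<lambda>s w. F (Sinv s \<otimes>\<^bsub>H\<^esub> p) w)) = F \<one>\<^bsub>H\<^esub> h" (is ?thesis2)
proof -
  note rules = klin_intros' bilin_left[OF F] bilin_right[OF F]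
  have c: "sw G h (\<lambda>z w. hcounit H z \<odot>\<^bsub>G\<^esub> F \<one>\<^bsub>H\<^esub> w) = F \<one>\<^bsub>H\<^esub> h"
    by (rule sw_counit_left) (auto intro!: rules simp: assms)
  have "sw G h (\<lambda>p q. sw G q (\<lambda>s w. F (s \<otimes>\<^bsub>H\<^esub> Sinv p) w))
      = sw G h (\<lambda>z w. sw G z (\<lambda>p s. F (s \<otimes>\<^bsub>H\<^esub> Sinv p) w))"
    by (rule sw_coassoc[symmetric]) (auto intro!: rules simp: assms)
  also have "\<dots> = sw G h (\<lambda>z w. hcounit H z \<odot>\<^bsub>G\<^esub> F \<one>\<^bsub>H\<^esub> w)"
    by (rule tcong, rule sw_Sinv_right[where f = "\<lambda>z. F z _"]) (auto intro!: rules simp: assms)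
  finally show ?thesis1 unfolding c .
  have "sw G h (\<lambda>p q. sw G q (\<lambda>s w. F (Sinv s \<otimes>\<^bsub>H\<^esub> p) w))
      = sw G h (\<lambda>z w. sw G z (\<lambda>p s. F (Sinv s \<otimes>\<^bsub>H\<^esub> p) w))"
    by (rule sw_coassoc[symmetric]) (auto intro!: rules simp: assms)
  also have "\<dots> = sw G h (\<lambda>z w. hcounit H z \<odot>\<^bsub>G\<^esub> F \<one>\<^bsub>H\<^esub> w)"
    by (rule tcong, rule sw_Sinv_left[where f = "\<lambda>z. F z _"]) (auto intro!: rules simp: assms)
  finally show ?thesis2 unfolding c .
qed

text \<open>An inverse argument based on multiplicativity of the coproduct. In legs,
  \<open>\<Delta>(Sinv h) = (Sinv h5 \<otimes> Sinv h4) (h2 \<otimes> h3) \<Delta>(Sinv h1) = (Sinv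
  h4 \<otimes> Sinv h3) \<Delta>(h2 Sinv h1) = Sinv h2 \<otimes> Sinv h1\<close>.\<close>

lemma sw_Sinv:
  assumes "module K G" and b: "bilin K H H G b" and h: "h \<in> carrier H"
  shows "sw G (Sinv h) b = sw G h (\<lambda>x y. b (Sinv y) (Sinv x))"
proof -
  note rules = klin_intros' bilin_left[OF b] bilin_right[OF b]
  note [simp] = assms(1) h module_H bilin_closed[OF b] sw_closed
  let ?g = "\<lambda>p u s t v. sw G (Sinv p)
    (\<lambda>x y. b ((Sinv v \<otimes>\<^bsub>H\<^esub> u) \<otimes>\<^bsub>H\<^esub> x) ((Sinv t \<otimes>\<^bsub>H\<^esub> s) \<otimes>\<^bsub>H\<^esub> y))"
  \<comment> \<open>The unit marks the place where the first pair, \<open>Sinv v\<close> and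
    \<open>u\<close>, is inserted.\<close>
  have "sw G (Sinv h) b = sw G (Sinv h) (\<lambda>x y. b (\<one>\<^bsub>H\<^esub> \<otimes>\<^bsub>H\<^esub> x) y)" by simp
  also have "\<dots> = sw G h (\<lambda>p q. sw G q (\<lambda>u v. sw G (Sinv p) (\<lambda>x y. b ((Sinv v \<otimes>\<^bsub>H\<^esub> u) \<otimes>\<^bsub>H\<^esub> x) y)))"
    by (rule sw_cancel_right[where F = "\<lambda>p z. sw G (Sinv p) (\<lambda>x y. b (z \<otimes>\<^bsub>H\<^esub> x) y)", symmetric])
       (auto intro!: rules)
  also have "\<dots> = sw G h (\<lambda>p q. sw G q (\<lambda>u v. sw G (Sinv p)
      (\<lambda>x y. b ((Sinv v \<otimes>\<^bsub>H\<^esub> u) \<otimes>\<^bsub>H\<^esub> x) (\<one>\<^bsub>H\<^esub> \<otimes>\<^bsub>H\<^esub> y))))" by simp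
  \<comment> \<open>The second pair is inserted by splitting the leg \<open>u\<close>, so that the
    new \<open>u\<close> and \<open>s\<close> are neighbours and can be joined to one
    coproduct.\<close>
  also have "\<dots> = sw G h (\<lambda>p q. sw G q (\<lambda>u v. sw G u (\<lambda>u w. sw G w (\<lambda>s t. ?g p u s t v))))"
    by (rule tcong, rule tcong, rule sw_cancel_right[where F = "\<lambda>u z. sw G (Sinv _)
          (\<lambda>x y. b ((Sinv _ \<otimes>\<^bsub>H\<^esub> u) \<otimes>\<^bsub>H\<^esub> x) (z \<otimes>\<^bsub>H\<^esub> y))", symmetric])
       (auto intro!: rules)
  \<comment> \<open>Rebracketing until \<open>p\<close> and \<open>e\<close>, whose legs are
    \<open>u\<close> and \<open>s\<close>, make up the first half \<open>m\<close> of
    \<open>h\<close>, and \<open>t\<close>, \<open>v\<close> the second half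
    \<open>n\<close>.\<close>
  also have "\<dots> = sw G h (\<lambda>p q. sw G q (\<lambda>u v. sw G u (\<lambda>e t. sw G e (\<lambda>u s. ?g p u s t v))))"
    by (rule tcong, rule tcong, rule sw_coassoc[symmetric]) (auto intro!: rules)
  also have "\<dots> = sw G h (\<lambda>p q. sw G q (\<lambda>e n. sw G n (\<lambda>t v. sw G e (\<lambda>u s. ?g p u s t v))))"
    by (rule tcong, rule sw_coassoc) (auto intro!: rules)
  also have "\<dots> = sw G h (\<lambda>m n. sw G m (\<lambda>p e. sw G n (\<lambda>t v. sw G e (\<lambda>u s. ?g p u s t v))))"
    by (rule sw_coassoc[symmetric]) (auto intro!: rules)
  also have "\<dots> = sw G h (\<lambda>m n. sw G n (\<lambda>t v. sw G m (\<lambda>p e. sw G e (\<lambda>u s. ?g p u s t v))))"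
    by (rule tcong, rule sw_swap) simp_all
  \<comment> \<open>Multiplicativity read backwards:
    \<open>\<Delta>(e) \<Delta>(Sinv p) = \<Delta>(e Sinv p)\<close>, a pair that cancels.\<close>
  also have "\<dots> = sw G h (\<lambda>m n. sw G n (\<lambda>t v. sw G m (\<lambda>p e. sw G (e \<otimes>\<^bsub>H\<^esub> Sinv p)
      (\<lambda>x y. b (Sinv v \<otimes>\<^bsub>H\<^esub> x) (Sinv t \<otimes>\<^bsub>H\<^esub> y)))))"
    by (rule tcong, rule tcong, rule tcong, subst sw_mult) (auto intro!: rules simp: A.m_assoc)
  also have "\<dots> = sw G h (\<lambda>m n. sw G n (\<lambda>t v. hcounit H m \<odot>\<^bsub>G\<^esub> sw G \<one>\<^bsub>H\<^esub>
      (\<lambda>x y. b (Sinv v \<otimes>\<^bsub>H\<^esub> x) (Sinv t \<otimes>\<^bsub>H\<^esub> y))))"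
    by (rule tcong, rule tcong, rule sw_Sinv_right[where f = "\<lambda>z. sw G z _"]) (auto intro!: rules)
  also have "\<dots> = sw G h (\<lambda>m n. sw G n (\<lambda>t v. hcounit H m \<odot>\<^bsub>G\<^esub> b (Sinv v) (Sinv t)))"
    by (rule tcong, rule tcong, subst sw_one) (auto intro!: rules)
  also have "\<dots> = sw G h (\<lambda>m n. hcounit H m \<odot>\<^bsub>G\<^esub> sw G n (\<lambda>t v. b (Sinv v) (Sinv t)))"
    by (rule tcong, rule sw_compose[where f = "\<lambda>z. hcounit H _ \<odot>\<^bsub>G\<^esub> z", symmetric])
       (auto intro!: klin_smult klin_id)
  also have "\<dots> = sw G h (\<lambda>t v. b (Sinv v) (Sinv t))"
    by (rule sw_counit_left) (auto intro!: rules)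
  finally show ?thesis .
qed

end


section \<open>The left dual ring of a coring\<close>

context A_coring
begin

abbreviation "D \<equiv> left_dual A C"
abbreviation "cw G c b \<equiv> tsum (carrier C) (carrier C) G (comult C c) b"

sublocale CC: comultiplication A C "comult C"
proof (intro comultiplication.intro comultiplication_axioms.intro tensor_pair.intro tensor_pair_axioms.intro)
  show "comult C c \<in> carrier (tensor A C C)" if "c \<in> carrier C" for c
    using comult_bilinear that by (auto simp: left_linear_def hom_def)
qed (simp_all add: coassoc L.act_closed R.act_closed L.M.abelian_group_axioms)

lemma one_smult: "\<lbrakk>r \<in> carrier K; c \<in> carrier C\<rbrakk> \<Longrightarrow> (r \<odot>\<^bsub>A\<^esub> \<one>\<^bsub>A\<^esub>) \<triangleright>\<^bsub>C\<^esub> c = r \<odot>\<^bsub>C\<^esub> c"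
  by (simp add: L.act_smult_left L.act_one)

lemma tensor_eval_cw:
  assumes "abelian_group G" "c \<in> carrier C" "\<And>x y. \<lbrakk>x \<in> carrier C; y \<in> carrier C\<rbrakk> \<Longrightarrow> b x y \<in> carrier G"
  shows "tensor_eval G b (comult C c) = cw G c b"
  using assms by (intro CC.tsum_eq CC.comult_closed)

lemma cw_closed: "\<lbrakk>abelian_group G; c \<in> carrier C\<rbrakk> \<Longrightarrow> cw G c b \<in> carrier G"
  by (intro CC.tsum_closed CC.comult_closed)

lemma cw_compose:
  assumes "module K G" "module K G'" "klin K G G' f" "c \<in> carrier C"
    and "\<And>x y. \<lbrakk>x \<in> carrier C; y \<in> carrier C\<rbrakk> \<Longrightarrow> b x y \<in> carrier G"
  shows "f (cw G c b) = cw G' c (\<lambda>x y. f (b x y))"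
proof -
  interpret G: module K G by fact
  interpret G': module K G' by fact
  show ?thesis
    using assms
    by (intro CC.tsum_compose CC.comult_closed klin_hom G.abelian_group_axioms G'.abelian_group_axioms)
qed

lemma cw_add:
  assumes "abelian_group G" "balanced A C C G b" "c \<in> carrier C" "c' \<in> carrier C"
  shows "cw G (c \<oplus>\<^bsub>C\<^esub> c') b = cw G c b \<oplus>\<^bsub>G\<^esub> cw G c' b"
proof -
  have "comult C (c \<oplus>\<^bsub>C\<^esub> c') = comult C c \<oplus>\<^bsub>tensor A C C\<^esub> comult C c'"
    using comult_bilinear assms(3,4) by (auto simp: left_linear_def hom_def)
  then show ?thesis using assms by (simp add: CC.tsum_add CC.comult_closed)
qed

text \<open>Bilinearity of the coproduct in summed form: the left action reaches only the first leg,
  the right action in \<open>cw_ract\<close> only the second.\<close>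

lemma cw_lact:
  assumes "abelian_group G" "balanced A C C G b" "a \<in> carrier A" "c \<in> carrier C"
  shows "cw G (a \<triangleright>\<^bsub>C\<^esub> c) b = cw G c (\<lambda>x y. b (a \<triangleright>\<^bsub>C\<^esub> x) y)"
proof -
  have "comult C (a \<triangleright>\<^bsub>C\<^esub> c) = a \<triangleright>\<^bsub>tensor A C C\<^esub> comult C c"
    using comult_bilinear assms(3,4) by (auto simp: left_linear_def)
  then show ?thesis
    using CC.tsum_tensor_eval_pure[OF assms(1,2) CC.tensor_pair_axioms, of "comult C c"
        "\<lambda>x y. a \<triangleright>\<^bsub>C\<^esub> x" "\<lambda>x y. y"] assms
    by (simp add: CC.lact_tensor CC.comult_closed L.act_closed)
qed

lemma cw_ract:
  assumes "abelian_group G" "balanced A C C G b" "a \<in> carrier A" "c \<in> carrier C"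
  shows "cw G (c \<triangleleft>\<^bsub>C\<^esub> a) b = cw G c (\<lambda>x y. b x (y \<triangleleft>\<^bsub>C\<^esub> a))"
proof -
  have "comult C (c \<triangleleft>\<^bsub>C\<^esub> a) = comult C c \<triangleleft>\<^bsub>tensor A C C\<^esub> a"
    using comult_bilinear assms(3,4) by (auto simp: right_linear_def)
  then show ?thesis
    using CC.tsum_tensor_eval_pure[OF assms(1,2) CC.tensor_pair_axioms, of "comult C c"
        "\<lambda>x y. x" "\<lambda>x y. y \<triangleleft>\<^bsub>C\<^esub> a"] assms
    by (simp add: CC.ract_tensor CC.comult_closed R.act_closed)
qed

section \<open>The ring of left linear functionals\<close>

lemma dual_iff:
  "f \<in> carrier D \<longleftrightarrow> f \<in> extensional (carrier C) \<and> (\<forall>c \<in> carrier C. f c \<in> carrier A) \<and>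
     (\<forall>c \<in> carrier C. \<forall>c' \<in> carrier C. f (c \<oplus>\<^bsub>C\<^esub> c') = f c \<oplus>\<^bsub>A\<^esub> f c') \<and>
     (\<forall>a \<in> carrier A. \<forall>c \<in> carrier C. f (a \<triangleright>\<^bsub>C\<^esub> c) = a \<otimes>\<^bsub>A\<^esub> f c)"
  by (auto simp: left_dual_def left_linear_def regular_bimod_def hom_def)

lemma dualI:
  assumes "f \<in> extensional (carrier C)" "\<And>c. c \<in> carrier C \<Longrightarrow> f c \<in> carrier A"
    and "\<And>c c'. \<lbrakk>c \<in> carrier C; c' \<in> carrier C\<rbrakk> \<Longrightarrow> f (c \<oplus>\<^bsub>C\<^esub> c') = f c \<oplus>\<^bsub>A\<^esub> f c'"
    and "\<And>a c. \<lbrakk>a \<in> carrier A; c \<in> carrier C\<rbrakk> \<Longrightarrow> f (a \<triangleright>\<^bsub>C\<^esub> c) = a \<otimes>\<^bsub>A\<^esub> f c"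
  shows "f \<in> carrier D"
  using assms by (simp add: dual_iff)

lemma dualD:
  assumes "f \<in> carrier D"
  shows "\<And>c. c \<in> carrier C \<Longrightarrow> f c \<in> carrier A"
    and "\<And>c c'. \<lbrakk>c \<in> carrier C; c' \<in> carrier C\<rbrakk> \<Longrightarrow> f (c \<oplus>\<^bsub>C\<^esub> c') = f c \<oplus>\<^bsub>A\<^esub> f c'"
    and "\<And>a c. \<lbrakk>a \<in> carrier A; c \<in> carrier C\<rbrakk> \<Longrightarrow> f (a \<triangleright>\<^bsub>C\<^esub> c) = a \<otimes>\<^bsub>A\<^esub> f c"
  using assms by (simp_all add: dual_iff)

lemma dual_eqI:
  assumes "f \<in> carrier D" "g \<in> carrier D" "\<And>c. c \<in> carrier C \<Longrightarrow> f c = g c"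
  shows "f = g"
  using assms by (auto simp: dual_iff intro: extensionalityI)

text \<open>\<open>left_linear\<close> asks for additivity and \<open>A\<close>-linearity; scalars
  come along because \<open>r\<close> acts on \<open>C\<close> as the element \<open>r 1\<close> of
  \<open>A\<close> does.\<close>

lemma dual_smult:
  assumes "f \<in> carrier D" "r \<in> carrier K" "c \<in> carrier C"
  shows "f (r \<odot>\<^bsub>C\<^esub> c) = r \<odot>\<^bsub>A\<^esub> f c"
  using dualD(3)[OF assms(1), of "r \<odot>\<^bsub>A\<^esub> \<one>\<^bsub>A\<^esub>" c] dualD(1)[OF assms(1)] assms(2,3)
  by (simp add: one_smult L.A.smult_mult_left)

lemma klin_dual: "f \<in> carrier D \<Longrightarrow> klin K C A f"
  by (rule klinI) (simp_all add: dualD dual_smult)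

lemmas klin_dual_comp = klin_comp[OF klin_dual]

lemma counit_props:
  "\<And>c. c \<in> carrier C \<Longrightarrow> counit C c \<in> carrier A"
  "\<And>c c'. \<lbrakk>c \<in> carrier C; c' \<in> carrier C\<rbrakk> \<Longrightarrow> counit C (c \<oplus>\<^bsub>C\<^esub> c') = counit C c \<oplus>\<^bsub>A\<^esub> counit C c'"
  "\<And>a c. \<lbrakk>a \<in> carrier A; c \<in> carrier C\<rbrakk> \<Longrightarrow> counit C (a \<triangleright>\<^bsub>C\<^esub> c) = a \<otimes>\<^bsub>A\<^esub> counit C c"
  "\<And>a c. \<lbrakk>a \<in> carrier A; c \<in> carrier C\<rbrakk> \<Longrightarrow> counit C (c \<triangleleft>\<^bsub>C\<^esub> a) = counit C c \<otimes>\<^bsub>A\<^esub> a"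
  using counit_bilinear
  by (auto simp: left_linear_def right_linear_def regular_bimod_def hom_def)

lemma counit_dual: "restrict (counit C) (carrier C) \<in> carrier D"
  by (rule dualI) (simp_all add: counit_props L.act_closed)

text \<open>The balancing identity is left linearity of \<open>f\<close>,
  \<open>(x a) f(y) = x (a f(y)) = x f(a y)\<close>; it makes the product of the dual ring
  independent of representatives.\<close>

lemma dual_prod_balanced:
  assumes f: "f \<in> carrier D" and g: "g \<in> carrier D"
  shows "balanced A C C A (\<lambda>x y. g (x \<triangleleft>\<^bsub>C\<^esub> f y))"
  by (rule balancedI)
     (simp_all add: dualD[OF f] dualD[OF g] R.act_closed R.act_add_left R.act_add_right R.act_mult)

text \<open>Needed beside balancedness once \<open>H\<close> acts on the arguments: the coproduct of
  \<open>Sinv h\<close> is evaluated in a tensor product over \<open>K\<close>.\<close>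

lemma dual_prod_bilin:
  assumes f: "f \<in> carrier D" and g: "g \<in> carrier D"
  shows "bilin K C C A (\<lambda>x y. g (x \<triangleleft>\<^bsub>C\<^esub> f y))"
  by (intro bilinI klin_dual_comp[OF f] klin_dual_comp[OF g] R.klin_act_left R.klin_act_right klin_id)
     (simp_all add: dualD[OF f] klin_dual f)

lemma dual_fields:
  "\<one>\<^bsub>D\<^esub> = restrict (counit C) (carrier C)"
  "\<zero>\<^bsub>D\<^esub> = (\<lambda>c \<in> carrier C. \<zero>\<^bsub>A\<^esub>)"
  "f \<oplus>\<^bsub>D\<^esub> g = (\<lambda>c \<in> carrier C. f c \<oplus>\<^bsub>A\<^esub> g c)"
  "r \<odot>\<^bsub>D\<^esub> f = (\<lambda>c \<in> carrier C. r \<odot>\<^bsub>A\<^esub> f c)"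
  "a \<triangleright>\<^bsub>D\<^esub> f = (\<lambda>c \<in> carrier C. f (c \<triangleleft>\<^bsub>C\<^esub> a))"
  "f \<triangleleft>\<^bsub>D\<^esub> a = (\<lambda>c \<in> carrier C. f c \<otimes>\<^bsub>A\<^esub> a)"
  by (simp_all add: left_dual_def)

lemma dual_prod:
  assumes f: "f \<in> carrier D" and g: "g \<in> carrier D"
  shows "f \<otimes>\<^bsub>D\<^esub> g = (\<lambda>c \<in> carrier C. cw A c (\<lambda>x y. g (x \<triangleleft>\<^bsub>C\<^esub> f y)))"
proof -
  have "f \<otimes>\<^bsub>D\<^esub> g = (\<lambda>c \<in> carrier C. tensor_eval A (\<lambda>x y. g (x \<triangleleft>\<^bsub>C\<^esub> f y)) (comult C c))"
    by (simp add: left_dual_def)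
  also have "\<dots> = (\<lambda>c \<in> carrier C. cw A c (\<lambda>x y. g (x \<triangleleft>\<^bsub>C\<^esub> f y)))"
    by (rule restrict_ext, rule tensor_eval_cw)
       (simp_all add: L.A.abelian_group_axioms dualD[OF f] dualD[OF g] R.act_closed)
  finally show ?thesis .
qed

lemma cw_counit_left:
  assumes "module K G" "klin K C G f" "c \<in> carrier C"
  shows "cw G c (\<lambda>x y. f (counit C x \<triangleright>\<^bsub>C\<^esub> y)) = f c"
proof -
  have "f c = f (cw C c (\<lambda>x y. counit C x \<triangleright>\<^bsub>C\<^esub> y))"
    using assms counit_left[of c]
    by (simp add: tensor_eval_cw L.M.abelian_group_axioms counit_props L.act_closed)
  also have "\<dots> = cw G c (\<lambda>x y. f (counit C x \<triangleright>\<^bsub>C\<^esub> y))"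
    using assms by (intro cw_compose) (simp_all add: L.M.module_axioms counit_props L.act_closed)
  finally show ?thesis ..
qed

lemma cw_counit_right:
  assumes "module K G" "klin K C G f" "c \<in> carrier C"
  shows "cw G c (\<lambda>x y. f (x \<triangleleft>\<^bsub>C\<^esub> counit C y)) = f c"
proof -
  have "f c = f (cw C c (\<lambda>x y. x \<triangleleft>\<^bsub>C\<^esub> counit C y))"
    using assms counit_right[of c]
    by (simp add: tensor_eval_cw L.M.abelian_group_axioms counit_props R.act_closed)
  also have "\<dots> = cw G c (\<lambda>x y. f (x \<triangleleft>\<^bsub>C\<^esub> counit C y))"
    using assms by (intro cw_compose) (simp_all add: L.M.module_axioms counit_props R.act_closed)
  finally show ?thesis ..
qed

lemma dual_add_closed: "\<lbrakk>f \<in> carrier D; g \<in> carrier D\<rbrakk> \<Longrightarrow> f \<oplus>\<^bsub>D\<^esub> g \<in> carrier D"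
  unfolding dual_fields
  by (rule dualI) (simp_all add: dualD L.act_closed L.A.A.r_distr L.A.M.add.m_ac)

lemma dual_smult_closed: "\<lbrakk>r \<in> carrier K; f \<in> carrier D\<rbrakk> \<Longrightarrow> r \<odot>\<^bsub>D\<^esub> f \<in> carrier D"
  unfolding dual_fields
  by (rule dualI) (simp_all add: dualD L.act_closed L.A.smult_r_distr L.A.smult_mult_right)

text \<open>For left linearity, the \<open>a\<close> of \<open>a c\<close> sits on the first leg,
  passes the right action by \<open>f c2\<close> and then leaves \<open>g\<close>.\<close>

lemma dual_prod_closed:
  assumes f: "f \<in> carrier D" and g: "g \<in> carrier D"
  shows "f \<otimes>\<^bsub>D\<^esub> g \<in> carrier D"
  unfolding dual_prod[OF assms]
proof (rule dualI)
  note bal = dual_prod_balanced[OF assms] and ab = L.A.abelian_group_axioms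
  show "(\<lambda>c \<in> carrier C. cw A c (\<lambda>x y. g (x \<triangleleft>\<^bsub>C\<^esub> f y))) (a \<triangleright>\<^bsub>C\<^esub> c)
      = a \<otimes>\<^bsub>A\<^esub> (\<lambda>c \<in> carrier C. cw A c (\<lambda>x y. g (x \<triangleleft>\<^bsub>C\<^esub> f y))) c"
    if "a \<in> carrier A" "c \<in> carrier C" for a c
  proof -
    have "a \<otimes>\<^bsub>A\<^esub> cw A c (\<lambda>x y. g (x \<triangleleft>\<^bsub>C\<^esub> f y)) = cw A c (\<lambda>x y. a \<otimes>\<^bsub>A\<^esub> g (x \<triangleleft>\<^bsub>C\<^esub> f y))"
      using that
      by (intro cw_compose[where f = "\<lambda>z. a \<otimes>\<^bsub>A\<^esub> z"])
         (simp_all add: L.A.module_axioms L.A.klin_prod_right klin_id dualD[OF f] dualD[OF g] R.act_closed)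
    then show ?thesis using that
      by (simp add: L.act_closed cw_lact[OF ab bal] lact_ract_assoc dualD[OF f] dualD[OF g] R.act_closed)
  qed
qed (simp_all add: L.A.abelian_group_axioms cw_closed cw_add[OF _ dual_prod_balanced[OF assms]])

text \<open>The common value is \<open>k(c1 g(c2 f(c3)))\<close>: on the left the inner sum is
  pulled out of \<open>k\<close>, on the right the coproduct of \<open>x f(y)\<close> carries
  \<open>f(y)\<close> on its second leg.\<close>

lemma dual_prod_assoc:
  assumes f: "f \<in> carrier D" and g: "g \<in> carrier D" and k: "k \<in> carrier D"
  shows "(f \<otimes>\<^bsub>D\<^esub> g) \<otimes>\<^bsub>D\<^esub> k = f \<otimes>\<^bsub>D\<^esub> (g \<otimes>\<^bsub>D\<^esub> k)"
proof (rule dual_eqI)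
  note [simp] = dualD[OF f] dualD[OF g] dualD[OF k] R.act_closed dual_prod_closed f g k
    L.A.abelian_group_axioms
  fix c assume c: "c \<in> carrier C"
  have "((f \<otimes>\<^bsub>D\<^esub> g) \<otimes>\<^bsub>D\<^esub> k) c
      = cw A c (\<lambda>x y. k (x \<triangleleft>\<^bsub>C\<^esub> cw A y (\<lambda>u v. g (u \<triangleleft>\<^bsub>C\<^esub> f v))))"
    using c unfolding dual_prod[OF dual_prod_closed[OF f g] k] by (simp add: dual_prod[OF f g])
  also have "\<dots> = cw A c (\<lambda>x y. cw A y (\<lambda>u v. k (x \<triangleleft>\<^bsub>C\<^esub> g (u \<triangleleft>\<^bsub>C\<^esub> f v))))"
    by (rule tcong, rule cw_compose[where f = "\<lambda>z. k (_ \<triangleleft>\<^bsub>C\<^esub> z)"])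
       (auto simp: L.A.module_axioms intro!: klin_dual_comp R.klin_act_right klin_id)
  also have "\<dots> = cw A c (\<lambda>x y. cw A x (\<lambda>u v. k (u \<triangleleft>\<^bsub>C\<^esub> g (v \<triangleleft>\<^bsub>C\<^esub> f y))))"
    using c
    by (intro CC.csum_coassoc[symmetric] balancedI)
       (simp_all add: R.act_add_left R.act_add_right R.act_mult lact_ract_assoc)
  also have "\<dots> = cw A c (\<lambda>x y. cw A (x \<triangleleft>\<^bsub>C\<^esub> f y) (\<lambda>u v. k (u \<triangleleft>\<^bsub>C\<^esub> g v)))"
    by (rule tcong, rule cw_ract[symmetric]) (simp_all add: dual_prod_balanced)
  also have "\<dots> = (f \<otimes>\<^bsub>D\<^esub> (g \<otimes>\<^bsub>D\<^esub> k)) c"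
    using c unfolding dual_prod[OF f dual_prod_closed[OF g k]] by (simp add: dual_prod[OF g k])
  finally show "((f \<otimes>\<^bsub>D\<^esub> g) \<otimes>\<^bsub>D\<^esub> k) c = (f \<otimes>\<^bsub>D\<^esub> (g \<otimes>\<^bsub>D\<^esub> k)) c" .
qed (simp_all add: dual_prod_closed assms)

lemma dual_zero_closed: "\<zero>\<^bsub>D\<^esub> \<in> carrier D"
  unfolding dual_fields by (rule dualI) (simp_all add: L.act_closed)

lemma dual_abelian_group: "abelian_group D"
proof (rule abelian_groupI)
  note [simp] = dual_add_closed dual_zero_closed
  fix f g k assume f: "f \<in> carrier D" and g: "g \<in> carrier D" and k: "k \<in> carrier D"
  note [simp] = dualD[OF f] dualD[OF g] dualD[OF k] f g k
  show "f \<oplus>\<^bsub>D\<^esub> g \<oplus>\<^bsub>D\<^esub> k = f \<oplus>\<^bsub>D\<^esub> (g \<oplus>\<^bsub>D\<^esub> k)"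
    by (rule dual_eqI) (simp_all, simp_all add: dual_fields L.A.M.a_assoc)
  show "f \<oplus>\<^bsub>D\<^esub> g = g \<oplus>\<^bsub>D\<^esub> f"
    by (rule dual_eqI) (simp_all, simp_all add: dual_fields L.A.M.a_comm)
next
  note [simp] = dual_add_closed dual_zero_closed
  fix f assume f: "f \<in> carrier D"
  note [simp] = dualD[OF f] f
  show "\<zero>\<^bsub>D\<^esub> \<oplus>\<^bsub>D\<^esub> f = f"
    by (rule dual_eqI) (simp_all, simp_all add: dual_fields)
  let ?g = "\<lambda>c \<in> carrier C. \<ominus>\<^bsub>A\<^esub> f c"
  have "?g \<in> carrier D"
    by (rule dualI) (simp_all add: L.act_closed L.A.M.minus_add L.A.A.r_minus)
  moreover have "?g \<oplus>\<^bsub>D\<^esub> f = \<zero>\<^bsub>D\<^esub>"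
    by (auto simp: dual_fields L.A.M.l_neg)
  ultimately show "\<exists>g \<in> carrier D. g \<oplus>\<^bsub>D\<^esub> f = \<zero>\<^bsub>D\<^esub>" by blast
qed (simp_all add: dual_add_closed dual_zero_closed)

lemma dual_module: "module K D"
proof (rule moduleI)
  note [simp] = dual_add_closed dual_smult_closed
  show "(r \<oplus>\<^bsub>K\<^esub> s) \<odot>\<^bsub>D\<^esub> f = r \<odot>\<^bsub>D\<^esub> f \<oplus>\<^bsub>D\<^esub> s \<odot>\<^bsub>D\<^esub> f"
    if "r \<in> carrier K" "s \<in> carrier K" "f \<in> carrier D" for r s f
    using that by (auto simp: dual_fields dualD L.A.smult_l_distr)
  show "r \<odot>\<^bsub>D\<^esub> (f \<oplus>\<^bsub>D\<^esub> g) = r \<odot>\<^bsub>D\<^esub> f \<oplus>\<^bsub>D\<^esub> r \<odot>\<^bsub>D\<^esub> g"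
    if "r \<in> carrier K" "g \<in> carrier D" "f \<in> carrier D" for r g f
    using that by (auto simp: dual_fields dualD L.A.smult_r_distr)
  show "(r \<otimes>\<^bsub>K\<^esub> s) \<odot>\<^bsub>D\<^esub> f = r \<odot>\<^bsub>D\<^esub> (s \<odot>\<^bsub>D\<^esub> f)"
    if "r \<in> carrier K" "s \<in> carrier K" "f \<in> carrier D" for r s f
    using that by (auto simp: dual_fields dualD L.A.smult_assoc1)
  show "\<one>\<^bsub>K\<^esub> \<odot>\<^bsub>D\<^esub> f = f" if "f \<in> carrier D" for f
    using that dual_smult_closed[OF L.A.R.one_closed that]
    by (intro dual_eqI) (simp_all add: dual_fields dualD)
qed (simp_all add: dual_abelian_group dual_smult_closed L.A.R.cring_axioms)

lemma klin_dual_eval: "c \<in> carrier C \<Longrightarrow> klin K D A (\<lambda>f. f c)"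
  by (rule klinI) (simp_all add: dual_fields dualD)

lemma dual_ring: "ring D"
proof (rule ringI)
  note [simp] = dual_add_closed dual_prod_closed R.act_closed L.A.abelian_group_axioms counit_dual
  show "monoid D"
  proof (rule monoidI)
    fix f assume f: "f \<in> carrier D"
    note [simp] = dualD[OF f] f
    \<comment> \<open>The left unit law needs the right counit law, because the product feeds the
      second leg to its first factor: \<open>f(c1 \<epsilon>(c2)) = f(c)\<close>.\<close>
    show "\<one>\<^bsub>D\<^esub> \<otimes>\<^bsub>D\<^esub> f = f"
    proof (rule dual_eqI)
      show "(\<one>\<^bsub>D\<^esub> \<otimes>\<^bsub>D\<^esub> f) c = f c" if "c \<in> carrier C" for c
        using that cw_counit_right[OF L.A.module_axioms klin_dual[OF f]]
        by (simp add: dual_fields dual_prod)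
    qed (simp_all add: dual_fields(1))
    \<comment> \<open>Linearity of both maps turns
      \<open>\<epsilon>(c1 f(c2)) = \<epsilon>(c1) f(c2)\<close> into
      \<open>f(\<epsilon>(c1) c2)\<close>, a case of the left counit law.\<close>
    show "f \<otimes>\<^bsub>D\<^esub> \<one>\<^bsub>D\<^esub> = f"
    proof (rule dual_eqI)
      show "(f \<otimes>\<^bsub>D\<^esub> \<one>\<^bsub>D\<^esub>) c = f c" if "c \<in> carrier C" for c
        using that cw_counit_left[OF L.A.module_axioms klin_dual[OF f]]
        by (simp add: dual_fields dual_prod counit_props)
    qed (simp_all add: dual_fields(1))
  qed (simp_all add: dual_fields(1) dual_prod_assoc)
  fix f g k assume f: "f \<in> carrier D" and g: "g \<in> carrier D" and k: "k \<in> carrier D"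
  note [simp] = dualD[OF f] dualD[OF g] dualD[OF k] f g k
  show "(f \<oplus>\<^bsub>D\<^esub> g) \<otimes>\<^bsub>D\<^esub> k = f \<otimes>\<^bsub>D\<^esub> k \<oplus>\<^bsub>D\<^esub> g \<otimes>\<^bsub>D\<^esub> k"
  proof (rule dual_eqI)
    fix c assume c: "c \<in> carrier C"
    have "((f \<oplus>\<^bsub>D\<^esub> g) \<otimes>\<^bsub>D\<^esub> k) c = cw A c (\<lambda>x y. k (x \<triangleleft>\<^bsub>C\<^esub> (f \<oplus>\<^bsub>D\<^esub> g) y))"
      using c by (simp add: dual_prod)
    also have "\<dots> = cw A c (\<lambda>x y. k (x \<triangleleft>\<^bsub>C\<^esub> f y) \<oplus>\<^bsub>A\<^esub> k (x \<triangleleft>\<^bsub>C\<^esub> g y))"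
      by (rule tcong) (simp add: dual_fields R.act_add_right)
    also have "\<dots> = (f \<otimes>\<^bsub>D\<^esub> k \<oplus>\<^bsub>D\<^esub> g \<otimes>\<^bsub>D\<^esub> k) c"
      using c by (simp add: dual_prod dual_fields CC.tsum_add_fun CC.comult_closed)
    finally show "((f \<oplus>\<^bsub>D\<^esub> g) \<otimes>\<^bsub>D\<^esub> k) c = (f \<otimes>\<^bsub>D\<^esub> k \<oplus>\<^bsub>D\<^esub> g \<otimes>\<^bsub>D\<^esub> k) c" .
  qed simp_all
  show "k \<otimes>\<^bsub>D\<^esub> (f \<oplus>\<^bsub>D\<^esub> g) = k \<otimes>\<^bsub>D\<^esub> f \<oplus>\<^bsub>D\<^esub> k \<otimes>\<^bsub>D\<^esub> g"
  proof (rule dual_eqI)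
    fix c assume c: "c \<in> carrier C"
    have "(k \<otimes>\<^bsub>D\<^esub> (f \<oplus>\<^bsub>D\<^esub> g)) c = cw A c (\<lambda>x y. (f \<oplus>\<^bsub>D\<^esub> g) (x \<triangleleft>\<^bsub>C\<^esub> k y))"
      using c by (simp add: dual_prod)
    also have "\<dots> = cw A c (\<lambda>x y. f (x \<triangleleft>\<^bsub>C\<^esub> k y) \<oplus>\<^bsub>A\<^esub> g (x \<triangleleft>\<^bsub>C\<^esub> k y))"
      by (rule tcong) (simp add: dual_fields)
    also have "\<dots> = (k \<otimes>\<^bsub>D\<^esub> f \<oplus>\<^bsub>D\<^esub> k \<otimes>\<^bsub>D\<^esub> g) c"
      using c by (simp add: dual_prod dual_fields CC.tsum_add_fun CC.comult_closed)
    finally show "(k \<otimes>\<^bsub>D\<^esub> (f \<oplus>\<^bsub>D\<^esub> g)) c = (k \<otimes>\<^bsub>D\<^esub> f \<oplus>\<^bsub>D\<^esub> k \<otimes>\<^bsub>D\<^esub> g) c" .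
  qed simp_all
qed (simp_all add: dual_abelian_group)

lemma dual_k_algebra: "k_algebra K D"
proof (intro k_algebra.intro k_algebra_axioms.intro dual_module dual_ring)
  note [simp] = dual_smult_closed dual_prod_closed R.act_closed
  fix r f g assume r: "r \<in> carrier K" and f: "f \<in> carrier D" and g: "g \<in> carrier D"
  note [simp] = dualD[OF f] dualD[OF g] r f g
  have pull: "r \<odot>\<^bsub>A\<^esub> cw A c (\<lambda>x y. g (x \<triangleleft>\<^bsub>C\<^esub> f y)) = cw A c (\<lambda>x y. r \<odot>\<^bsub>A\<^esub> g (x \<triangleleft>\<^bsub>C\<^esub> f y))"
    if "c \<in> carrier C" for c
    using that by (intro cw_compose) (simp_all add: L.A.module_axioms klin_smult klin_id)
  show "(r \<odot>\<^bsub>D\<^esub> f) \<otimes>\<^bsub>D\<^esub> g = r \<odot>\<^bsub>D\<^esub> (f \<otimes>\<^bsub>D\<^esub> g)"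
  proof (rule dual_eqI)
    fix c assume c: "c \<in> carrier C"
    have "((r \<odot>\<^bsub>D\<^esub> f) \<otimes>\<^bsub>D\<^esub> g) c = cw A c (\<lambda>x y. g (x \<triangleleft>\<^bsub>C\<^esub> (r \<odot>\<^bsub>D\<^esub> f) y))"
      using c by (simp add: dual_prod)
    also have "\<dots> = cw A c (\<lambda>x y. r \<odot>\<^bsub>A\<^esub> g (x \<triangleleft>\<^bsub>C\<^esub> f y))"
      by (rule tcong) (simp add: dual_fields R.act_smult_right dual_smult)
    finally show "((r \<odot>\<^bsub>D\<^esub> f) \<otimes>\<^bsub>D\<^esub> g) c = (r \<odot>\<^bsub>D\<^esub> (f \<otimes>\<^bsub>D\<^esub> g)) c"
      using c by (simp add: dual_fields dual_prod pull)
  qed simp_all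
  show "f \<otimes>\<^bsub>D\<^esub> (r \<odot>\<^bsub>D\<^esub> g) = r \<odot>\<^bsub>D\<^esub> (f \<otimes>\<^bsub>D\<^esub> g)"
  proof (rule dual_eqI)
    fix c assume c: "c \<in> carrier C"
    have "(f \<otimes>\<^bsub>D\<^esub> (r \<odot>\<^bsub>D\<^esub> g)) c = cw A c (\<lambda>x y. (r \<odot>\<^bsub>D\<^esub> g) (x \<triangleleft>\<^bsub>C\<^esub> f y))"
      using c by (simp add: dual_prod)
    also have "\<dots> = cw A c (\<lambda>x y. r \<odot>\<^bsub>A\<^esub> g (x \<triangleleft>\<^bsub>C\<^esub> f y))"
      by (rule tcong) (simp add: dual_fields)
    finally show "(f \<otimes>\<^bsub>D\<^esub> (r \<odot>\<^bsub>D\<^esub> g)) c = (r \<odot>\<^bsub>D\<^esub> (f \<otimes>\<^bsub>D\<^esub> g)) c"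
      using c by (simp add: dual_fields dual_prod pull)
  qed simp_all
qed

section \<open>The embedding of \<open>A\<close> and the bimodule structure\<close>

lemma dual_emb_closed: "a \<in> carrier A \<Longrightarrow> dual_emb A C a \<in> carrier D"
  unfolding dual_emb_def
  by (rule dualI) (simp_all add: counit_props L.act_closed L.A.A.l_distr L.A.A.m_assoc)

text \<open>The right counit law for the linear map \<open>c \<mapsto> f(c a)\<close>.\<close>

lemma dual_emb_left:
  assumes a: "a \<in> carrier A" and f: "f \<in> carrier D"
  shows "a \<triangleright>\<^bsub>D\<^esub> f = dual_emb A C a \<otimes>\<^bsub>D\<^esub> f"
proof -
  note [simp] = dualD[OF f] R.act_closed counit_props a f
  have "cw A c (\<lambda>x y. f (x \<triangleleft>\<^bsub>C\<^esub> dual_emb A C a y)) = f (c \<triangleleft>\<^bsub>C\<^esub> a)" if "c \<in> carrier C" for c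
    using that cw_counit_right[OF L.A.module_axioms klin_dual_comp[OF f R.klin_act_left[OF a klin_id]]]
    by (simp add: dual_emb_def R.act_mult)
  then show ?thesis
    by (simp add: dual_prod dual_emb_closed dual_fields cong: restrict_cong)
qed

text \<open>Right linearity of the counit gives \<open>\<epsilon>(c1) f(c2) a\<close>, which is the
  linear map \<open>c \<mapsto> f(c) a\<close> taken at \<open>\<epsilon>(c1) c2\<close>.\<close>

lemma dual_emb_right:
  assumes a: "a \<in> carrier A" and f: "f \<in> carrier D"
  shows "f \<triangleleft>\<^bsub>D\<^esub> a = f \<otimes>\<^bsub>D\<^esub> dual_emb A C a"
proof -
  note [simp] = dualD[OF f] R.act_closed counit_props a f
  have "cw A c (\<lambda>x y. dual_emb A C a (x \<triangleleft>\<^bsub>C\<^esub> f y)) = f c \<otimes>\<^bsub>A\<^esub> a" if "c \<in> carrier C" for c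
    using that cw_counit_left[OF L.A.module_axioms L.A.klin_prod_left[OF klin_dual[OF f] a]]
    by (simp add: dual_emb_def)
  then show ?thesis
    by (simp add: dual_prod dual_emb_closed dual_fields cong: restrict_cong)
qed

lemma dual_emb_hom: "dual_emb A C \<in> ring_hom A D"
proof (rule ring_hom_memI)
  fix a b assume ab: "a \<in> carrier A" "b \<in> carrier A"
  \<comment> \<open>Seen as a right action this is a pointwise identity;
    \<open>dual_emb_right\<close> then turns the action into a product in \<open>D\<close>.\<close>
  then have "dual_emb A C (a \<otimes>\<^bsub>A\<^esub> b) = dual_emb A C a \<triangleleft>\<^bsub>D\<^esub> b"
    by (auto simp: dual_emb_def dual_fields counit_props L.A.A.m_assoc)
  then show "dual_emb A C (a \<otimes>\<^bsub>A\<^esub> b) = dual_emb A C a \<otimes>\<^bsub>D\<^esub> dual_emb A C b"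
    using ab by (simp add: dual_emb_right dual_emb_closed)
  show "dual_emb A C (a \<oplus>\<^bsub>A\<^esub> b) = dual_emb A C a \<oplus>\<^bsub>D\<^esub> dual_emb A C b"
    using ab by (auto simp: dual_emb_def dual_fields counit_props L.A.A.r_distr)
next
  show "dual_emb A C \<one>\<^bsub>A\<^esub> = \<one>\<^bsub>D\<^esub>"
    by (auto simp: dual_emb_def dual_fields counit_props)
qed (rule dual_emb_closed)

lemma dual_emb_smult:
  "\<lbrakk>r \<in> carrier K; a \<in> carrier A\<rbrakk> \<Longrightarrow> dual_emb A C (r \<odot>\<^bsub>A\<^esub> a) = r \<odot>\<^bsub>D\<^esub> dual_emb A C a"
  by (auto simp: dual_emb_def dual_fields counit_props L.A.smult_mult_right)

text \<open>Both actions are multiplications by images under a ring homomorphism compatible with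
  scalars, so each axiom becomes an algebra law in \<open>D\<close>.\<close>

lemma dual_bimodule: "bimodule K A D"
proof -
  interpret D: k_algebra K D by (rule dual_k_algebra)
  note hom = ring_hom_mult[OF dual_emb_hom] ring_hom_add[OF dual_emb_hom]
    ring_hom_one[OF dual_emb_hom]
  show ?thesis
    by (intro bimodule.intro left_module.intro right_module.intro bimodule_axioms.intro
        left_module_axioms.intro right_module_axioms.intro L.A.k_algebra_axioms dual_module)
       (simp_all add: dual_emb_left dual_emb_right dual_emb_closed hom dual_emb_smult
         D.A.l_distr D.A.r_distr D.A.m_assoc D.smult_mult_left D.smult_mult_right)
qed

end

locale bij_HA_coring = bij_hopf_algebra K H + HA_coring K H A actA C actC
  for K :: "('k, 'x) ring_scheme" and H :: "('k, 'h, 'y) hopf_scheme"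
    and A :: "('k, 'a, 'z) module_scheme" and actA :: "'h \<Rightarrow> 'a \<Rightarrow> 'a"
    and C :: "('k, 'a, 'c, 'w) coring_scheme" and actC :: "'h \<Rightarrow> 'c \<Rightarrow> 'c"
begin
end


text \<open>In legs the left side is \<open>Q(h1, Sinv(h3) h2, h4, h5)\<close>, bracketed as it
  arises when \<open>p\<close> acts on the first factor of a product and \<open>q\<close> on the
  second. Interchanges and coassociativity bring \<open>v\<close> and \<open>s\<close> together,
  with \<open>u\<close> as a parameter.\<close>

lemma (in bij_hopf_algebra) sw_cancel_middle:
  assumes G: "module K G" and h: "h \<in> carrier H"
    and Q: "\<And>z t y. \<lbrakk>z \<in> carrier H; t \<in> carrier H; y \<in> carrier H\<rbrakk> \<Longrightarrow> klin K H G (\<lambda>u. Q u z t y)"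
      "\<And>u t y. \<lbrakk>u \<in> carrier H; t \<in> carrier H; y \<in> carrier H\<rbrakk> \<Longrightarrow> klin K H G (\<lambda>z. Q u z t y)"
      "\<And>u z y. \<lbrakk>u \<in> carrier H; z \<in> carrier H; y \<in> carrier H\<rbrakk> \<Longrightarrow> klin K H G (\<lambda>t. Q u z t y)"
      "\<And>u z t. \<lbrakk>u \<in> carrier H; z \<in> carrier H; t \<in> carrier H\<rbrakk> \<Longrightarrow> klin K H G (\<lambda>y. Q u z t y)"
  shows "sw G h (\<lambda>p q. sw G q (\<lambda>x y. sw G x (\<lambda>s t. sw G p (\<lambda>u v. Q u (Sinv s \<otimes>\<^bsub>H\<^esub> v) t y))))
    = sw G h (\<lambda>x y. sw G x (\<lambda>u t. Q u \<one>\<^bsub>H\<^esub> t y))"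
proof -
  \<comment> \<open>The second slot receives the product \<open>Sinv s v\<close>, so linearity in
    \<open>s\<close> and in \<open>v\<close> both go through \<open>Q\<close> composed with a linear
    map.\<close>
  have Q2: "klin K H G (\<lambda>x. Q u (f x) t y)"
    if "u \<in> carrier H" "t \<in> carrier H" "y \<in> carrier H" "klin K H H f"
    for u t y f
    using klin_comp[OF Q(2)] that by blast
  note rules = klin_intros' Q(1,3,4) Q2
  note [simp] = G h sw_closed klinD(1)[OF Q(1)]
  have "sw G h (\<lambda>p q. sw G q (\<lambda>x y. sw G x (\<lambda>s t. sw G p (\<lambda>u v. Q u (Sinv s \<otimes>\<^bsub>H\<^esub> v) t y))))
      = sw G h (\<lambda>p q. sw G q (\<lambda>x y. sw G p (\<lambda>u v. sw G x (\<lambda>s t. Q u (Sinv s \<otimes>\<^bsub>H\<^esub> v) t y))))"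
    by (rule tcong, rule tcong, rule sw_swap) simp_all
  also have "\<dots> = sw G h (\<lambda>p q. sw G p (\<lambda>u v. sw G q (\<lambda>x y. sw G x (\<lambda>s t. Q u (Sinv s \<otimes>\<^bsub>H\<^esub> v) t y))))"
    by (rule tcong, rule sw_swap) simp_all
  also have "\<dots> = sw G h (\<lambda>p q. sw G p (\<lambda>u v. sw G q (\<lambda>s r. sw G r (\<lambda>t y. Q u (Sinv s \<otimes>\<^bsub>H\<^esub> v) t y))))"
    by (rule tcong, rule tcong, rule sw_coassoc) (auto intro!: rules)
  also have "\<dots> = sw G h (\<lambda>u w. sw G w (\<lambda>v q. sw G q (\<lambda>s r. sw G r (\<lambda>t y. Q u (Sinv s \<otimes>\<^bsub>H\<^esub> v) t y))))"
    by (rule sw_coassoc) (auto intro!: rules)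
  also have "\<dots> = sw G h (\<lambda>u w. sw G w (\<lambda>t y. Q u \<one>\<^bsub>H\<^esub> t y))"
    by (rule tcong, rule sw_cancel_left(2)[where F = "\<lambda>z r. sw G r (\<lambda>t y. Q _ z t y)"])
       (auto intro!: rules)
  also have "\<dots> = sw G h (\<lambda>x y. sw G x (\<lambda>u t. Q u \<one>\<^bsub>H\<^esub> t y))"
    by (rule sw_coassoc[symmetric]) (auto intro!: rules)
  finally show ?thesis .
qed


section \<open>The Hopf action on the left dual ring\<close>

context bij_HA_coring
begin

abbreviation "dact \<equiv> dual_act H A actA C actC"

lemmas action_closed = A.act_closed H_mod.act_closed L.act_closed R.act_closed counit_props(1)

lemmas action_rules = klin_intros' A.klin_act_left A.klin_act_right H_mod.klin_act_left
  H_mod.klin_act_right L.klin_act_left L.klin_act_right R.klin_act_left R.klin_act_right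
  L.A.klin_prod_left L.A.klin_prod_right

lemma actA_prod:
  assumes "h \<in> carrier H" "a \<in> carrier A" "b \<in> carrier A"
  shows "actA h (a \<otimes>\<^bsub>A\<^esub> b) = sw A h (\<lambda>x y. actA x a \<otimes>\<^bsub>A\<^esub> actA y b)"
  using assms A.act_prod[of h a b]
  by (simp add: tensor_eval_sw L.A.module_axioms action_closed)

text \<open>\<open>Sinv h\<close> acts through its own coproduct, which \<open>sw_Sinv\<close>
  expresses by that of \<open>h\<close>. The linear map \<open>\<phi>\<close> is the context in
  which the identity will be applied.\<close>

lemma klin_Sinv_lact:
  assumes G: "module K G" and \<phi>: "klin K C G \<phi>" and h: "h \<in> carrier H"
    and a: "a \<in> carrier A" and c: "c \<in> carrier C"
  shows "\<phi> (actC (Sinv h) (a \<triangleright>\<^bsub>C\<^esub> c)) = sw G h (\<lambda>x y. \<phi> (actA (Sinv y) a \<triangleright>\<^bsub>C\<^esub> actC (Sinv x) c))"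
proof -
  note [simp] = assms action_closed L.M.module_axioms
  have "\<phi> (actC (Sinv h) (a \<triangleright>\<^bsub>C\<^esub> c)) = \<phi> (sw C (Sinv h) (\<lambda>x y. actA x a \<triangleright>\<^bsub>C\<^esub> actC y c))"
    using act_lact[of "Sinv h" a c] by (simp add: tensor_eval_sw)
  also have "\<dots> = sw G (Sinv h) (\<lambda>x y. \<phi> (actA x a \<triangleright>\<^bsub>C\<^esub> actC y c))"
    by (rule sw_compose) simp_all
  also have "\<dots> = sw G h (\<lambda>x y. \<phi> (actA (Sinv y) a \<triangleright>\<^bsub>C\<^esub> actC (Sinv x) c))"
    by (rule sw_Sinv) (auto intro!: action_rules klin_comp[OF \<phi>])
  finally show ?thesis .
qed

lemma klin_Sinv_ract:
  assumes G: "module K G" and \<phi>: "klin K C G \<phi>" and h: "h \<in> carrier H"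
    and a: "a \<in> carrier A" and c: "c \<in> carrier C"
  shows "\<phi> (actC (Sinv h) (c \<triangleleft>\<^bsub>C\<^esub> a)) = sw G h (\<lambda>x y. \<phi> (actC (Sinv y) c \<triangleleft>\<^bsub>C\<^esub> actA (Sinv x) a))"
proof -
  note [simp] = assms action_closed L.M.module_axioms
  have "\<phi> (actC (Sinv h) (c \<triangleleft>\<^bsub>C\<^esub> a)) = \<phi> (sw C (Sinv h) (\<lambda>x y. actC x c \<triangleleft>\<^bsub>C\<^esub> actA y a))"
    using act_ract[of "Sinv h" c a] by (simp add: tensor_eval_sw)
  also have "\<dots> = sw G (Sinv h) (\<lambda>x y. \<phi> (actC x c \<triangleleft>\<^bsub>C\<^esub> actA y a))"
    by (rule sw_compose) simp_all
  also have "\<dots> = sw G h (\<lambda>x y. \<phi> (actC (Sinv y) c \<triangleleft>\<^bsub>C\<^esub> actA (Sinv x) a))"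
    by (rule sw_Sinv) (auto intro!: action_rules klin_comp[OF \<phi>])
  finally show ?thesis .
qed

lemma cw_sw_swap:
  assumes "module K G" "c \<in> carrier C" "h \<in> carrier H"
    and "\<And>m n x y. \<lbrakk>m \<in> carrier C; n \<in> carrier C; x \<in> carrier H; y \<in> carrier H\<rbrakk> \<Longrightarrow> f m n x y \<in> carrier G"
  shows "cw G c (\<lambda>m n. sw G h (f m n)) = sw G h (\<lambda>x y. cw G c (\<lambda>m n. f m n x y))"
proof -
  interpret G: module K G by fact
  show ?thesis
    using tsum_swap[OF CC.tensor_pair_axioms HH.tensor_pair_axioms, of "comult C c" "hcomult H h" G f]
      assms by (simp add: G.abelian_group_axioms CC.comult_closed)
qed

text \<open>For fixed \<open>x\<close>, \<open>y\<close> the integrand in \<open>m\<close>,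
  \<open>n\<close> need not be balanced. Linearity of the coproduct is therefore used in the order
  of \<open>tensor_act\<close>, with the sum over \<open>C\<close> outside, and the sums are
  interchanged at the end, on fixed representatives.\<close>

lemma cw_act:
  assumes "module K G" "balanced A C C G b" "h \<in> carrier H" "c \<in> carrier C"
  shows "cw G (actC h c) b = sw G h (\<lambda>x y. cw G c (\<lambda>m n. b (actC x m) (actC y n)))"
proof -
  interpret G: module K G by fact
  interpret T: abelian_group "tensor A C C" by (rule CC.tensor_abelian_group)
  note bal = assms(2) and ab = G.abelian_group_axioms
  note [simp] = balancedD(1)[OF bal] assms action_closed ab CC.comult_closed
  let ?in = "\<lambda>m n. tensor_eval CC.T (\<lambda>x y. pure_tensor A C C (actC x m) (actC y n)) (hcomult H h)"
  have cl: "?in m n \<in> carrier CC.T" if "m \<in> carrier C" "n \<in> carrier C" for m n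
    using that by (intro HH.tensor_eval_closed T.abelian_group_axioms CC.pure_tensor_closed) simp_all
  have "cw G (actC h c) b = tensor_eval G b (tensor_eval CC.T ?in (comult C c))"
    using comult_H_linear[of h c] by (subst tensor_eval_cw[symmetric]) (simp_all add: tensor_act_def)
  also have "\<dots> = tensor_eval G (\<lambda>m n. tensor_eval G b (?in m n)) (comult C c)"
    using cl by (intro CC.tensor_eval_compose CC.tensor_eval_hom bal T.abelian_group_axioms) simp_all
  also have "\<dots> = cw G c (\<lambda>m n. tensor_eval G b (?in m n))"
    using cl by (intro CC.tsum_eq) (auto intro!: CC.tensor_eval_closed)
  also have "\<dots> = cw G c (\<lambda>m n. sw G h (\<lambda>x y. b (actC x m) (actC y n)))"
  proof (rule tcong)
    fix m n assume "m \<in> carrier C" "n \<in> carrier C"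
    then show "tensor_eval G b (?in m n) = sw G h (\<lambda>x y. b (actC x m) (actC y n))"
      using CC.tsum_tensor_eval_pure[OF ab bal HH.tensor_pair_axioms, of "hcomult H h"
          "\<lambda>x y. actC x m" "\<lambda>x y. actC y n"] CC.tsum_eq[OF cl ab, of m n b]
      by simp
  qed
  also have "\<dots> = sw G h (\<lambda>x y. cw G c (\<lambda>m n. b (actC x m) (actC y n)))"
    by (rule cw_sw_swap) simp_all
  finally show ?thesis .
qed

text \<open>Balancedness lets \<open>cw_act\<close> evaluate the coproduct of
  \<open>Sinv(h) c\<close>; bilinearity makes the outcome bilinear in the legs of
  \<open>Sinv h\<close>, as \<open>sw_Sinv\<close> demands.\<close>

lemma cw_Sinv_act:
  assumes "module K G" "balanced A C C G b" "bilin K C C G b" "h \<in> carrier H" "c \<in> carrier C"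
  shows "cw G (actC (Sinv h) c) b
    = sw G h (\<lambda>x y. cw G c (\<lambda>m n. b (actC (Sinv y) m) (actC (Sinv x) n)))"
  by (subst cw_act, simp_all add: assms, rule sw_Sinv)
     (auto intro!: bilinI klin_tsum[OF CC.tensor_pair_axioms] bilin_left[OF assms(3)]
       bilin_right[OF assms(3)] H_mod.klin_act_left klin_id
       simp: assms CC.comult_closed action_closed)

section \<open>The action of \<open>H\<close> on functionals\<close>

lemma dual_act_eq:
  assumes "h \<in> carrier H" "f \<in> carrier D"
  shows "dact h f = (\<lambda>c \<in> carrier C. sw A h (\<lambda>x y. actA y (f (actC (Sinv x) c))))"
  unfolding dual_act_def
  by (rule restrict_ext, rule tensor_eval_sw)
     (simp_all add: assms L.A.module_axioms action_closed dualD[OF assms(2)])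

text \<open>Left linearity shows why the legs are placed as in the definition: the factor
  \<open>a\<close> picks up the adjacent pair \<open>h3 Sinv(h2)\<close>, since \<open>h3 .
  f((Sinv(h2) a) (Sinv(h1) c)) = (h3 Sinv(h2) a) (h4 . f(Sinv(h1) c))\<close>.\<close>

lemma dual_act_closed:
  assumes h: "h \<in> carrier H" and f: "f \<in> carrier D"
  shows "dact h f \<in> carrier D"
proof (rule dualI)
  note [simp] = action_closed L.A.module_axioms dualD[OF f] h f dual_act_eq sw_closed
  note rules = action_rules klin_dual_comp[OF f]
  show "dact h f \<in> extensional (carrier C)" "\<And>c. c \<in> carrier C \<Longrightarrow> dact h f c \<in> carrier A" by simp_all
  have lin: "klin K C A (\<lambda>c. sw A h (\<lambda>x y. actA y (f (actC (Sinv x) c))))"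
    by (auto intro!: rules)
  show "dact h f (c \<oplus>\<^bsub>C\<^esub> c') = dact h f c \<oplus>\<^bsub>A\<^esub> dact h f c'"
    if "c \<in> carrier C" "c' \<in> carrier C" for c c'
    using that klinD(2)[OF lin] by simp
  fix a c assume [simp]: "a \<in> carrier A" "c \<in> carrier C"
  have "dact h f (a \<triangleright>\<^bsub>C\<^esub> c) = sw A h (\<lambda>x y. actA y (f (actC (Sinv x) (a \<triangleright>\<^bsub>C\<^esub> c))))" by simp
  also have "\<dots> = sw A h (\<lambda>x y. sw A x (\<lambda>u v. actA y (f (actA (Sinv v) a \<triangleright>\<^bsub>C\<^esub> actC (Sinv u) c))))"
    by (rule tcong, rule klin_Sinv_lact[where \<phi> = "\<lambda>z. actA _ (f z)"]) (auto intro!: rules)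
  also have "\<dots> = sw A h (\<lambda>x y. sw A x (\<lambda>u v. sw A y (\<lambda>s t.
      actA (s \<otimes>\<^bsub>H\<^esub> Sinv v) a \<otimes>\<^bsub>A\<^esub> actA t (f (actC (Sinv u) c)))))"
    by (rule tcong, rule tcong) (simp add: actA_prod A.act_mult)
  also have "\<dots> = sw A h (\<lambda>u w. sw A w (\<lambda>v y. sw A y (\<lambda>s t.
      actA (s \<otimes>\<^bsub>H\<^esub> Sinv v) a \<otimes>\<^bsub>A\<^esub> actA t (f (actC (Sinv u) c)))))"
    by (rule sw_coassoc) (auto intro!: rules)
  also have "\<dots> = sw A h (\<lambda>u w. actA \<one>\<^bsub>H\<^esub> a \<otimes>\<^bsub>A\<^esub> actA w (f (actC (Sinv u) c)))"
    by (rule tcong, rule sw_cancel_left(1)[where F = "\<lambda>z t. actA z a \<otimes>\<^bsub>A\<^esub> actA t (f (actC (Sinv _) c))"])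
       (auto intro!: rules)
  also have "\<dots> = a \<otimes>\<^bsub>A\<^esub> sw A h (\<lambda>x y. actA y (f (actC (Sinv x) c)))"
    by (subst sw_compose[where f = "\<lambda>z. a \<otimes>\<^bsub>A\<^esub> z" and G' = A])
       (auto intro!: rules simp: A.act_one)
  finally show "dact h f (a \<triangleright>\<^bsub>C\<^esub> c) = a \<otimes>\<^bsub>A\<^esub> dact h f c" by simp
qed

text \<open>\<open>Sinv\<close> reverses products and so does precomposition; the two reversals
  cancel.\<close>

lemma dual_act_mult:
  assumes g: "g \<in> carrier H" and h: "h \<in> carrier H" and f: "f \<in> carrier D"
  shows "dact (g \<otimes>\<^bsub>H\<^esub> h) f = dact g (dact h f)"
proof (rule dual_eqI)
  note [simp] = action_closed L.A.module_axioms dualD[OF f] g h f sw_closed dual_act_closed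
  note rules = action_rules klin_dual_comp[OF f]
  fix c assume [simp]: "c \<in> carrier C"
  have "dact (g \<otimes>\<^bsub>H\<^esub> h) f c = sw A (g \<otimes>\<^bsub>H\<^esub> h) (\<lambda>x y. actA y (f (actC (Sinv x) c)))"
    by (simp add: dual_act_eq)
  also have "\<dots> = sw A g (\<lambda>x y. sw A h (\<lambda>u v. actA (y \<otimes>\<^bsub>H\<^esub> v) (f (actC (Sinv (x \<otimes>\<^bsub>H\<^esub> u)) c))))"
    by (rule sw_mult) (auto intro!: rules)
  also have "\<dots> = sw A g (\<lambda>x y. sw A h (\<lambda>u v. actA y (actA v (f (actC (Sinv u) (actC (Sinv x) c))))))"
    by (simp add: Sinv_mult A.act_mult H_mod.act_mult)
  also have "\<dots> = sw A g (\<lambda>x y. actA y (sw A h (\<lambda>u v. actA v (f (actC (Sinv u) (actC (Sinv x) c))))))"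
    by (rule tcong, rule sw_compose[symmetric]) (auto intro!: rules)
  also have "\<dots> = dact g (dact h f) c"
    by (simp add: dual_act_eq[OF g dual_act_closed[OF h f]]) (simp add: dual_act_eq)
  finally show "dact (g \<otimes>\<^bsub>H\<^esub> h) f c = dact g (dact h f) c" .
qed (simp_all add: dual_act_closed assms)

lemma dual_act_left_module: "left_module K H D dact"
proof (intro left_module.intro left_module_axioms.intro dual_module dual_act_mult dual_act_closed)
  note [simp] = action_closed L.A.module_axioms sw_closed dual_act_closed dual_add_closed
    dual_smult_closed
  show "k_algebra K H" by unfold_locales
  fix f assume f: "f \<in> carrier D"
  note [simp] = dualD[OF f] f
  note rules = action_rules klin_dual_comp[OF f]
  have lin: "klin K H A (\<lambda>h. sw A h (\<lambda>x y. actA y (f (actC (Sinv x) c))))" if "c \<in> carrier C" for c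
    using that by (auto intro!: rules)
  show "dact (g \<oplus>\<^bsub>H\<^esub> h) f = dact g f \<oplus>\<^bsub>D\<^esub> dact h f" if "g \<in> carrier H" "h \<in> carrier H" for g h
    using that by (auto simp: dual_act_eq dual_fields klinD(2)[OF lin])
  show "dact (r \<odot>\<^bsub>H\<^esub> h) f = r \<odot>\<^bsub>D\<^esub> dact h f" if "r \<in> carrier K" "h \<in> carrier H" for r h
    using that by (auto simp: dual_act_eq dual_fields klinD(3)[OF lin])
  show "dact h (r \<odot>\<^bsub>D\<^esub> f) = r \<odot>\<^bsub>D\<^esub> dact h f" if "r \<in> carrier K" "h \<in> carrier H" for r h
  proof (rule dual_eqI)
    fix c assume c: "c \<in> carrier C"
    have "dact h (r \<odot>\<^bsub>D\<^esub> f) c = sw A h (\<lambda>x y. r \<odot>\<^bsub>A\<^esub> actA y (f (actC (Sinv x) c)))"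
      using that c by (simp add: dual_act_eq) (simp add: dual_fields A.act_smult_right)
    also have "\<dots> = (r \<odot>\<^bsub>D\<^esub> dact h f) c"
      using that c
      by (subst sw_compose[where f = "\<lambda>z. r \<odot>\<^bsub>A\<^esub> z" and G' = A, symmetric])
         (auto intro!: klin_smult klin_id simp: dual_act_eq dual_fields)
    finally show "dact h (r \<odot>\<^bsub>D\<^esub> f) c = (r \<odot>\<^bsub>D\<^esub> dact h f) c" .
  qed (use that in simp_all)
  show "dact \<one>\<^bsub>H\<^esub> f = f"
  proof (rule dual_eqI)
    show "dact \<one>\<^bsub>H\<^esub> f c = f c" if "c \<in> carrier C" for c
      using that by (simp add: dual_act_eq)
        (subst sw_one, auto intro!: rules simp: Sinv_one A.act_one H_mod.act_one)
  qed simp_all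
  show "dact h (f \<oplus>\<^bsub>D\<^esub> g) = dact h f \<oplus>\<^bsub>D\<^esub> dact h g" if g: "g \<in> carrier D" and h: "h \<in> carrier H" for h g
  proof (rule dual_eqI)
    note [simp] = dualD[OF g] g h
    fix c assume c: "c \<in> carrier C"
    have "dact h (f \<oplus>\<^bsub>D\<^esub> g) c = sw A h (\<lambda>x y. actA y (f (actC (Sinv x) c)) \<oplus>\<^bsub>A\<^esub> actA y (g (actC (Sinv x) c)))"
      using c by (simp add: dual_act_eq) (simp add: dual_fields A.act_add_right)
    also have "\<dots> = (dact h f \<oplus>\<^bsub>D\<^esub> dact h g) c"
      using c HH.tsum_add_fun[of "hcomult H h" A "\<lambda>x y. actA y (f (actC (Sinv x) c))"
          "\<lambda>x y. actA y (g (actC (Sinv x) c))"]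
      by (simp add: dual_act_eq dual_fields L.A.abelian_group_axioms)
    finally show "dact h (f \<oplus>\<^bsub>D\<^esub> g) c = (dact h f \<oplus>\<^bsub>D\<^esub> dact h g) c" .
  qed (use g h in simp_all)
qed

text \<open>Both sides are brought to sums over \<open>c\<close> outside and over legs of
  \<open>h\<close> inside, with the common integrand \<open>?Q\<close>, in which \<open>z\<close>
  acts on the value of \<open>f\<close>. On the left \<open>z\<close> is the unit, on the right it
  is \<open>Sinv s v\<close>.\<close>

lemma dual_act_prod:
  assumes h: "h \<in> carrier H" and f: "f \<in> carrier D" and g: "g \<in> carrier D"
  shows "dact h (f \<otimes>\<^bsub>D\<^esub> g) = sw D h (\<lambda>p q. dact p f \<otimes>\<^bsub>D\<^esub> dact q g)"
proof (rule dual_eqI)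
  note [simp] = action_closed L.A.module_axioms L.A.abelian_group_axioms dualD[OF f] dualD[OF g]
    h f g sw_closed dual_act_closed dual_prod_closed cw_closed
  note rules = action_rules klin_dual_comp[OF f] klin_dual_comp[OF g]
  fix c assume [simp]: "c \<in> carrier C"
  let ?Q = "\<lambda>m n u z t y. actA y (g (actC (Sinv t) m \<triangleleft>\<^bsub>C\<^esub> actA z (f (actC (Sinv u) n))))"
  have "dact h (f \<otimes>\<^bsub>D\<^esub> g) c = sw A h (\<lambda>x y. actA y (cw A (actC (Sinv x) c) (\<lambda>m n. g (m \<triangleleft>\<^bsub>C\<^esub> f n))))"
    by (simp add: dual_act_eq[OF h dual_prod_closed[OF f g]]) (simp add: dual_prod)
  also have "\<dots> = sw A h (\<lambda>x y. actA y (sw A x (\<lambda>u v. cw A c (\<lambda>m n.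
      g (actC (Sinv v) m \<triangleleft>\<^bsub>C\<^esub> f (actC (Sinv u) n))))))"
    by (rule tcong, subst cw_Sinv_act[OF _ dual_prod_balanced[OF f g] dual_prod_bilin[OF f g]]) simp_all
  also have "\<dots> = sw A h (\<lambda>x y. sw A x (\<lambda>u v. actA y (cw A c (\<lambda>m n.
      g (actC (Sinv v) m \<triangleleft>\<^bsub>C\<^esub> f (actC (Sinv u) n))))))"
    by (rule tcong, rule sw_compose) (auto intro!: rules)
  \<comment> \<open>The unit enters through \<open>A.act_one\<close>, to reach the right side of
    \<open>sw_cancel_middle\<close>.\<close>
  also have "\<dots> = sw A h (\<lambda>x y. sw A x (\<lambda>u t. cw A c (\<lambda>m n. ?Q m n u \<one>\<^bsub>H\<^esub> t y)))"
    by (rule tcong, rule tcong, subst cw_compose) (auto intro!: rules simp: A.act_one)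
  \<comment> \<open>The sum over \<open>c\<close> moves outward, because the cancellation is applied
    for each pair \<open>m\<close>, \<open>n\<close> separately.\<close>
  also have "\<dots> = sw A h (\<lambda>x y. cw A c (\<lambda>m n. sw A x (\<lambda>u t. ?Q m n u \<one>\<^bsub>H\<^esub> t y)))"
    by (rule tcong, rule cw_sw_swap[symmetric]) simp_all
  also have "\<dots> = cw A c (\<lambda>m n. sw A h (\<lambda>x y. sw A x (\<lambda>u t. ?Q m n u \<one>\<^bsub>H\<^esub> t y)))"
    by (rule cw_sw_swap[symmetric]) simp_all
  also have "\<dots> = cw A c (\<lambda>m n. sw A h (\<lambda>p q. sw A q (\<lambda>x y. sw A x (\<lambda>s t. sw A p (\<lambda>u v.
      ?Q m n u (Sinv s \<otimes>\<^bsub>H\<^esub> v) t y)))))"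
    by (rule tcong, rule sw_cancel_middle[symmetric]) (auto intro!: rules)
  also have "\<dots> = cw A c (\<lambda>m n. sw A h (\<lambda>p q. dact q g (m \<triangleleft>\<^bsub>C\<^esub> dact p f n)))"
  proof (rule tcong, rule tcong)
    fix m n p q assume [simp]: "m \<in> carrier C" "n \<in> carrier C" "p \<in> carrier H" "q \<in> carrier H"
    let ?k = "sw A p (\<lambda>u v. actA v (f (actC (Sinv u) n)))"
    have "dact q g (m \<triangleleft>\<^bsub>C\<^esub> dact p f n) = sw A q (\<lambda>x y. actA y (g (actC (Sinv x) (m \<triangleleft>\<^bsub>C\<^esub> ?k))))"
      by (simp add: dual_act_eq)
    \<comment> \<open>The legs of \<open>Sinv x\<close> come interchanged: the earlier leg
      \<open>s\<close> goes to \<open>?k\<close>, the later leg \<open>t\<close> to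
      \<open>m\<close>.\<close>
    also have "\<dots> = sw A q (\<lambda>x y. sw A x (\<lambda>s t. actA y (g (actC (Sinv t) m \<triangleleft>\<^bsub>C\<^esub> actA (Sinv s) ?k))))"
      by (rule tcong, rule klin_Sinv_ract[where \<phi> = "\<lambda>z. actA _ (g z)"]) (auto intro!: rules)
    also have "\<dots> = sw A q (\<lambda>x y. sw A x (\<lambda>s t. sw A p (\<lambda>u v.
        actA y (g (actC (Sinv t) m \<triangleleft>\<^bsub>C\<^esub> actA (Sinv s) (actA v (f (actC (Sinv u) n))))))))"
      by (rule tcong, rule tcong,
          rule sw_compose[where f = "\<lambda>z. actA _ (g (actC (Sinv _) m \<triangleleft>\<^bsub>C\<^esub> actA (Sinv _) z))"])
         (auto intro!: rules)
    finally show "sw A q (\<lambda>x y. sw A x (\<lambda>s t. sw A p (\<lambda>u v. ?Q m n u (Sinv s \<otimes>\<^bsub>H\<^esub> v) t y)))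
        = dact q g (m \<triangleleft>\<^bsub>C\<^esub> dact p f n)"
      by (simp add: A.act_mult)
  qed
  also have "\<dots> = sw A h (\<lambda>p q. cw A c (\<lambda>m n. dact q g (m \<triangleleft>\<^bsub>C\<^esub> dact p f n)))"
    by (rule cw_sw_swap) (simp_all add: dualD[OF dual_act_closed])
  also have "\<dots> = sw A h (\<lambda>p q. (dact p f \<otimes>\<^bsub>D\<^esub> dact q g) c)"
    by (rule tcong) (simp add: dual_prod)
  \<comment> \<open>Evaluation at \<open>c\<close> is linear on \<open>D\<close>, so a sum in
    \<open>D\<close> has the sum of the values as its value.\<close>
  also have "\<dots> = sw D h (\<lambda>p q. dact p f \<otimes>\<^bsub>D\<^esub> dact q g) c"
    by (rule sw_compose[where f = "\<lambda>f. f c", symmetric]) (simp_all add: dual_module klin_dual_eval)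
  finally show "dact h (f \<otimes>\<^bsub>D\<^esub> g) c = sw D h (\<lambda>p q. dact p f \<otimes>\<^bsub>D\<^esub> dact q g) c" .
qed (simp_all add: dual_act_closed dual_prod_closed sw_closed dual_module assms)

text \<open>Linearity of the counit gives \<open>h2 . ((Sinv(h1) . \<epsilon>(c)) a)\<close>, and
  the module algebra law of \<open>A\<close> makes the adjacent pair \<open>h2 Sinv(h1)\<close> act
  on \<open>\<epsilon>(c)\<close>.\<close>

lemma dual_act_emb:
  assumes h: "h \<in> carrier H" and a: "a \<in> carrier A"
  shows "dact h (dual_emb A C a) = dual_emb A C (actA h a)"
proof (rule dual_eqI)
  note [simp] = action_closed L.A.module_axioms h a
  fix c assume [simp]: "c \<in> carrier C"
  have "dact h (dual_emb A C a) c = sw A h (\<lambda>x y. actA y (actA (Sinv x) (counit C c) \<otimes>\<^bsub>A\<^esub> a))"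
    by (simp add: dual_act_eq dual_emb_closed) (simp add: dual_emb_def counit_H_linear)
  also have "\<dots> = sw A h (\<lambda>x y. sw A y (\<lambda>s t. actA (s \<otimes>\<^bsub>H\<^esub> Sinv x) (counit C c) \<otimes>\<^bsub>A\<^esub> actA t a))"
    by (rule tcong) (simp add: actA_prod A.act_mult)
  also have "\<dots> = actA \<one>\<^bsub>H\<^esub> (counit C c) \<otimes>\<^bsub>A\<^esub> actA h a"
    by (rule sw_cancel_left(1)[where F = "\<lambda>z t. actA z (counit C c) \<otimes>\<^bsub>A\<^esub> actA t a"])
       (auto intro!: action_rules)
  finally show "dact h (dual_emb A C a) c = dual_emb A C (actA h a) c"
    by (simp add: dual_emb_def A.act_one)
qed (simp_all add: dual_act_closed dual_emb_closed A.act_closed assms)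

lemma dual_module_algebra: "H_module_algebra K H D dact"
proof (intro H_module_algebra.intro H_module_algebra_axioms.intro dual_k_algebra dual_act_left_module)
  show "hopf_algebra K H" by (rule hopf_algebra_axioms)
  show "dact h (f \<otimes>\<^bsub>D\<^esub> g) = tensor_eval D (\<lambda>x y. dact x f \<otimes>\<^bsub>D\<^esub> dact y g) (hcomult H h)"
    if "h \<in> carrier H" "f \<in> carrier D" "g \<in> carrier D" for h f g
    using that by (simp add: dual_act_prod tensor_eval_sw dual_module dual_prod_closed dual_act_closed)
  \<comment> \<open>The unit of \<open>D\<close> is the image of the unit of \<open>A\<close>, from
    which the law is inherited.\<close>
  show "dact h \<one>\<^bsub>D\<^esub> = hcounit H h \<odot>\<^bsub>D\<^esub> \<one>\<^bsub>D\<^esub>" if "h \<in> carrier H" for h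
    using that dual_act_emb[of h "\<one>\<^bsub>A\<^esub>"]
    by (simp add: ring_hom_one[OF dual_emb_hom] A.act_unit dual_emb_smult)
qed

lemma dual_HA_bimodule: "HA_bimodule K H A actA D dact"
proof (intro HA_bimodule.intro HA_bimodule_axioms.intro dual_act_left_module dual_bimodule)
  note [simp] = dual_module dual_prod_closed dual_act_closed dual_emb_closed A.act_closed
  show "H_module_algebra K H A actA" by (rule A.H_module_algebra_axioms)
  fix h a f assume "h \<in> carrier H" "a \<in> carrier A" "f \<in> carrier D"
  then show "dact h (a \<triangleright>\<^bsub>D\<^esub> f) = tensor_eval D (\<lambda>x y. actA x a \<triangleright>\<^bsub>D\<^esub> dact y f) (hcomult H h)"
    and "dact h (f \<triangleleft>\<^bsub>D\<^esub> a) = tensor_eval D (\<lambda>x y. dact x f \<triangleleft>\<^bsub>D\<^esub> actA y a) (hcomult H h)"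
    by (simp_all add: dual_act_prod dual_act_emb dual_emb_left dual_emb_right
        tensor_eval_sw)
qed

end

theorem lemma2p9:
  fixes K :: "('k, 'x) ring_scheme"
    and H :: "('k, 'h, 'y) hopf_scheme"
    and A :: "('k, 'a, 'z) module_scheme" and actA :: "'h \<Rightarrow> 'a \<Rightarrow> 'a"
    and C :: "('k, 'a, 'c, 'w) coring_scheme" and actC :: "'h \<Rightarrow> 'c \<Rightarrow> 'c"
  assumes "cring K"
    and "hopf_algebra K H"
    and "bij_betw (antipode H) (carrier H) (carrier H)"
    and "H_module_algebra K H A actA"
    and "HA_coring K H A actA C actC"
  shows "HA_bimodule K H A actA (left_dual A C) (dual_act H A actA C actC) \<and>
    H_module_algebra K H (left_dual A C) (dual_act H A actA C actC) \<and>
    dual_emb A C \<in>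
      H_module_algebra_hom K H A actA (left_dual A C) (dual_act H A actA C actC) \<and>
    (\<forall>a \<in> carrier A. \<forall>f \<in> carrier (left_dual A C).
      a \<triangleright>\<^bsub>left_dual A C\<^esub> f = dual_emb A C a \<otimes>\<^bsub>left_dual A C\<^esub> f \<and>
      f \<triangleleft>\<^bsub>left_dual A C\<^esub> a = f \<otimes>\<^bsub>left_dual A C\<^esub> dual_emb A C a)"
proof -
  interpret bij_HA_coring K H A actA C actC
    using assms by (intro bij_HA_coring.intro bij_hopf_algebra.intro bij_hopf_algebra_axioms.intro)
  show ?thesis
    by (simp add: dual_HA_bimodule dual_module_algebra H_module_algebra_hom_def dual_emb_hom
        dual_emb_smult dual_act_emb dual_emb_left dual_emb_right)
qed

end
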